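(* Let $F\in\hat{\mathcal C}_{k,n}$, and let $M$ be the block diagonal Levi of the standard parabolic with unipotent radical $D_F$, with blocks $GL_{n_1},\dots,GL_{n_m}$ from the upper left corner downwards. Let $j$ be the upper left corner embedding of $GL_{n-n_m}$ in $GL_n$ and $N_m$ the unipotent radical of the standard parabolic subgroup with Levi $j(GL_{n-n_m})\times GL_{n_m}$. Then: (1) there is an AF $\bar F$ such that (a) $\bar F\in\hat{\mathcal C}^{\le}_{k,n}\cap'\mathcal B_n$ and $D_{\bar F}\subset j(SL_{n-n_m})N_m$, and (b) $J_F$ and $J_{\bar F}$ are conjugate by an element of $j(SL_{n-n_m})(k)$; (2) there is an $(\bar F\to F,\ j(SL_{n-n_m})N_m,\ k)$-path.
   Context: $\mathbb K$ algebraically closed of characteristic $0$, $k\subseteq\mathbb K$ a subfield. An additive function (AF) is a homomorphism $F:D_F\to(\mathbb K,+)$ of algebraic groups with $D_F$ a unipotent subgroup of $GL_n$; subscript $k$ means defined over $k$. $U_{(i,j)}$ is the root subgroup on entry $(i,j)$. For $F$ with domain generated by root subgroups, $J_F$ is the unique element of $\mathrm{Lie}(D_F)^t$ with $\mathrm{tr}(J_Fu)=F(\exp u)$ on $\mathrm{Lie}(D_F)$. $\mathcal C_{k,n}$: AFs over $k$ whose domain is the unipotent radical of a standard parabolic of $GL_n$. $\hat{\mathcal C}_{k,n}$: those $F\in\mathcal C_{k,n}$ such that whenever $F$ is nontrivial on $U_{(i,j)}$ and $U_{(i',j')}$, $(i,j)\ne(i',j')$, then $i\ne i'$ and $j\ne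 j'$. $\hat{\mathcal C}^{\le}_{k,n}$: those $F\in\hat{\mathcal C}_{k,n}$ for which the block sizes $n'_1,\dots,n'_s$ (from the upper left) of the Levi of the parabolic with unipotent radical $D_F$ satisfy $n'_1\le\dots\le n'_s$. For $\mathcal X\subseteq\mathcal C_{k,n}$, $\mathcal X\cap'\mathcal B_n$ is the set of $F\in\mathcal X$ with $J_F$ in the Richardson orbit of $D_F$ (the nilpotent orbit meeting $\mathrm{Lie}(D_F)$ in an open dense set). Steps over $k$ with input $F$: (e) for a unipotent $k$-subgroup $N\supsetneq D_F\supseteq[N,N]$, outputs all $k$-AFs $Z$ on $N$ with $Z|_{D_F}=F$; (eu) one output $Z$ with, for $C=D_F\cap D_Z\ne D_F$, $C\supseteq[D_F,D_F]\cup[D_Z,D_Z]\cup[D_F,D_Z]$, $F|_C=Z|_C$, and $C(k)\backslash D_F(k)$ acting freely and transitively by conjugation on the $k$-AFs $Q$ on $D_Z$ with $Q|_C=F|_C$; (co) one output $\gamma F$, $\gamma F(u)=F(\gamma^{-1}u\gamma)$, $\gamma\in GL_n(k)$. A path is a sequence of AFs $F_0,\dots,F_t$ such that each $F_i$ is an output of a step over $k$ with input $F_{i-1}$. An $(F'\to F,H,k)$-path has $F_0=F'$, $F_t=F$, all domains contained in $H$, and all co-steps by elements of $H(k)$. *)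

theory Defs
  imports "Jordan_Normal_Form.Determinant" "HOL-Algebra.Generated_Groups"
begin

text \<open>The type \<^typ>\<open>'a\<close> plays the role of the algebraically closed field; algebraic groups are
  identified with their groups of points over it.  Matrix indices start at 0.\<close>

definition GL :: "nat \<Rightarrow> 'a::field mat monoid" where
  "GL n = units_of (ring_mat TYPE('a) n ())"

definition is_subfield :: "'a::field set \<Rightarrow> bool" where
  "is_subfield k \<longleftrightarrow> 0 \<in> k \<and> 1 \<in> k \<and>
     (\<forall>x\<in>k. \<forall>y\<in>k. x + y \<in> k \<and> x - y \<in> k \<and> x * y \<in> k \<and> inverse x \<in> k)"

definition k_points :: "'a set \<Rightarrow> 'a mat set \<Rightarrow> 'a mat set" where
  "k_points k X = {A \<in> X. \<forall>i<dim_row A. \<forall>j<dim_col A. A $$ (i, j) \<in> k}"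

definition mat_trace :: "'a::comm_monoid_add mat \<Rightarrow> 'a" where
  "mat_trace A = (\<Sum>i<dim_row A. A $$ (i, i))"


subsection \<open>Algebraic subgroups\<close>

text \<open>Polynomial functions in the matrix entries, with coefficients in \<^term>\<open>k\<close>.\<close>

inductive_set poly_funs :: "'a::field set \<Rightarrow> nat \<Rightarrow> ('a mat \<Rightarrow> 'a) set"
  for k :: "'a set" and n :: nat where
  const: "c \<in> k \<Longrightarrow> (\<lambda>_. c) \<in> poly_funs k n"
| entry: "i < n \<Longrightarrow> j < n \<Longrightarrow> (\<lambda>A. A $$ (i, j)) \<in> poly_funs k n"
| add: "f \<in> poly_funs k n \<Longrightarrow> g \<in> poly_funs k n \<Longrightarrow> (\<lambda>A. f A + g A) \<in> poly_funs k n"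
| mult: "f \<in> poly_funs k n \<Longrightarrow> g \<in> poly_funs k n \<Longrightarrow> (\<lambda>A. f A * g A) \<in> poly_funs k n"

definition zariski_closed :: "nat \<Rightarrow> 'a::field mat set \<Rightarrow> bool" where
  "zariski_closed n X \<longleftrightarrow>
     (\<exists>S\<subseteq>poly_funs UNIV n. X = {A \<in> carrier_mat n n. \<forall>f\<in>S. f A = 0})"

definition vanishing :: "'a::field set \<Rightarrow> nat \<Rightarrow> 'a mat set \<Rightarrow> ('a mat \<Rightarrow> 'a) set" where
  "vanishing k n X = {f \<in> poly_funs k n. \<forall>A\<in>X. f A = 0}"

text \<open>The vanishing ideal is generated by its elements with coefficients in \<^term>\<open>k\<close>.  Polynomial
  functions are compared on \<^term>\<open>carrier_mat n n\<close> only.\<close>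

definition defined_over :: "'a::field set \<Rightarrow> nat \<Rightarrow> 'a mat set \<Rightarrow> bool" where
  "defined_over k n X \<longleftrightarrow>
     (\<forall>f\<in>vanishing UNIV n X. \<exists>r h g.
        (\<forall>i<r. h i \<in> poly_funs UNIV n \<and> g i \<in> vanishing k n X) \<and>
        (\<forall>A\<in>carrier_mat n n. f A = (\<Sum>i<(r::nat). h i A * g i A)))"

definition nilpotent_mat :: "nat \<Rightarrow> 'a::field mat \<Rightarrow> bool" where
  "nilpotent_mat n X \<longleftrightarrow> X \<in> carrier_mat n n \<and> (\<exists>m. X ^\<^sub>m m = 0\<^sub>m n n)"

text \<open>Unipotent algebraic subgroups of \<^term>\<open>GL n\<close> defined over \<^term>\<open>k\<close>.\<close>

definition unipotent_subgroup :: "'a::field set \<Rightarrow> nat \<Rightarrow> 'a mat set \<Rightarrow> bool" where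
  "unipotent_subgroup k n D \<longleftrightarrow>
     subgroup D (GL n) \<and>
     (\<exists>X. zariski_closed n X \<and> D = carrier (GL n) \<inter> X) \<and>
     defined_over k n D \<and>
     (\<forall>g\<in>D. nilpotent_mat n (g - 1\<^sub>m n))"

definition commutator :: "nat \<Rightarrow> 'a::field mat set \<Rightarrow> 'a mat set \<Rightarrow> 'a mat set" where
  "commutator n A B =
     generate (GL n) {a * b * inv\<^bsub>GL n\<^esub> a * inv\<^bsub>GL n\<^esub> b | a b. a \<in> A \<and> b \<in> B}"

text \<open>The Zariski tangent space at the identity: for a polynomial function \<open>f\<close>, the coefficient
  of \<open>t\<close> in \<open>f (1 + t X)\<close> is the value at \<open>X\<close> of the differential of \<open>f\<close> at the identity.\<close>

definition Lie :: "nat \<Rightarrow> 'a::field mat set \<Rightarrow> 'a mat set" where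
  "Lie n D = {X \<in> carrier_mat n n. \<forall>f\<in>vanishing UNIV n D. \<forall>p::'a poly.
     (\<forall>t. poly p t = f (1\<^sub>m n + t \<cdot>\<^sub>m X)) \<longrightarrow> coeff p 1 = 0}"

text \<open>The exponential of a nilpotent \<open>n \<times> n\<close> matrix; the remaining terms vanish.\<close>

definition mat_exp :: "nat \<Rightarrow> 'a::field_char_0 mat \<Rightarrow> 'a mat" where
  "mat_exp n X = mat n n (\<lambda>(i, j). \<Sum>m<n. (X ^\<^sub>m m) $$ (i, j) / fact m)"


subsection \<open>Additive functions\<close>

text \<open>An additive function \<open>F\<close> is a partial function on matrices, \<^term>\<open>dom F\<close> being its domain
  \<open>D_F\<close>, and \<^term>\<open>F |` C\<close> its restriction to \<open>C\<close>.  A unipotent subgroup is contained in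
  \<open>SL_n\<close>, hence its regular functions over \<open>k\<close> are the restrictions of polynomial functions
  over \<open>k\<close> in the entries.\<close>

type_synonym 'a af = "'a mat \<Rightarrow> 'a option"

definition AF :: "'a::field set \<Rightarrow> nat \<Rightarrow> 'a af \<Rightarrow> bool" where
  "AF k n F \<longleftrightarrow>
     unipotent_subgroup k n (dom F) \<and>
     (\<exists>f\<in>poly_funs k n. \<forall>u\<in>dom F. F u = Some (f u)) \<and>
     (\<forall>u\<in>dom F. \<forall>v\<in>dom F. the (F (u * v)) = the (F u) + the (F v))"

text \<open>\<open>(g F)(u) = F (g\<^sup>-\<^sup>1 u g)\<close>, with domain \<open>g D_F g\<^sup>-\<^sup>1\<close>.\<close>

definition conj_af :: "nat \<Rightarrow> 'a::field mat \<Rightarrow> 'a af \<Rightarrow> 'a af" where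
  "conj_af n g F = (\<lambda>u. F (inv\<^bsub>GL n\<^esub> g * u * g)) |` carrier_mat n n"

definition root_subgroup :: "nat \<Rightarrow> nat \<Rightarrow> nat \<Rightarrow> 'a::field mat set" where
  "root_subgroup n i j =
     {mat n n (\<lambda>(a, b). if a = b then 1 else if a = i \<and> b = j then c else 0) | c. True}"

definition nontrivial_on_root :: "nat \<Rightarrow> 'a::field af \<Rightarrow> nat \<Rightarrow> nat \<Rightarrow> bool" where
  "nontrivial_on_root n F i j \<longleftrightarrow> i < n \<and> j < n \<and> i \<noteq> j \<and>
     root_subgroup n i j \<subseteq> dom F \<and> (\<exists>u\<in>root_subgroup n i j. F u \<noteq> Some 0)"

definition J_of :: "nat \<Rightarrow> 'a::field_char_0 af \<Rightarrow> 'a mat" where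
  "J_of n F = (THE J. J \<in> transpose_mat ` Lie n (dom F) \<and>
     (\<forall>u\<in>Lie n (dom F). mat_trace (J * u) = the (F (mat_exp n u))))"


subsection \<open>Standard parabolics and the classes of additive functions\<close>

definition composition :: "nat \<Rightarrow> nat list \<Rightarrow> bool" where
  "composition n ns \<longleftrightarrow> sum_list ns = n \<and> (\<forall>a\<in>set ns. 0 < a)"

text \<open>Row \<open>i\<close> belongs to an earlier block than column \<open>j\<close>.\<close>

definition earlier_block :: "nat list \<Rightarrow> nat \<Rightarrow> nat \<Rightarrow> bool" where
  "earlier_block ns i j \<longleftrightarrow>
     (\<exists>p\<le>length ns. i < sum_list (take p ns) \<and> sum_list (take p ns) \<le> j)"

text \<open>The unipotent radical of the standard (block upper triangular) parabolic subgroup whose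
  diagonal blocks have sizes \<open>ns\<close>, from the upper left corner.\<close>

definition unip_radical :: "nat \<Rightarrow> nat list \<Rightarrow> 'a::field mat set" where
  "unip_radical n ns = {A \<in> carrier_mat n n. \<forall>i<n. \<forall>j<n.
     \<not> earlier_block ns i j \<longrightarrow> A $$ (i, j) = (if i = j then 1 else 0)}"

definition C_class :: "'a::field set \<Rightarrow> nat \<Rightarrow> 'a af set" where
  "C_class k n = {F. AF k n F \<and> (\<exists>ns. composition n ns \<and> dom F = unip_radical n ns)}"

definition C_hat :: "'a::field set \<Rightarrow> nat \<Rightarrow> 'a af set" where
  "C_hat k n = {F \<in> C_class k n. \<forall>i j i' j'.
     nontrivial_on_root n F i j \<and> nontrivial_on_root n F i' j' \<and> (i, j) \<noteq> (i', j')
       \<longrightarrow> i \<noteq> i' \<and> j \<noteq> j'}"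

definition C_hat_le :: "'a::field set \<Rightarrow> nat \<Rightarrow> 'a af set" where
  "C_hat_le k n = {F \<in> C_hat k n.
     \<exists>ns. composition n ns \<and> dom F = unip_radical n ns \<and> sorted ns}"

text \<open>A nilpotent orbit whose intersection with \<open>Lie(D)\<close> is open and dense in \<open>Lie(D)\<close>.\<close>

definition richardson_orbit :: "nat \<Rightarrow> 'a::field mat set \<Rightarrow> 'a mat set \<Rightarrow> bool" where
  "richardson_orbit n D Orb \<longleftrightarrow>
     (\<exists>X. nilpotent_mat n X \<and> Orb = {Y. similar_mat Y X}) \<and>
     (\<exists>Z. zariski_closed n Z \<and> Orb \<inter> Lie n D = Lie n D - Z) \<and>
     (\<forall>Z. zariski_closed n Z \<and> Orb \<inter> Lie n D \<subseteq> Z \<longrightarrow> Lie n D \<subseteq> Z)"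

definition cap_B :: "nat \<Rightarrow> 'a::field_char_0 af set \<Rightarrow> 'a af set" where
  "cap_B n \<X> = {F \<in> \<X>. \<exists>Orb. richardson_orbit n (dom F) Orb \<and> J_of n F \<in> Orb}"


subsection \<open>Steps and paths\<close>

definition e_step :: "'a::field set \<Rightarrow> nat \<Rightarrow> 'a af \<Rightarrow> 'a af \<Rightarrow> bool" where
  "e_step k n F Z \<longleftrightarrow>
     (\<exists>N. unipotent_subgroup k n N \<and> dom F \<subset> N \<and> commutator n N N \<subseteq> dom F \<and>
        AF k n Z \<and> dom Z = N \<and> Z |` dom F = F)"

text \<open>The stabilizer condition below says both that conjugation by \<open>D_F(k)\<close> factors through
  \<open>C(k)\D_F(k)\<close> and that the resulting action is free.\<close>

definition eu_step :: "'a::field set \<Rightarrow> nat \<Rightarrow> 'a af \<Rightarrow> 'a af \<Rightarrow> bool" where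
  "eu_step k n F Z \<longleftrightarrow> AF k n Z \<and>
     (let C = dom F \<inter> dom Z;
          Qs = {Q. AF k n Q \<and> dom Q = dom Z \<and> Q |` C = F |` C};
          U = k_points k (dom F)
      in C \<noteq> dom F \<and>
         commutator n (dom F) (dom F) \<subseteq> C \<and>
         commutator n (dom Z) (dom Z) \<subseteq> C \<and>
         commutator n (dom F) (dom Z) \<subseteq> C \<and>
         F |` C = Z |` C \<and>
         (\<forall>u\<in>U. \<forall>Q\<in>Qs. conj_af n u Q \<in> Qs) \<and>
         (\<forall>u\<in>U. \<forall>Q\<in>Qs. conj_af n u Q = Q \<longleftrightarrow> u \<in> k_points k C) \<and>
         (\<forall>Q\<in>Qs. \<forall>Q'\<in>Qs. \<exists>u\<in>U. conj_af n u Q = Q'))"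

text \<open>Conjugating elements are taken from \<open>\<Gamma>\<close>; all of \<open>GL_n(k)\<close> gives the unrestricted steps.\<close>

definition co_step :: "nat \<Rightarrow> 'a::field mat set \<Rightarrow> 'a af \<Rightarrow> 'a af \<Rightarrow> bool" where
  "co_step n \<Gamma> F Z \<longleftrightarrow> (\<exists>\<gamma>\<in>\<Gamma>. Z = conj_af n \<gamma> F)"

definition af_step :: "'a::field set \<Rightarrow> nat \<Rightarrow> 'a mat set \<Rightarrow> 'a af \<Rightarrow> 'a af \<Rightarrow> bool" where
  "af_step k n \<Gamma> F Z \<longleftrightarrow> e_step k n F Z \<or> eu_step k n F Z \<or> co_step n \<Gamma> F Z"

text \<open>\<open>Fs\<close> is an \<open>(F' \<rightarrow> F, H, k)\<close>-path; a single additive function is a path of length 0.\<close>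

definition af_path ::
    "'a::field set \<Rightarrow> nat \<Rightarrow> 'a mat set \<Rightarrow> 'a af \<Rightarrow> 'a af \<Rightarrow> 'a af list \<Rightarrow> bool" where
  "af_path k n H F' F Fs \<longleftrightarrow> Fs \<noteq> [] \<and> hd Fs = F' \<and> last Fs = F \<and>
     (\<forall>Z\<in>set Fs. AF k n Z \<and> dom Z \<subseteq> H) \<and>
     (\<forall>i. Suc i < length Fs \<longrightarrow>
        af_step k n (k_points k (H \<inter> carrier (GL n))) (Fs ! i) (Fs ! Suc i))"

text \<open>The image of \<open>SL_r\<close> in \<open>GL_n\<close> under the upper left corner embedding.\<close>

definition corner_SL :: "nat \<Rightarrow> nat \<Rightarrow> 'a::field mat set" where
  "corner_SL n r =
     {four_block_mat A (0\<^sub>m r (n - r)) (0\<^sub>m (n - r) r) (1\<^sub>m (n - r)) | A.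
        A \<in> carrier_mat r r \<and> det A = 1}"

end

theory Submission
  imports Defs
begin

text \<open>An additive function on a unipotent group spanned by root subgroups is a linear form in the
  matrix entries.  For \<open>F\<close> as in the theorem its nonzero coefficients \<open>c i j\<close> are the edges
  \<open>i \<rightarrow> j\<close> of a disjoint union of chains, each of which runs through consecutive blocks.  Shifting
  all chains to the right until they end in the last block, and sorting the basis vectors by the
  new block index with a monomial matrix that fixes the last block, gives \<open>Fbar\<close>.  Its block sizes
  count the chains of at least a given length, so they increase; and since every vertex outside the
  last block has a successor, a block upper triangular \<open>X\<close> is generically conjugate to the
  coefficient matrix.

  For the path, the same linear form is restricted to changing domains.  Shifting some of the
  chains to the left by one block removes the roots \<open>(p, q)\<close> with \<open>p\<close> fixed, \<open>q\<close> moving and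
  \<open>q\<close> one block after \<open>p\<close>, and adds the roots \<open>(q, p')\<close> with \<open>q\<close> and \<open>p'\<close> previously in the same
  block.  The commutator pairs \<open>(p, q)\<close> with \<open>(q, p')\<close> for every edge \<open>p \<rightarrow> p'\<close>, so the roots can be
  exchanged one at a time by eu-steps; an e-step adds the new roots that are left over.\<close>


section \<open>Pattern groups\<close>

text \<open>The domains between the two ends are in general neither upper triangular nor radicals of
  parabolics. Hence everything is set up for groups attached to an arbitrary strict order on the
  indices. A linear form is additive on such a group exactly when no edge
  \<open>i \<rightarrow> j\<close> is a composite of two roots of the domain. This condition forces
  the edges of \<open>F\<close> to join neighbouring blocks, and it dictates the order of the
  exchanges: a pair \<open>(p, q)\<close> has to go before the pair of its predecessors. The
  exchanges need a successor for every fixed \<open>p\<close> that loses a root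
  \<open>(p, q)\<close>. Right justification provides it: after \<open>q\<close> rounds of shifting,
  the chains still on the move end at level at most \<open>M - q\<close>, while a vertex without
  successor that has stopped has level at least \<open>M - q\<close>, too high to be the
  \<open>p\<close> of a lost root. Vertices of the last block never move and are never the row of a
  root, which keeps all domains in \<open>H\<close>. The Richardson orbit is found for the
  coefficient matrix, but \<open>J_F\<close> is its transpose; reversing the chains conjugates one
  to the other.\<close>

lemma mult_mat_index:
  assumes "A \<in> carrier_mat n m" "B \<in> carrier_mat m q" "i < n" "j < q"
  shows "(A * B) $$ (i, j) = (\<Sum>l<m. A $$ (i, l) * B $$ (l, j))"
  using assms by (auto simp: scalar_prod_def lessThan_atLeast0 intro!: sum.cong)

lemma sum_unit:
  fixes g :: "nat \<Rightarrow> 'a::semiring_1"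
  assumes "i < n"
  shows "(\<Sum>l<n. of_bool (i = l) * g l) = g i" "(\<Sum>l<n. g l * of_bool (l = i)) = g i"
proof -
  have "(\<Sum>l<n. of_bool (i = l) * g l) = (\<Sum>l<n. if i = l then g l else 0)"
    by (rule sum.cong) auto
  then show "(\<Sum>l<n. of_bool (i = l) * g l) = g i" using assms by simp
  have "(\<Sum>l<n. g l * of_bool (l = i)) = (\<Sum>l<n. if l = i then g l else 0)"
    by (rule sum.cong) auto
  then show "(\<Sum>l<n. g l * of_bool (l = i)) = g i" using assms by simp
qed

text \<open>A strict order stands for a closed set of roots: transitivity gives closure under
  products, and together with irreflexivity it makes the group unipotent. It may disagree with the
  order of the indices as numbers.\<close>

definition root_pattern :: "nat \<Rightarrow> (nat \<times> nat) set \<Rightarrow> bool" where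
  "root_pattern n R \<longleftrightarrow> R \<subseteq> {..<n} \<times> {..<n} \<and> trans R \<and> irrefl R"

definition pattern_group :: "nat \<Rightarrow> (nat \<times> nat) set \<Rightarrow> 'a::field mat set" where
  "pattern_group n R = {A \<in> carrier_mat n n. \<forall>i<n. \<forall>j<n.
     (i, j) \<notin> R \<longrightarrow> A $$ (i, j) = (if i = j then 1 else 0)}"

definition pattern_algebra :: "nat \<Rightarrow> (nat \<times> nat) set \<Rightarrow> 'a::field mat set" where
  "pattern_algebra n R = {X \<in> carrier_mat n n. \<forall>i<n. \<forall>j<n. (i, j) \<notin> R \<longrightarrow> X $$ (i, j) = 0}"

text \<open>For \<open>A\<close> in the group of \<open>R\<close> these are the entries of
  \<open>A - 1\<close>. The value 0 off \<open>R\<close> lets product formulas sum over all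
  indices.\<close>

definition off :: "(nat \<times> nat) set \<Rightarrow> 'a::field mat \<Rightarrow> nat \<Rightarrow> nat \<Rightarrow> 'a" where
  "off R A i j = (if (i, j) \<in> R then A $$ (i, j) else 0)"

definition root_elem :: "nat \<Rightarrow> nat \<Rightarrow> nat \<Rightarrow> 'a::field \<Rightarrow> 'a mat" where
  "root_elem n i j t = mat n n (\<lambda>(a, b). if a = b then 1 else if a = i \<and> b = j then t else 0)"

text \<open>A rank function of the order, strictly increasing along \<open>R\<close> and below
  \<open>n\<close>; it takes over the role that the index itself has for triangular
  matrices.\<close>

definition pattern_height :: "(nat \<times> nat) set \<Rightarrow> nat \<Rightarrow> nat" where
  "pattern_height R i = card {l. (l, i) \<in> R}"

lemma root_patternD:
  assumes "root_pattern n R"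
  shows "(i, j) \<in> R \<Longrightarrow> i < n" "(i, j) \<in> R \<Longrightarrow> j < n" "(i, i) \<notin> R"
    "(i, j) \<in> R \<Longrightarrow> (j, l) \<in> R \<Longrightarrow> (i, l) \<in> R" "(i, j) \<in> R \<Longrightarrow> i \<noteq> j" "finite R"
proof -
  show "finite R" using assms finite_subset[of R "{..<n} \<times> {..<n}"] by (auto simp: root_pattern_def)
qed (use assms in \<open>auto simp: root_pattern_def irrefl_def dest: transD\<close>)

lemma pattern_height_less:
  assumes R: "root_pattern n R" and ij: "(i, j) \<in> R"
  shows "pattern_height R i < pattern_height R j"
  unfolding pattern_height_def
proof (rule psubset_card_mono)
  show "finite {l. (l, j) \<in> R}"
    by (rule finite_subset[of _ "{..<n}"]) (auto dest: root_patternD(1)[OF R])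
  show "{l. (l, i) \<in> R} \<subset> {l. (l, j) \<in> R}"
    using ij root_patternD(3)[OF R] root_patternD(4)[OF R] by blast
qed

lemma pattern_height_bound:
  assumes R: "root_pattern n R" and j: "j < n"
  shows "pattern_height R j < n"
proof -
  have "{l. (l, j) \<in> R} \<subseteq> {..<n} - {j}"
    using root_patternD(1,3)[OF R] by blast
  then have "pattern_height R j \<le> card ({..<n} - {j})"
    unfolding pattern_height_def by (intro card_mono) auto
  then show ?thesis using j by simp
qed

lemma pattern_groupD:
  assumes "A \<in> pattern_group n R"
  shows "A \<in> carrier_mat n n" "dim_row A = n" "dim_col A = n"
    "i < n \<Longrightarrow> j < n \<Longrightarrow> (i, j) \<notin> R \<Longrightarrow> A $$ (i, j) = (if i = j then 1 else 0)"
  using assms by (auto simp: pattern_group_def)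

lemma pattern_group_mono: "R \<subseteq> R' \<Longrightarrow> pattern_group n R \<subseteq> pattern_group n R'"
  unfolding pattern_group_def by blast

lemma pattern_group_Int: "pattern_group n R \<inter> pattern_group n R' = pattern_group n (R \<inter> R')"
  unfolding pattern_group_def by blast

lemma pattern_group_entry:
  assumes "root_pattern n R" "A \<in> pattern_group n R" "i < n" "j < n"
  shows "A $$ (i, j) = of_bool (i = j) + off R A i j"
  using assms root_patternD(3)[of n R] by (auto simp: off_def pattern_group_def)

lemma pattern_group_mult_entry:
  assumes R: "root_pattern n R" "root_pattern n R'"
    and A: "A \<in> pattern_group n R" and B: "B \<in> pattern_group n R'" and ij: "i < n" "j < n"
  shows "(A * B) $$ (i, j) =
    of_bool (i = j) + off R A i j + off R' B i j + (\<Sum>l<n. off R A i l * off R' B l j)"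
proof -
  have "(A * B) $$ (i, j) = (\<Sum>l<n. A $$ (i, l) * B $$ (l, j))"
    using A B ij by (intro mult_mat_index) (auto dest: pattern_groupD)
  also have "\<dots> = (\<Sum>l<n. of_bool (i = l) * of_bool (l = j) + of_bool (i = l) * off R' B l j
      + off R A i l * of_bool (l = j) + off R A i l * off R' B l j)"
    by (rule sum.cong)
      (use ij in \<open>auto simp: pattern_group_entry[OF R(1) A] pattern_group_entry[OF R(2) B] algebra_simps\<close>)
  also have "\<dots> = of_bool (i = j) + off R A i j + off R' B i j + (\<Sum>l<n. off R A i l * off R' B l j)"
    using ij by (simp only: sum.distrib sum_unit add.assoc) (simp only: ac_simps)
  finally show ?thesis .
qed

lemma pattern_group_mult:
  assumes R: "root_pattern n R" and A: "A \<in> pattern_group n R" and B: "B \<in> pattern_group n R"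
  shows "A * B \<in> pattern_group n R"
proof -
  have "(\<Sum>l<n. off R A i l * off R B l j) = 0" if "(i, j) \<notin> R" for i j
    using that root_patternD(4)[OF R] by (intro sum.neutral) (auto simp: off_def)
  then show ?thesis
    using A B unfolding pattern_group_def[of n R]
    by (auto simp: pattern_group_mult_entry[OF R R A B] off_def dest: pattern_groupD(2,3))
qed

lemma one_in_pattern_group: "1\<^sub>m n \<in> pattern_group n R"
  by (auto simp: pattern_group_def)

lemma root_elem_in_pattern_group: "(i, j) \<in> R \<Longrightarrow> root_elem n i j t \<in> pattern_group n R"
  by (auto simp: pattern_group_def root_elem_def)

lemma root_elem_mult_right:
  assumes "A \<in> carrier_mat n n" "i < n" "i \<noteq> j" "a < n" "b < n"
  shows "(A * root_elem n i j t) $$ (a, b) = A $$ (a, b) + (if b = j then t * A $$ (a, i) else 0)"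
proof -
  have "(A * root_elem n i j t) $$ (a, b) = (\<Sum>l<n. A $$ (a, l) * root_elem n i j t $$ (l, b))"
    using assms by (intro mult_mat_index) (auto simp: root_elem_def)
  also have "\<dots> = (\<Sum>l<n. A $$ (a, l) * (if l = b then 1 else 0) + A $$ (a, l) * (if l = i \<and> b = j then t else 0))"
    using assms by (intro sum.cong) (auto simp: root_elem_def)
  also have "\<dots> = (\<Sum>l<n. if l = b then A $$ (a, l) else 0)
      + (if b = j then (\<Sum>l<n. if l = i then A $$ (a, l) * t else 0) else 0)"
    by (auto simp: sum.distrib if_distrib[of "(*) _"] cong: if_cong)
  also have "\<dots> = A $$ (a, b) + (if b = j then t * A $$ (a, i) else 0)"
    using assms by (simp add: sum.delta mult.commute)
  finally show ?thesis .
qed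

definition restrict_pattern :: "nat \<Rightarrow> (nat \<times> nat) set \<Rightarrow> 'a::field mat \<Rightarrow> 'a mat" where
  "restrict_pattern n S A =
     mat n n (\<lambda>(a, b). if a = b then 1 else if (a, b) \<in> S then A $$ (a, b) else 0)"

lemma restrict_pattern_in: "S \<subseteq> R \<Longrightarrow> restrict_pattern n S A \<in> pattern_group n R"
  by (auto simp: restrict_pattern_def pattern_group_def)

lemma restrict_pattern_self:
  assumes "root_pattern n R" "A \<in> pattern_group n R"
  shows "restrict_pattern n R A = A"
  using assms by (intro eq_matI)
    (auto simp: restrict_pattern_def pattern_group_def root_patternD(3))

lemma restrict_pattern_empty: "restrict_pattern n {} A = 1\<^sub>m n"
  by (intro eq_matI) (auto simp: restrict_pattern_def)

text \<open>Adding positions by decreasing row height, \<open>1 + V\<close> becomes the product of the root elements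
  with exactly the entries of \<open>V\<close> as parameters.\<close>

lemma restrict_pattern_induct [consumes 2, case_names empty insert]:
  assumes R: "root_pattern n R" and "S \<subseteq> R"
    and empty: "P {}"
    and insert: "\<And>S i j. insert (i, j) S \<subseteq> R \<Longrightarrow> (i, j) \<notin> S \<Longrightarrow>
      restrict_pattern n (insert (i, j) S) A = restrict_pattern n S A * root_elem n i j (A $$ (i, j)) \<Longrightarrow>
      P S \<Longrightarrow> P (insert (i, j) S)"
  shows "P S"
proof -
  have "finite S" using \<open>S \<subseteq> R\<close> root_patternD(6)[OF R] finite_subset by blast
  then show ?thesis using \<open>S \<subseteq> R\<close>
  proof (induction S rule: finite_psubset_induct)
    case (psubset S)
    show ?case
    proof (cases "S = {}")
      case False
      define p where "p = arg_min_on (\<lambda>p. pattern_height R (fst p)) S"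
      have p: "p \<in> S" "\<And>q. q \<in> S \<Longrightarrow> pattern_height R (fst p) \<le> pattern_height R (fst q)"
        unfolding p_def using arg_min_if_finite[OF psubset(1) False, of "\<lambda>p. pattern_height R (fst p)"]
        by (auto simp: not_less)
      obtain i j where ij: "p = (i, j)" by fastforce
      define T where "T = S - {(i, j)}"
      have S: "S = insert (i, j) T" "(i, j) \<notin> T" using p(1) ij by (auto simp: T_def)
      have ijR: "(i, j) \<in> R" using S psubset.prems by auto
      note b = root_patternD(1,2,5)[OF R ijR]
      \<comment> \<open>Since the row height of \<open>(i, j)\<close> is minimal in
        \<open>S\<close>, column \<open>i\<close> of the restriction to \<open>T\<close> is still a
        unit column. Right multiplication by the root element therefore changes only the entry
        \<open>(i, j)\<close>.\<close>
      have no: "(a, i) \<notin> T" for a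
      proof
        assume "(a, i) \<in> T"
        then have "(a, i) \<in> S" by (simp add: S)
        then have "pattern_height R a < pattern_height R i"
          using psubset.prems by (intro pattern_height_less[OF R]) auto
        moreover have "pattern_height R i \<le> pattern_height R a" using p(2)[OF \<open>(a, i) \<in> S\<close>] ij by simp
        ultimately show False by simp
      qed
      have "restrict_pattern n S A = restrict_pattern n T A * root_elem n i j (A $$ (i, j))" (is "_ = ?B")
      proof (rule eq_matI)
        have c: "restrict_pattern n T A \<in> carrier_mat n n" by (simp add: restrict_pattern_def)
        have r: "root_elem n i j (A $$ (i, j)) \<in> carrier_mat n n" by (simp add: root_elem_def)
        show "dim_row (restrict_pattern n S A) = dim_row ?B" "dim_col (restrict_pattern n S A) = dim_col ?B"
          using c r by (auto simp: restrict_pattern_def)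
        fix a d assume "a < dim_row ?B" "d < dim_col ?B"
        then have "a < n" "d < n" using c r by auto
        then show "restrict_pattern n S A $$ (a, d) = ?B $$ (a, d)"
          using b no S by (subst root_elem_mult_right[OF c]) (auto simp: restrict_pattern_def)
      qed
      moreover have "P T" using psubset.IH[of T] psubset.prems S by auto
      ultimately show ?thesis using insert[of i j T] S psubset.prems by auto
    qed (simp add: empty)
  qed
qed

text \<open>Root elements are transvections, of determinant 1 and with inverse of opposite
  parameter; the factorization into root elements passes this on to the whole group.\<close>

lemma pattern_group_inverse:
  assumes R: "root_pattern n R" and A: "A \<in> pattern_group n R"
  obtains B where "B \<in> pattern_group n R" "A * B = 1\<^sub>m n" "B * A = 1\<^sub>m n" "det A = 1"
proof -
  let ?P = "\<lambda>A. \<exists>B\<in>pattern_group n R. A * B = 1\<^sub>m n \<and> B * A = 1\<^sub>m n \<and> det A = 1"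
  have P: "?P (restrict_pattern n S A)" if "S \<subseteq> R" for S
    using R that
  proof (induction S rule: restrict_pattern_induct[where A = A])
    case empty
    show ?case by (auto simp: restrict_pattern_empty one_in_pattern_group intro!: bexI[of _ "1\<^sub>m n"])
  next
    case (insert S i j)
    from insert.IH obtain B where B: "B \<in> pattern_group n R" "restrict_pattern n S A * B = 1\<^sub>m n"
      "B * restrict_pattern n S A = 1\<^sub>m n" "det (restrict_pattern n S A) = 1" by blast
    have ij: "(i, j) \<in> R" using insert by auto
    note b = root_patternD(1,2,5)[OF R ij]
    let ?E = "\<lambda>t. root_elem n i j t :: 'a mat"
    have EE: "?E s * ?E t = 1\<^sub>m n" if "s + t = 0" for s t
    proof (rule eq_matI)
      fix a d assume "a < dim_row (1\<^sub>m n :: 'a mat)" "d < dim_col (1\<^sub>m n :: 'a mat)"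
      then show "(?E s * ?E t) $$ (a, d) = 1\<^sub>m n $$ (a, d)"
        using b that by (subst root_elem_mult_right) (auto simp: root_elem_def)
    qed (auto simp: root_elem_def)
    have detE: "det (?E t) = 1" for t
    proof -
      have "?E t = addrow_mat n t i j"
        using b by (intro eq_matI) (auto simp: root_elem_def)
      then show ?thesis using b by (simp add: det_addrow_mat)
    qed
    have c [simp]: "restrict_pattern n S A \<in> carrier_mat n n" "B \<in> carrier_mat n n"
      "?E t \<in> carrier_mat n n" for t
      using B by (auto simp: restrict_pattern_def root_elem_def dest: pattern_groupD)
    let ?t = "A $$ (i, j)"
    have 1: "restrict_pattern n (insert (i, j) S) A * (?E (- ?t) * B) = 1\<^sub>m n"
    proof -
      have "restrict_pattern n S A * ?E ?t * (?E (- ?t) * B)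
          = restrict_pattern n S A * (?E ?t * ?E (- ?t)) * B"
        by (simp add: assoc_mult_mat[of _ n n _ n _ n] mult_carrier_mat[of _ n n _ n])
      then show ?thesis using EE[of ?t "- ?t"] insert B right_mult_one_mat[OF c(1)] by simp
    qed
    have 2: "(?E (- ?t) * B) * restrict_pattern n (insert (i, j) S) A = 1\<^sub>m n"
    proof -
      have "(?E (- ?t) * B) * (restrict_pattern n S A * ?E ?t)
          = ?E (- ?t) * (B * restrict_pattern n S A) * ?E ?t"
        by (simp add: assoc_mult_mat[of _ n n _ n _ n] mult_carrier_mat[of _ n n _ n])
      then show ?thesis using EE[of "- ?t" ?t] insert B right_mult_one_mat[OF c(3)] by simp
    qed
    show ?case
      using 1 2 insert B detE root_elem_in_pattern_group[OF ij]
      by (auto intro!: bexI[of _ "?E (- ?t) * B"] pattern_group_mult[OF R] simp: det_mult[of _ n])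
  qed
  show thesis using that P[OF order_refl] by (auto simp: restrict_pattern_self[OF R A])
qed

section \<open>The ambient general linear group and nilpotence\<close>

lemma GL_carrier_iff:
  "A \<in> carrier (GL n) \<longleftrightarrow> A \<in> carrier_mat n n \<and> (\<exists>B\<in>carrier_mat n n. A * B = 1\<^sub>m n \<and> B * A = 1\<^sub>m n)"
  by (auto simp: GL_def units_of_def Units_def ring_mat_def)

lemma GL_mult [simp]: "x \<otimes>\<^bsub>GL n\<^esub> y = x * y" and GL_one [simp]: "\<one>\<^bsub>GL n\<^esub> = 1\<^sub>m n"
  by (auto simp: GL_def units_of_def ring_mat_def)

lemma GL_group: "group (GL n :: 'a::field mat monoid)"
proof -
  interpret ring "ring_mat TYPE('a) n ()" by (rule ring_mat)
  show ?thesis unfolding GL_def by (rule units_group)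
qed

lemma GL_inv_eqI:
  fixes A B :: "'a::field mat"
  assumes "A \<in> carrier_mat n n" "B \<in> carrier_mat n n" "A * B = 1\<^sub>m n" "B * A = 1\<^sub>m n"
  shows "A \<in> carrier (GL n)" "B \<in> carrier (GL n)" "inv\<^bsub>GL n\<^esub> A = B"
proof -
  interpret group "GL n :: 'a mat monoid" by (rule GL_group)
  show "A \<in> carrier (GL n)" "B \<in> carrier (GL n)" using assms by (auto simp: GL_carrier_iff)
  then show "inv\<^bsub>GL n\<^esub> A = B" using assms by (intro inv_equality) auto
qed

lemma pattern_group_inv:
  assumes R: "root_pattern n R" and A: "A \<in> pattern_group n R"
  shows "A \<in> carrier (GL n)" "inv\<^bsub>GL n\<^esub> A \<in> pattern_group n R"
    "A * inv\<^bsub>GL n\<^esub> A = 1\<^sub>m n" "inv\<^bsub>GL n\<^esub> A * A = 1\<^sub>m n" "det A = 1"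
proof -
  obtain B where B: "B \<in> pattern_group n R" "A * B = 1\<^sub>m n" "B * A = 1\<^sub>m n" "det A = 1"
    by (rule pattern_group_inverse[OF R A])
  have "A \<in> carrier (GL n)" "inv\<^bsub>GL n\<^esub> A = B"
    using GL_inv_eqI[of A n B] B A by (auto dest: pattern_groupD)
  with B show "A \<in> carrier (GL n)" "inv\<^bsub>GL n\<^esub> A \<in> pattern_group n R"
    "A * inv\<^bsub>GL n\<^esub> A = 1\<^sub>m n" "inv\<^bsub>GL n\<^esub> A * A = 1\<^sub>m n" "det A = 1" by auto
qed

lemma pattern_group_subgroup:
  assumes R: "root_pattern n R"
  shows "subgroup (pattern_group n R) (GL n :: 'a::field mat monoid)"
proof -
  interpret group "GL n :: 'a mat monoid" by (rule GL_group)
  show ?thesis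
    using pattern_group_inv[OF R] pattern_group_mult[OF R] one_in_pattern_group[of n R]
    by (intro subgroupI) auto
qed

text \<open>Every factor \<open>X\<close> raises the height by at least one, so a nonzero entry
  \<open>(i, j)\<close> of the \<open>m\<close>-th power needs a height difference of at least
  \<open>m\<close>; heights are below \<open>n\<close>.\<close>

lemma pattern_nilpotent:
  assumes R: "root_pattern n R" and X: "X \<in> pattern_algebra n R"
  shows "X ^\<^sub>m n = 0\<^sub>m n n"
proof -
  have c: "X \<in> carrier_mat n n" using X by (simp add: pattern_algebra_def)
  have *: "(X ^\<^sub>m m) $$ (i, j) = 0"
    if "i < n" "j < n" "pattern_height R j < pattern_height R i + m" for i j m
    using that
  proof (induction m arbitrary: j)
    case 0
    then show ?case using c by auto
  next
    case (Suc m)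
    have "(X ^\<^sub>m m * X) $$ (i, j) = (\<Sum>l<n. (X ^\<^sub>m m) $$ (i, l) * X $$ (l, j))"
      using Suc.prems c by (intro mult_mat_index) auto
    also have "\<dots> = 0"
    proof (rule sum.neutral, rule ballI)
      fix l assume l: "l \<in> {..<n}"
      show "(X ^\<^sub>m m) $$ (i, l) * X $$ (l, j) = 0"
      proof (cases "(l, j) \<in> R")
        case True
        then have "(X ^\<^sub>m m) $$ (i, l) = 0"
          using pattern_height_less[OF R True] Suc.prems l by (intro Suc.IH) auto
        then show ?thesis by simp
      next
        case False
        then show ?thesis using X l Suc.prems by (auto simp: pattern_algebra_def)
      qed
    qed
    finally show ?case by simp
  qed
  show ?thesis
  proof (rule eq_matI)
    fix i j assume "i < dim_row (0\<^sub>m n n :: 'a mat)" "j < dim_col (0\<^sub>m n n :: 'a mat)"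
    then show "(X ^\<^sub>m n) $$ (i, j) = 0\<^sub>m n n $$ (i, j)"
      using *[of i j n] pattern_height_bound[OF R, of j] by simp
  qed (use c in auto)
qed

section \<open>Additive functions on pattern groups\<close>

lemma subfieldD:
  assumes "is_subfield k"
  shows "0 \<in> k" "1 \<in> k" "x \<in> k \<Longrightarrow> y \<in> k \<Longrightarrow> x + y \<in> k" "x \<in> k \<Longrightarrow> y \<in> k \<Longrightarrow> x - y \<in> k"
    "x \<in> k \<Longrightarrow> y \<in> k \<Longrightarrow> x * y \<in> k" "x \<in> k \<Longrightarrow> - x \<in> k" "x \<in> k \<Longrightarrow> y \<in> k \<Longrightarrow> x / y \<in> k"
proof -
  show "0 \<in> k" "1 \<in> k" "x \<in> k \<Longrightarrow> y \<in> k \<Longrightarrow> x + y \<in> k" "x \<in> k \<Longrightarrow> y \<in> k \<Longrightarrow> x - y \<in> k"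
    "x \<in> k \<Longrightarrow> y \<in> k \<Longrightarrow> x * y \<in> k" using assms by (auto simp: is_subfield_def)
  show "- x \<in> k" if "x \<in> k"
  proof -
    have "0 - x \<in> k" using assms that unfolding is_subfield_def by blast
    then show ?thesis by simp
  qed
  show "x / y \<in> k" if "x \<in> k" "y \<in> k"
    using assms that unfolding is_subfield_def divide_inverse by blast
qed

section \<open>Polynomial functions, closedness, fields of definition, Lie algebras\<close>

lemma poly_funs_sum:
  "0 \<in> k \<Longrightarrow> (\<And>i. i \<in> I \<Longrightarrow> f i \<in> poly_funs k n) \<Longrightarrow> (\<lambda>A. \<Sum>i\<in>I. f i A) \<in> poly_funs k n"
  by (induction I rule: infinite_finite_induct) (auto intro: poly_funs.const poly_funs.add)

lemma poly_funs_prod: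
  "1 \<in> k \<Longrightarrow> (\<And>i. i \<in> I \<Longrightarrow> f i \<in> poly_funs k n) \<Longrightarrow> (\<lambda>A. \<Prod>i\<in>I. f i A) \<in> poly_funs k n"
  by (induction I rule: infinite_finite_induct) (auto intro: poly_funs.const poly_funs.mult)

lemma poly_funs_value:
  assumes k: "is_subfield k" and f: "f \<in> poly_funs k n" and A: "\<And>i j. i < n \<Longrightarrow> j < n \<Longrightarrow> A $$ (i, j) \<in> k"
  shows "f A \<in> k"
  using f by induction (auto simp: A subfieldD[OF k])

text \<open>Passing to one variable makes the finiteness of roots available, for linearity on root
  subgroups and for density of the orbit.\<close>

lemma poly_funs_line:
  fixes f :: "'a::field mat \<Rightarrow> 'a"
  assumes f: "f \<in> poly_funs k n" and AB: "A \<in> carrier_mat n n" "B \<in> carrier_mat n n"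
  obtains p where "\<And>t. poly p t = f (A + t \<cdot>\<^sub>m B)"
proof -
  have "\<exists>p. \<forall>t. poly p t = f (A + t \<cdot>\<^sub>m B)" using f
  proof induction
    case (const c)
    show ?case by (rule exI[of _ "[:c:]"]) simp
  next
    case (entry i j)
    then show ?case using AB by (intro exI[of _ "[:A $$ (i, j), B $$ (i, j):]"]) auto
  next
    case (add f g)
    then obtain p q where "\<forall>t. poly p t = f (A + t \<cdot>\<^sub>m B)" "\<forall>t. poly q t = g (A + t \<cdot>\<^sub>m B)" by auto
    then show ?case by (intro exI[of _ "p + q"]) auto
  next
    case (mult f g)
    then obtain p q where "\<forall>t. poly p t = f (A + t \<cdot>\<^sub>m B)" "\<forall>t. poly q t = g (A + t \<cdot>\<^sub>m B)" by auto
    then show ?case by (intro exI[of _ "p * q"]) auto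
  qed
  then show thesis using that by blast
qed

lemma poly_funs_entry_minus:
  assumes "is_subfield k" "c \<in> k" "i < n" "j < n"
  shows "(\<lambda>A. A $$ (i, j) - c) \<in> poly_funs k n"
  using poly_funs.add[OF poly_funs.entry[OF assms(3,4)] poly_funs.const[of "- c" k]] assms(2)
    subfieldD(6)[OF assms(1)] by simp

lemma subfield_UNIV: "is_subfield UNIV"
  by (simp add: is_subfield_def)

lemma pattern_group_zariski_closed:
  "zariski_closed n (pattern_group n R :: 'a::field mat set)"
  unfolding zariski_closed_def
proof (intro exI conjI)
  let ?S = "{(\<lambda>A::'a mat. A $$ (i, j) - (if i = j then 1 else 0)) | i j. i < n \<and> j < n \<and> (i, j) \<notin> R}"
  show "?S \<subseteq> poly_funs UNIV n"
  proof
    fix f assume "f \<in> ?S"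
    then obtain i j where "f = (\<lambda>A. A $$ (i, j) - (if i = j then 1 else 0))" "i < n" "j < n" by blast
    then show "f \<in> poly_funs UNIV n" by (simp only: poly_funs_entry_minus[OF subfield_UNIV UNIV_I])
  qed
  show "pattern_group n R = {A \<in> carrier_mat n n. \<forall>f\<in>?S. f A = 0}"
  proof (intro equalityI subsetI)
    fix A :: "'a mat" assume "A \<in> {A \<in> carrier_mat n n. \<forall>f\<in>?S. f A = 0}"
    from CollectD[OF this] have A: "A \<in> carrier_mat n n" "\<And>f. f \<in> ?S \<Longrightarrow> f A = 0"
      by (rule conjunct1, elim conjE bspec)
    have "A $$ (i, j) - (if i = j then 1 else 0) = 0" if "i < n" "j < n" "(i, j) \<notin> R" for i j
      by (rule A(2)[of "\<lambda>A. A $$ (i, j) - (if i = j then 1 else 0)"]) (use that in auto)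
    then show "A \<in> pattern_group n R" using A(1) by (simp add: pattern_group_def)
  qed (auto simp: pattern_group_def)
qed

lemma poly_funs_restrict_pattern:
  assumes k: "is_subfield k" and f: "f \<in> poly_funs k n"
  shows "(\<lambda>A. f (restrict_pattern n R A)) \<in> poly_funs k n"
  using f
proof induction
  case (entry i j)
  consider "i = j" | "i \<noteq> j" "(i, j) \<in> R" | "i \<noteq> j" "(i, j) \<notin> R" by blast
  then show ?case
    by cases (use entry subfieldD[OF k] in \<open>auto simp: restrict_pattern_def intro: poly_funs.intros\<close>)
qed (auto intro: poly_funs.intros)

text \<open>Modulo the entries off the pattern (minus 1 on the diagonal), every polynomial function
  agrees with its composition with \<^const>\<open>restrict_pattern\<close>.\<close>

lemma pattern_group_defined_over:
  fixes k :: "'a::field set"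
  assumes k: "is_subfield k" and R: "root_pattern n R"
  shows "defined_over k n (pattern_group n R)"
  unfolding defined_over_def
proof (rule ballI)
  \<comment> \<open>Position \<open>(i, j)\<close> is coded as \<open>i * n + j\<close>, which gives
    the initial segment of indices that \<open>defined_over\<close> asks for; positions in
    \<open>R\<close> contribute the zero function.\<close>
  define gen where "gen l = (\<lambda>A::'a mat. if (l div n, l mod n) \<in> R then 0
    else A $$ (l div n, l mod n) - (if l div n = l mod n then 1 else 0))" for l
  let ?\<pi> = "restrict_pattern n R :: 'a mat \<Rightarrow> _"
  have pos: "l div n < n" "l mod n < n" if "l < n * n" for l
    using that by (auto simp: less_mult_imp_div_less intro!: mod_less_divisor gr0I)
  have gen: "gen l \<in> vanishing k n (pattern_group n R)" if "l < n * n" for l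
  proof -
    have "gen l \<in> poly_funs k n"
      using poly_funs_entry_minus[OF k _ pos[OF that]] subfieldD(1,2)[OF k]
      by (cases "(l div n, l mod n) \<in> R") (auto simp: gen_def intro: poly_funs.const)
    then show ?thesis using pos[OF that] by (auto simp: gen_def vanishing_def pattern_group_def)
  qed
  fix f :: "'a mat \<Rightarrow> 'a" assume "f \<in> vanishing UNIV n (pattern_group n R)"
  then have f: "f \<in> poly_funs UNIV n" and f0: "\<And>A. A \<in> pattern_group n R \<Longrightarrow> f A = 0"
    by (auto simp: vanishing_def)
  \<comment> \<open>The induction treats the difference of \<open>f\<close> and its composite with
    the retraction, because vanishing on the group does not pass to the parts of a sum or product.
    At the end the composite is zero everywhere, its argument being in the group.\<close>
  have "\<exists>h. (\<forall>l<n*n. h l \<in> poly_funs UNIV n) \<and>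
      (\<forall>A\<in>carrier_mat n n. f A - f (?\<pi> A) = (\<Sum>l<n*n. h l A * gen l A))"
    using f
  proof induction
    case (const c)
    show ?case by (rule exI[of _ "\<lambda>_ _. 0"]) (auto intro: poly_funs.const)
  next
    case (entry i j)
    show ?case
    proof (cases "(i, j) \<in> R")
      case True
      then show ?thesis using entry root_patternD(5)[OF R True]
        by (intro exI[of _ "\<lambda>_ _. 0"]) (auto intro: poly_funs.const simp: restrict_pattern_def)
    next
      case False
      let ?l0 = "i * n + j"
      have l0: "?l0 < n * n" "?l0 div n = i" "?l0 mod n = j"
      proof -
        have "i * n + j < Suc i * n" using entry by simp
        also have "\<dots> \<le> n * n" using entry by (intro mult_right_mono) auto
        finally show "?l0 < n * n" .
      qed (use entry in auto)
      have "(\<Sum>l<n*n. of_bool (?l0 = l) * gen l A) = gen ?l0 A" for A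
        by (rule sum_unit) (rule l0)
      then show ?thesis using False entry l0
        by (intro exI[of _ "\<lambda>l _. of_bool (?l0 = l)"])
          (auto intro: poly_funs.const simp: restrict_pattern_def gen_def)
    qed
  next
    case (add f g)
    obtain hf where hf: "(\<forall>l<n*n. hf l \<in> poly_funs UNIV n) \<and>
        (\<forall>A\<in>carrier_mat n n. f A - f (?\<pi> A) = (\<Sum>l<n*n. hf l A * gen l A))"
      using add.IH(1) by (rule exE)
    obtain hg where hg: "(\<forall>l<n*n. hg l \<in> poly_funs UNIV n) \<and>
        (\<forall>A\<in>carrier_mat n n. g A - g (?\<pi> A) = (\<Sum>l<n*n. hg l A * gen l A))"
      using add.IH(2) by (rule exE)
    note h = conjunct1[OF hf, rule_format] conjunct1[OF hg, rule_format]
      conjunct2[OF hf, rule_format] conjunct2[OF hg, rule_format]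
    show ?case
      by (intro exI[of _ "\<lambda>l A. hf l A + hg l A"] conjI allI impI ballI poly_funs.add h)
        (simp_all only: sum.distrib distrib_right add_diff_add h)
  next
    case (mult f g)
    obtain hf where hf: "(\<forall>l<n*n. hf l \<in> poly_funs UNIV n) \<and>
        (\<forall>A\<in>carrier_mat n n. f A - f (?\<pi> A) = (\<Sum>l<n*n. hf l A * gen l A))"
      using mult.IH(1) by (rule exE)
    obtain hg where hg: "(\<forall>l<n*n. hg l \<in> poly_funs UNIV n) \<and>
        (\<forall>A\<in>carrier_mat n n. g A - g (?\<pi> A) = (\<Sum>l<n*n. hg l A * gen l A))"
      using mult.IH(2) by (rule exE)
    note h = conjunct1[OF hf, rule_format] conjunct1[OF hg, rule_format]
      conjunct2[OF hf, rule_format] conjunct2[OF hg, rule_format]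
    let ?h = "\<lambda>l A. hf l A * g A + f (?\<pi> A) * hg l A"
    have "f A * g A - f (?\<pi> A) * g (?\<pi> A) = (\<Sum>l<n*n. ?h l A * gen l A)" if "A \<in> carrier_mat n n" for A
    proof -
      have "(\<Sum>l<n*n. ?h l A * gen l A) =
          (\<Sum>l<n*n. hf l A * gen l A) * g A + f (?\<pi> A) * (\<Sum>l<n*n. hg l A * gen l A)"
        by (simp add: sum.distrib sum_distrib_left sum_distrib_right algebra_simps)
      also have "\<dots> = (f A - f (?\<pi> A)) * g A + f (?\<pi> A) * (g A - g (?\<pi> A))"
        by (simp only: h(3)[OF that] h(4)[OF that])
      finally show ?thesis by (simp add: algebra_simps)
    qed
    moreover have "\<forall>l<n*n. ?h l \<in> poly_funs UNIV n"
      by (intro allI impI poly_funs.add poly_funs.mult h mult.hyps poly_funs_restrict_pattern[OF subfield_UNIV])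
    ultimately show ?case by (intro exI[of _ ?h] conjI ballI)
  qed
  then obtain h where h: "\<forall>l<n*n. h l \<in> poly_funs UNIV n"
    "\<forall>A\<in>carrier_mat n n. f A - f (?\<pi> A) = (\<Sum>l<n*n. h l A * gen l A)" by blast
  have "f (?\<pi> A) = 0" for A by (rule f0[OF restrict_pattern_in[OF order_refl]])
  then show "\<exists>r h g. (\<forall>i<r. h i \<in> poly_funs UNIV n \<and> g i \<in> vanishing k n (pattern_group n R)) \<and>
      (\<forall>A\<in>carrier_mat n n. f A = (\<Sum>i<(r::nat). h i A * g i A))"
    using h gen by (intro exI[of _ "n * n"] exI[of _ h] exI[of _ gen]) auto
qed

lemma pattern_group_unipotent_subgroup:
  assumes k: "is_subfield k" and R: "root_pattern n R"
  shows "unipotent_subgroup k n (pattern_group n R)"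
  unfolding unipotent_subgroup_def
proof (intro conjI ballI)
  show "\<exists>X. zariski_closed n X \<and> pattern_group n R = carrier (GL n) \<inter> X"
    using pattern_group_zariski_closed pattern_group_inv(1)[OF R] by blast
  fix A :: "'a mat" assume A: "A \<in> pattern_group n R"
  have "A - 1\<^sub>m n \<in> pattern_algebra n R"
    using A by (auto simp: pattern_group_def pattern_algebra_def)
  then show "nilpotent_mat n (A - 1\<^sub>m n)"
    using pattern_nilpotent[OF R, of "A - 1\<^sub>m n"] unfolding nilpotent_mat_def
    by (auto simp: pattern_algebra_def)
qed (use pattern_group_subgroup[OF R] pattern_group_defined_over[OF k R] in auto)

text \<open>For \<open>X\<close> in the algebra the whole line \<open>1 + t X\<close> lies in the
  group, so every \<open>p\<close> in the definition of \<open>Lie\<close> vanishes identically.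
  Conversely, the coordinate functions off the pattern have differential
  \<open>X $$ (i, j)\<close>.\<close>

lemma Lie_pattern_group:
  fixes R :: "(nat \<times> nat) set"
  assumes R: "root_pattern n R"
  shows "Lie n (pattern_group n R) = (pattern_algebra n R :: 'a::field_char_0 mat set)"
proof (intro equalityI subsetI)
  fix X :: "'a mat" assume X: "X \<in> Lie n (pattern_group n R)"
  have c: "X \<in> carrier_mat n n" using X by (simp add: Lie_def)
  have "X $$ (i, j) = 0" if ij: "i < n" "j < n" "(i, j) \<notin> R" for i j
  proof -
    let ?f = "\<lambda>A::'a mat. A $$ (i, j) - (if i = j then 1 else 0)"
    have "?f \<in> vanishing UNIV n (pattern_group n R)"
      using poly_funs_entry_minus[OF subfield_UNIV _ ij(1,2)] ij unfolding vanishing_def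
      by (auto simp: pattern_group_def intro: poly_funs.entry)
    moreover have "\<forall>t. poly [:0, X $$ (i, j):] t = ?f (1\<^sub>m n + t \<cdot>\<^sub>m X)" using c ij by auto
    moreover have "\<forall>f\<in>vanishing UNIV n (pattern_group n R). \<forall>p.
        (\<forall>t. poly p t = f (1\<^sub>m n + t \<cdot>\<^sub>m X)) \<longrightarrow> coeff p 1 = 0"
      using X by (simp add: Lie_def)
    ultimately have "coeff [:0, X $$ (i, j):] 1 = 0" by metis
    then show ?thesis by simp
  qed
  then show "X \<in> pattern_algebra n R" using c by (auto simp: pattern_algebra_def)
next
  fix X :: "'a mat" assume X: "X \<in> pattern_algebra n R"
  have "p = 0" if f: "f \<in> vanishing UNIV n (pattern_group n R)"
    and p: "\<forall>t. poly p t = f (1\<^sub>m n + t \<cdot>\<^sub>m X)" for f p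
  proof -
    have "1\<^sub>m n + t \<cdot>\<^sub>m X \<in> pattern_group n R" for t
      using X by (auto simp: pattern_algebra_def pattern_group_def)
    then have "\<forall>t. poly p t = 0" using p f by (auto simp: vanishing_def)
    then show "p = 0" by (simp add: poly_all_0_iff_0)
  qed
  then have "coeff p 1 = 0" if "f \<in> vanishing UNIV n (pattern_group n R)"
    "\<forall>t. poly p t = f (1\<^sub>m n + t \<cdot>\<^sub>m X)" for f p
    using that by (metis coeff_0)
  then show "X \<in> Lie n (pattern_group n R)"
    using X unfolding Lie_def pattern_algebra_def by simp
qed

section \<open>Linear forms as additive functions\<close>

definition entry_form :: "nat \<Rightarrow> (nat \<Rightarrow> nat \<Rightarrow> 'a::field) \<Rightarrow> 'a mat \<Rightarrow> 'a" where
  "entry_form n c A = (\<Sum>i<n. \<Sum>j<n. c i j * A $$ (i, j))"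

text \<open>The coefficients are not tied to \<open>R\<close>: off \<open>R\<close> and off the
  diagonal the entries are zero. So one \<open>c\<close> with zero diagonal describes the additive
  functions on all domains along a path.\<close>

definition lin_af :: "nat \<Rightarrow> (nat \<times> nat) set \<Rightarrow> (nat \<Rightarrow> nat \<Rightarrow> 'a::field) \<Rightarrow> 'a af" where
  "lin_af n R c = (\<lambda>A. if A \<in> pattern_group n R then Some (entry_form n c A) else None)"

lemma dom_lin_af [simp]: "dom (lin_af n R c) = pattern_group n R"
  by (auto simp: lin_af_def dom_def)

lemma entry_form_poly: "is_subfield k \<Longrightarrow> (\<And>i j. c i j \<in> k) \<Longrightarrow> entry_form n c \<in> poly_funs k n"
  unfolding entry_form_def
  by (intro poly_funs_sum poly_funs.mult poly_funs.const poly_funs.entry) (auto dest: subfieldD)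

text \<open>The triple sum is the defect of additivity. It vanishes if \<open>c\<close> is zero on
  composites of two roots; in an exchange step its single surviving term is what conjugation adds to
  the form.\<close>

lemma entry_form_mult:
  assumes R: "root_pattern n R" "root_pattern n R'"
    and A: "A \<in> pattern_group n R" and B: "B \<in> pattern_group n R'" and c: "\<And>i. c i i = 0"
  shows "entry_form n c (A * B) = entry_form n c A + entry_form n c B
    + (\<Sum>i<n. \<Sum>j<n. c i j * (\<Sum>l<n. off R A i l * off R' B l j))"
  unfolding entry_form_def sum.distrib[symmetric]
proof (intro sum.cong refl)
  fix i j assume "i \<in> {..<n}" "j \<in> {..<n}"
  then have ij: "i < n" "j < n" by auto
  show "c i j * (A * B) $$ (i, j) = c i j * A $$ (i, j) + c i j * B $$ (i, j)
      + c i j * (\<Sum>l<n. off R A i l * off R' B l j)"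
    unfolding pattern_group_mult_entry[OF R A B ij] pattern_group_entry[OF R(1) A ij]
      pattern_group_entry[OF R(2) B ij]
    using c by (cases "i = j") (auto simp: algebra_simps)
qed

lemma entry_form_additive:
  assumes "root_pattern n R" "root_pattern n R'"
    and "A \<in> pattern_group n R" "B \<in> pattern_group n R'" "\<And>i. c i i = 0"
    and "\<And>i l j. (i, l) \<in> R \<Longrightarrow> (l, j) \<in> R' \<Longrightarrow> c i j = 0"
  shows "entry_form n c (A * B) = entry_form n c A + entry_form n c B"
proof -
  have "(\<Sum>i<n. \<Sum>j<n. c i j * (\<Sum>l<n. off R A i l * off R' B l j)) = 0"
    using assms(6) by (fastforce simp: sum_distrib_left off_def intro!: sum.neutral)
  then show ?thesis using entry_form_mult[where c = c, OF assms(1-5)] by simp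
qed

lemma AF_lin_af:
  assumes k: "is_subfield k" and R: "root_pattern n R"
    and c: "\<And>i j. c i j \<in> k" "\<And>i. c i i = 0" "\<And>i l j. (i, l) \<in> R \<Longrightarrow> (l, j) \<in> R \<Longrightarrow> c i j = 0"
  shows "AF k n (lin_af n R c)"
  unfolding AF_def dom_lin_af
proof (intro conjI ballI)
  show "\<exists>f\<in>poly_funs k n. \<forall>u\<in>pattern_group n R. lin_af n R c u = Some (f u)"
    using entry_form_poly[of k c n] k c by (auto simp: lin_af_def)
  fix u v :: "'a mat" assume uv: "u \<in> pattern_group n R" "v \<in> pattern_group n R"
  then show "the (lin_af n R c (u * v)) = the (lin_af n R c u) + the (lin_af n R c v)"
    using entry_form_additive[where c = c, OF R R uv] c pattern_group_mult[OF R uv] by (simp add: lin_af_def)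
qed (rule pattern_group_unipotent_subgroup[OF k R])

lemma root_elem_add:
  assumes "i < n" "i \<noteq> j"
  shows "root_elem n i j s * root_elem n i j t = root_elem n i j (s + t)"
proof (rule eq_matI)
  fix a b assume "a < dim_row (root_elem n i j (s + t))" "b < dim_col (root_elem n i j (s + t))"
  then have "a < n" "b < n" by (auto simp: root_elem_def)
  then show "(root_elem n i j s * root_elem n i j t) $$ (a, b) = root_elem n i j (s + t) $$ (a, b)"
    using assms by (subst root_elem_mult_right) (auto simp: root_elem_def)
qed (auto simp: root_elem_def)

text \<open>Additivity gives \<open>p(m) = m p(1)\<close> for natural \<open>m\<close>; in
  characteristic 0 these are infinitely many roots of the difference from the linear
  polynomial.\<close>

lemma additive_poly_linear:
  fixes p :: "'a::field_char_0 poly"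
  assumes "\<And>s t. poly p (s + t) = poly p s + poly p t"
  shows "poly p t = t * poly p 1"
proof -
  let ?q = "p - smult (poly p 1) [:0, 1:]"
  have nat: "poly p (of_nat m) = of_nat m * poly p 1" for m
  proof (induction m)
    case 0
    then show ?case using assms[of 0 0] by simp
  next
    case (Suc m)
    then show ?case using assms[of "of_nat m" 1] by (simp add: algebra_simps)
  qed
  have "range of_nat \<subseteq> {x. poly ?q x = 0}" using nat by auto
  moreover have "infinite (range (of_nat :: nat \<Rightarrow> 'a))"
    by (simp add: inj_of_nat range_inj_infinite)
  ultimately have "?q = 0" using poly_roots_finite[of ?q] finite_subset by blast
  then have "p = smult (poly p 1) [:0, 1:]" by simp
  then have "poly p t = poly (smult (poly p 1) [:0, 1:]) t" by metis
  then show ?thesis by simp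
qed

text \<open>On each root subgroup the function is an additive polynomial, hence linear. Since
  \<open>A\<close> factors into root elements whose parameters are exactly its entries, the values
  add up to a linear form in the entries.\<close>

lemma AF_imp_lin_af:
  fixes k :: "'a::field_char_0 set"
  assumes k: "is_subfield k" and R: "root_pattern n R" and Q: "AF k n Q" "dom Q = pattern_group n R"
  obtains c where "Q = lin_af n R c" "\<And>i j. c i j \<in> k" "\<And>i j. (i, j) \<notin> R \<Longrightarrow> c i j = 0"
proof -
  obtain f where f: "f \<in> poly_funs k n" "\<And>u. u \<in> pattern_group n R \<Longrightarrow> Q u = Some (f u)"
    using Q by (auto simp: AF_def)
  have add: "f (u * v) = f u + f v" if "u \<in> pattern_group n R" "v \<in> pattern_group n R" for u v
  proof -
    have "the (Q (u * v)) = the (Q u) + the (Q v)"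
      using Q that unfolding AF_def by auto
    then show ?thesis using f(2) that pattern_group_mult[OF R that] by simp
  qed
  define c where "c i j = (if (i, j) \<in> R then f (root_elem n i j 1) else 0)" for i j
  have root: "f (root_elem n i j t) = c i j * t" if ij: "(i, j) \<in> R" for i j t
  proof -
    note b = root_patternD(1,2,5)[OF R ij]
    let ?E = "mat n n (\<lambda>(a, b). if a = i \<and> b = j then 1 else 0) :: 'a mat"
    have E: "1\<^sub>m n + t \<cdot>\<^sub>m ?E = root_elem n i j t" for t
      using b by (intro eq_matI) (auto simp: root_elem_def)
    obtain p where p: "\<And>t. poly p t = f (1\<^sub>m n + t \<cdot>\<^sub>m ?E)"
      by (rule poly_funs_line[OF f(1), of "1\<^sub>m n" ?E]) auto
    have "poly p (s + t) = poly p s + poly p t" for s t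
      using add[OF root_elem_in_pattern_group[OF ij] root_elem_in_pattern_group[OF ij], of s t] b
      by (simp add: p E root_elem_add)
    from additive_poly_linear[OF this, of t] show ?thesis using ij by (simp add: p E c_def mult.commute)
  qed
  have fA: "f A = entry_form n c A" if A: "A \<in> pattern_group n R" for A
  proof -
    have *: "f (restrict_pattern n S A) = (\<Sum>(i, j)\<in>S. c i j * A $$ (i, j))" if "S \<subseteq> R" for S
      using R that
    proof (induction S rule: restrict_pattern_induct[where A = A])
      case empty
      have "f (1\<^sub>m n) = f (1\<^sub>m n) + f (1\<^sub>m n)"
        using add[OF one_in_pattern_group one_in_pattern_group] by simp
      then show ?case by (simp add: restrict_pattern_empty)
    next
      case (insert S i j)
      have S: "finite S" "S \<subseteq> R" "(i, j) \<in> R"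
        using insert.hyps(1) root_patternD(6)[OF R] finite_subset[of S R] by auto
      have "f (restrict_pattern n (Set.insert (i, j) S) A) =
          f (restrict_pattern n S A) + f (root_elem n i j (A $$ (i, j)))"
        unfolding insert.hyps(3)
        by (rule add[OF restrict_pattern_in[OF S(2)] root_elem_in_pattern_group[OF S(3)]])
      then show ?case using S(1) insert.hyps(2) by (simp add: root[OF S(3)] insert.IH)
    qed
    have "f A = (\<Sum>(i, j)\<in>R. c i j * A $$ (i, j))"
      using *[OF order_refl] by (simp add: restrict_pattern_self[OF R A])
    also have "\<dots> = (\<Sum>(i, j)\<in>{..<n} \<times> {..<n}. c i j * A $$ (i, j))"
      using R by (intro sum.mono_neutral_left) (auto simp: root_pattern_def c_def)
    finally show ?thesis by (simp add: entry_form_def sum.cartesian_product)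
  qed
  show thesis
  proof (rule that[of c])
    show "Q = lin_af n R c"
    proof
      fix u show "Q u = lin_af n R c u"
        using f(2)[of u] fA[of u] Q(2) by (cases "u \<in> pattern_group n R") (auto simp: lin_af_def)
    qed
    show "c i j \<in> k" for i j
    proof -
      have "f (root_elem n i j 1) \<in> k"
        using subfieldD(1,2)[OF k] by (intro poly_funs_value[OF k f(1)]) (auto simp: root_elem_def)
      then show ?thesis using subfieldD(1)[OF k] by (simp add: c_def)
    qed
  qed (simp add: c_def)
qed

lemma lin_af_root_elem:
  assumes "root_pattern n R" "(i, j) \<in> R" "\<And>i. c i i = 0"
  shows "lin_af n R c (root_elem n i j t) = Some (c i j * t)"
proof -
  note b = root_patternD(1,2,5)[OF assms(1,2)]
  have "entry_form n c (root_elem n i j t) = (\<Sum>a<n. \<Sum>d<n. if a = i \<and> d = j then c i j * t else 0)"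
    unfolding entry_form_def by (intro sum.cong refl) (use b assms(3) in \<open>auto simp: root_elem_def\<close>)
  also have "\<dots> = (\<Sum>a<n. if a = i then c i j * t else 0)"
    by (rule sum.cong) (use b in auto)
  also have "\<dots> = c i j * t" using b by simp
  finally show ?thesis using root_elem_in_pattern_group[OF assms(2)] by (simp add: lin_af_def)
qed

section \<open>The exponential and the matrix \<open>J_F\<close>\<close>

lemma pattern_algebra_mult:
  assumes R: "root_pattern n R" and XY: "X \<in> pattern_algebra n R" "Y \<in> pattern_algebra n R"
  shows "X * Y \<in> pattern_algebra n R"
    "\<And>i j. i < n \<Longrightarrow> j < n \<Longrightarrow> \<not> (\<exists>l. (i, l) \<in> R \<and> (l, j) \<in> R) \<Longrightarrow> (X * Y) $$ (i, j) = 0"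
proof -
  have c: "X \<in> carrier_mat n n" "Y \<in> carrier_mat n n" using XY by (auto simp: pattern_algebra_def)
  show *: "(X * Y) $$ (i, j) = 0" if ij: "i < n" "j < n" "\<not> (\<exists>l. (i, l) \<in> R \<and> (l, j) \<in> R)" for i j
  proof -
    have "X $$ (i, l) * Y $$ (l, j) = 0" if "l < n" for l
      using XY ij that by (cases "(i, l) \<in> R") (auto simp: pattern_algebra_def)
    then show ?thesis unfolding mult_mat_index[OF c ij(1,2)] by (auto intro: sum.neutral)
  qed
  show "X * Y \<in> pattern_algebra n R"
    using c root_patternD(4)[OF R] by (auto simp: pattern_algebra_def intro!: * simp del: index_mult_mat(1))
qed

text \<open>Powers from the second on are supported on composites of two roots, where
  \<open>c\<close> vanishes. Only the linear term of the exponential is seen by the form.\<close>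

lemma mat_exp_pattern_algebra:
  fixes X :: "'a::field_char_0 mat"
  assumes R: "root_pattern n R" and X: "X \<in> pattern_algebra n R"
    and c: "\<And>i j. c i j \<noteq> 0 \<Longrightarrow> (i, j) \<in> R" "\<And>i l j. (i, l) \<in> R \<Longrightarrow> (l, j) \<in> R \<Longrightarrow> c i j = 0"
  shows "lin_af n R c (mat_exp n X) = Some (entry_form n c X)"
proof -
  have cX: "X \<in> carrier_mat n n" using X by (auto simp: pattern_algebra_def)
  have pow: "X ^\<^sub>m Suc m \<in> pattern_algebra n R" for m
    by (induction m) (use X cX pattern_algebra_mult(1)[OF R _ X] in auto)
  have "mat_exp n X $$ (i, j) = (if i = j then 1 else 0)" if ij: "i < n" "j < n" "(i, j) \<notin> R" for i j
  proof -
    have "(X ^\<^sub>m m) $$ (i, j) / fact m = (if m = 0 then if i = j then 1 else 0 else 0)" for m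
      using pow[of "m - 1"] ij cX by (cases m) (auto simp: pattern_algebra_def)
    then have "mat_exp n X $$ (i, j) = (\<Sum>m<n. if m = 0 then if i = j then 1 else 0 else 0)"
      using ij by (auto simp: mat_exp_def intro!: sum.cong)
    then show ?thesis using ij by simp
  qed
  then have D: "mat_exp n X \<in> pattern_group n R" by (auto simp: pattern_group_def mat_exp_def)
  have "c i j * mat_exp n X $$ (i, j) = c i j * X $$ (i, j)" if ij: "i < n" "j < n" for i j
  proof (cases "c i j = 0")
    case False
    note R' = c(1)[OF False]
    have "(X ^\<^sub>m m) $$ (i, j) / fact m = (if m = 1 then X $$ (i, j) else 0)" for m
    proof -
      consider "m = 0" | "m = 1" | l where "m = Suc (Suc l)" by (metis One_nat_def nat.exhaust)
      then show ?thesis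
      proof cases
        case 3
        have "(X ^\<^sub>m Suc l * X) $$ (i, j) = 0"
          using pattern_algebra_mult(2)[OF R pow X ij] c(2) False by blast
        then show ?thesis using 3 by simp
      qed (use cX ij root_patternD(5)[OF R R'] in auto)
    qed
    then have "mat_exp n X $$ (i, j) = (\<Sum>m<n. if m = 1 then X $$ (i, j) else 0)"
      using ij by (simp add: mat_exp_def)
    \<comment> \<open>\<open>mat_exp\<close> sums over \<open>m < n\<close>, so its linear term is
      present only for \<open>n > 1\<close>; the off-diagonal position \<open>(i, j)\<close> ensures
      this.\<close>
    moreover have "1 < n" using ij root_patternD(5)[OF R R'] by linarith
    ultimately show ?thesis by simp
  qed simp
  then have "entry_form n c (mat_exp n X) = entry_form n c X"
    unfolding entry_form_def by (intro sum.cong refl) auto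
  then show ?thesis using D by (simp add: lin_af_def)
qed

text \<open>The trace pairs the algebra perfectly with its transpose, as testing on matrix units
  shows; the transposed coefficient matrix is the only candidate.\<close>

lemma J_of_lin_af:
  fixes c :: "nat \<Rightarrow> nat \<Rightarrow> 'a::field_char_0"
  assumes R: "root_pattern n R"
    and c: "\<And>i j. c i j \<noteq> 0 \<Longrightarrow> (i, j) \<in> R" "\<And>i l j. (i, l) \<in> R \<Longrightarrow> (l, j) \<in> R \<Longrightarrow> c i j = 0"
  shows "J_of n (lin_af n R c) = mat n n (\<lambda>(i, j). c j i)"
proof -
  let ?L = "pattern_algebra n R :: 'a mat set"
  have tr: "mat_trace (X\<^sup>T * u) = (\<Sum>i<n. \<Sum>j<n. X $$ (i, j) * u $$ (i, j))"
    if "X \<in> carrier_mat n n" "u \<in> carrier_mat n n" for X u :: "'a mat"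
  proof -
    have "mat_trace (X\<^sup>T * u) = (\<Sum>j<n. \<Sum>i<n. X $$ (i, j) * u $$ (i, j))"
      using that by (simp add: mat_trace_def mult_mat_index[of _ n n _ n] del: index_mult_mat(1))
    then show ?thesis by (subst sum.swap)
  qed
  have exp: "the (lin_af n R c (mat_exp n u)) = entry_form n c u" if "u \<in> ?L" for u
    using mat_exp_pattern_algebra[where c = c, OF R that c] by simp
  let ?C = "mat n n (\<lambda>(i, j). c i j)"
  show ?thesis unfolding J_of_def dom_lin_af Lie_pattern_group[OF R]
  proof (rule the_equality)
    have "mat n n (\<lambda>(i, j). c j i) = ?C\<^sup>T" by (rule eq_matI) auto
    moreover have "?C \<in> ?L" using c(1) by (auto simp: pattern_algebra_def)
    moreover have "mat_trace (?C\<^sup>T * u) = the (lin_af n R c (mat_exp n u))" if "u \<in> ?L" for u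
      using that by (subst tr) (auto simp: exp entry_form_def pattern_algebra_def)
    ultimately show "mat n n (\<lambda>(i, j). c j i) \<in> transpose_mat ` ?L \<and>
      (\<forall>u\<in>?L. mat_trace (mat n n (\<lambda>(i, j). c j i) * u) = the (lin_af n R c (mat_exp n u)))"
      by auto
  next
    fix J assume J: "J \<in> transpose_mat ` ?L \<and>
      (\<forall>u\<in>?L. mat_trace (J * u) = the (lin_af n R c (mat_exp n u)))"
    then obtain X where X: "X \<in> ?L" "J = X\<^sup>T" by auto
    have cX: "X \<in> carrier_mat n n" using X by (auto simp: pattern_algebra_def)
    have "X $$ (i, j) = c i j" if ij: "i < n" "j < n" for i j
    proof (cases "(i, j) \<in> R")
      case True
      let ?u = "mat n n (\<lambda>(a, b). if a = i \<and> b = j then 1 else 0) :: 'a mat"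
      have u: "?u \<in> ?L" using True by (auto simp: pattern_algebra_def)
      have s: "(\<Sum>a<n. \<Sum>b<n. g a b * ?u $$ (a, b)) = g i j" for g :: "nat \<Rightarrow> nat \<Rightarrow> 'a"
      proof -
        have "(\<Sum>a<n. \<Sum>b<n. g a b * ?u $$ (a, b)) = (\<Sum>a<n. \<Sum>b<n. if b = j then (if a = i then g a b else 0) else 0)"
          by (intro sum.cong refl) auto
        also have "\<dots> = (\<Sum>a<n. if a = i then g a j else 0)" using ij by simp
        finally show ?thesis using ij by simp
      qed
      have "(\<Sum>a<n. \<Sum>b<n. X $$ (a, b) * ?u $$ (a, b)) = entry_form n c ?u"
        using J u X tr[OF cX, of ?u] exp[OF u] by simp
      then show ?thesis unfolding entry_form_def s .
    next
      case False
      then show ?thesis using X ij c(1)[of i j] by (auto simp: pattern_algebra_def)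
    qed
    then show "J = mat n n (\<lambda>(i, j). c j i)" using X cX by (intro eq_matI) auto
  qed
qed

section \<open>Exchange and extension steps\<close>

text \<open>The group of \<open>C\<close> then contains all commutators of the group of
  \<open>N\<close>, and every set between \<open>C\<close> and \<open>N\<close> is again transitive.
  This is the common frame for the domains of a single step.\<close>

definition derived_in :: "(nat \<times> nat) set \<Rightarrow> (nat \<times> nat) set \<Rightarrow> bool" where
  "derived_in N C \<longleftrightarrow> C \<subseteq> N \<and> (\<forall>i l j. (i, l) \<in> N \<longrightarrow> (l, j) \<in> N \<longrightarrow> (i, j) \<in> C)"

lemma derived_in_root_pattern:
  assumes "root_pattern n N" "derived_in N C" "C \<subseteq> R" "R \<subseteq> N"
  shows "root_pattern n R"
  unfolding root_pattern_def
proof (intro conjI)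
  show "R \<subseteq> {..<n} \<times> {..<n}" using assms(1,4) by (auto simp: root_pattern_def)
  show "trans R"
  proof (rule transI)
    fix i j h assume "(i, j) \<in> R" "(j, h) \<in> R"
    then have "(i, j) \<in> N" "(j, h) \<in> N" using assms(4) by auto
    then have "(i, h) \<in> C" using assms(2) by (simp add: derived_in_def)
    then show "(i, h) \<in> R" using assms(3) by auto
  qed
  show "irrefl R" using assms(4) root_patternD(3)[OF assms(1)] by (auto simp: irrefl_def)
qed

text \<open>Entries outside \<open>C\<close> are the coordinates of the abelian quotient of the group of \<open>N\<close>.\<close>

lemma derived_in_mult_entry:
  assumes N: "root_pattern n N" "derived_in N C"
    and A: "A \<in> pattern_group n N" and B: "B \<in> pattern_group n N"
    and ij: "i < n" "j < n" "i \<noteq> j" "(i, j) \<notin> C"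
  shows "(A * B) $$ (i, j) = A $$ (i, j) + B $$ (i, j)"
proof -
  have "(\<Sum>l<n. off N A i l * off N B l j) = 0"
    using N(2) ij by (intro sum.neutral) (auto simp: off_def derived_in_def)
  then show ?thesis
    using ij by (simp only: pattern_group_mult_entry[OF N(1) N(1) A B ij(1,2)]
        pattern_group_entry[OF N(1) A ij(1,2)] pattern_group_entry[OF N(1) B ij(1,2)]) simp
qed

lemma pattern_group_offI:
  assumes "A \<in> pattern_group n N" "R \<subseteq> N"
    "\<And>i j. i < n \<Longrightarrow> j < n \<Longrightarrow> (i, j) \<in> N \<Longrightarrow> (i, j) \<notin> R \<Longrightarrow> A $$ (i, j) = (if i = j then 1 else 0)"
  shows "A \<in> pattern_group n R"
proof -
  have "A $$ (i, j) = (if i = j then 1 else 0)" if "i < n" "j < n" "(i, j) \<notin> R" for i j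
    using assms(3)[OF that(1,2) _ that(3)] pattern_groupD(4)[OF assms(1) that(1,2)] by blast
  then show ?thesis using assms(1) by (simp add: pattern_group_def)
qed

text \<open>For the commutator \<open>x\<close> of \<open>a\<close> and \<open>b\<close> one has
  \<open>x * (b * a) = a * b\<close>. Entries outside \<open>C\<close> are additive under
  multiplication, so those of \<open>x\<close> must vanish; no inverse has to be computed.\<close>

lemma commutator_pattern_group:
  fixes N :: "(nat \<times> nat) set"
  assumes N: "root_pattern n N" "derived_in N C" and R: "R \<subseteq> N" "R' \<subseteq> N"
  shows "commutator n (pattern_group n R) (pattern_group n R' :: 'a::field mat set) \<subseteq> pattern_group n C"
proof -
  interpret group "GL n :: 'a mat monoid" by (rule GL_group)
  have CN: "C \<subseteq> N" using N(2) by (simp add: derived_in_def)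
  have C: "root_pattern n C" by (rule derived_in_root_pattern[OF N order_refl CN])
  have "a * b * inv\<^bsub>GL n\<^esub> a * inv\<^bsub>GL n\<^esub> b \<in> pattern_group n C"
    if "a \<in> pattern_group n R" "b \<in> pattern_group n R'" for a b :: "'a mat"
  proof -
    have a: "a \<in> pattern_group n N" and b: "b \<in> pattern_group n N"
      using that R pattern_group_mono by blast+
    note ca = pattern_group_inv(1)[OF N(1) a] and cb = pattern_group_inv(1)[OF N(1) b]
    let ?x = "a * b * inv\<^bsub>GL n\<^esub> a * inv\<^bsub>GL n\<^esub> b"
    have x: "?x \<in> pattern_group n N"
      using a b by (intro pattern_group_mult[OF N(1)] pattern_group_inv(2)[OF N(1)])
    have ba: "b * a \<in> pattern_group n N" by (rule pattern_group_mult[OF N(1) b a])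
    have "a \<otimes>\<^bsub>GL n\<^esub> b \<otimes>\<^bsub>GL n\<^esub> inv\<^bsub>GL n\<^esub> a \<otimes>\<^bsub>GL n\<^esub> inv\<^bsub>GL n\<^esub> b \<otimes>\<^bsub>GL n\<^esub> (b \<otimes>\<^bsub>GL n\<^esub> a) = a \<otimes>\<^bsub>GL n\<^esub> b"
    proof -
      have "inv\<^bsub>GL n\<^esub> b \<otimes>\<^bsub>GL n\<^esub> (b \<otimes>\<^bsub>GL n\<^esub> a) = a"
        using ca cb by (simp only: m_assoc[symmetric] inv_closed l_inv l_one)
      then show ?thesis
        using ca cb by (simp only: m_assoc inv_closed m_closed l_inv r_one)
    qed
    then have eq: "?x * (b * a) = a * b" by simp
    have "?x $$ (i, j) = 0" if "i < n" "j < n" "i \<noteq> j" "(i, j) \<notin> C" for i j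
      using derived_in_mult_entry[OF N x ba that] derived_in_mult_entry[OF N a b that]
        derived_in_mult_entry[OF N b a that] by (simp add: eq)
    then show ?thesis
      using root_patternD(5)[OF N(1)] by (intro pattern_group_offI[OF x CN]) auto
  qed
  then show ?thesis unfolding commutator_def
    by (intro generate_subgroup_incl pattern_group_subgroup[OF C]) blast
qed

text \<open>As before, the equation \<open>u * w = v * u\<close> replaces a computation with the
  inverse: outside \<open>C\<close> the entries of \<open>u\<close> cancel. The equation itself is
  used later to evaluate forms on \<open>w\<close>.\<close>

lemma conj_pattern_group:
  assumes N: "root_pattern n N" "derived_in N C" and R: "C \<subseteq> R" "R \<subseteq> N"
    and u: "u \<in> pattern_group n N" and v: "v \<in> pattern_group n R"
  shows "inv\<^bsub>GL n\<^esub> u * v * u \<in> pattern_group n R"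
    "u * (inv\<^bsub>GL n\<^esub> u * v * u) = v * u"
    "\<And>i j. i < n \<Longrightarrow> j < n \<Longrightarrow> i \<noteq> j \<Longrightarrow> (i, j) \<notin> C \<Longrightarrow> (inv\<^bsub>GL n\<^esub> u * v * u) $$ (i, j) = v $$ (i, j)"
proof -
  let ?w = "inv\<^bsub>GL n\<^esub> u * v * u"
  have v': "v \<in> pattern_group n N" using v R pattern_group_mono by blast
  note ui = pattern_group_inv[OF N(1) u]
  have w: "?w \<in> pattern_group n N"
    using u ui v' by (intro pattern_group_mult[OF N(1)])
  have c: "u \<in> carrier_mat n n" "v \<in> carrier_mat n n" "inv\<^bsub>GL n\<^esub> u \<in> carrier_mat n n"
    using u v' ui(2) by (auto dest: pattern_groupD)
  have "u * ?w = (u * inv\<^bsub>GL n\<^esub> u) * (v * u)"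
    using c by (simp add: assoc_mult_mat[of _ n n _ n _ n] mult_carrier_mat[of _ n n _ n])
  then show eq: "u * ?w = v * u" using c ui by (simp add: mult_carrier_mat[of _ n n _ n])
  show entry: "?w $$ (i, j) = v $$ (i, j)" if "i < n" "j < n" "i \<noteq> j" "(i, j) \<notin> C" for i j
    using derived_in_mult_entry[OF N u w that] derived_in_mult_entry[OF N v' u that] by (simp add: eq)
  show "?w \<in> pattern_group n R"
  proof (rule pattern_group_offI[OF w R(2)])
    fix i j assume ij: "i < n" "j < n" "(i, j) \<in> N" "(i, j) \<notin> R"
    then have "?w $$ (i, j) = v $$ (i, j)"
      using root_patternD(5)[OF N(1)] R by (intro entry) auto
    then show "?w $$ (i, j) = (if i = j then 1 else 0)" using pattern_groupD(4)[OF v] ij by simp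
  qed
qed

lemma conj_af_pattern:
  assumes N: "root_pattern n N" "derived_in N C" and R: "C \<subseteq> R" "R \<subseteq> N"
    and u: "u \<in> pattern_group n N" and Q: "dom Q = pattern_group n R"
  shows "conj_af n u Q x = (if x \<in> pattern_group n R then Q (inv\<^bsub>GL n\<^esub> u * x * u) else None)"
proof (cases "x \<in> pattern_group n R")
  case True
  then show ?thesis by (simp add: conj_af_def restrict_map_def pattern_groupD)
next
  case False
  have "Q (inv\<^bsub>GL n\<^esub> u * x * u) = None" if x: "x \<in> carrier_mat n n"
  proof (rule ccontr)
    assume "Q (inv\<^bsub>GL n\<^esub> u * x * u) \<noteq> None"
    then have w: "inv\<^bsub>GL n\<^esub> u * x * u \<in> pattern_group n R" using Q by blast
    interpret group "GL n :: 'a mat monoid" by (rule GL_group)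
    note ui = pattern_group_inv[OF N(1) u]
    have c: "u \<in> carrier_mat n n" "inv\<^bsub>GL n\<^esub> u \<in> carrier_mat n n"
      using u ui(2) by (auto dest: pattern_groupD)
    have "inv\<^bsub>GL n\<^esub> (inv\<^bsub>GL n\<^esub> u) * (inv\<^bsub>GL n\<^esub> u * x * u) * inv\<^bsub>GL n\<^esub> u \<in> pattern_group n R"
      by (rule conj_pattern_group(1)[OF N R ui(2) w])
    also have "inv\<^bsub>GL n\<^esub> (inv\<^bsub>GL n\<^esub> u) * (inv\<^bsub>GL n\<^esub> u * x * u) * inv\<^bsub>GL n\<^esub> u
        = (u * inv\<^bsub>GL n\<^esub> u) * x * (u * inv\<^bsub>GL n\<^esub> u)"
      using c x ui(1) by (simp add: assoc_mult_mat[of _ n n _ n _ n] mult_carrier_mat[of _ n n _ n])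
    also have "\<dots> = x" using ui(3) x by simp
    finally show False using False by simp
  qed
  then show ?thesis using False by (simp add: conj_af_def restrict_map_def)
qed

lemma pattern_group_psubset:
  assumes "root_pattern n R'" "R \<subset> R'"
  shows "(pattern_group n R :: 'a::field mat set) \<subset> pattern_group n R'"
proof -
  obtain i j where ij: "(i, j) \<in> R'" "(i, j) \<notin> R" using assms by auto
  note b = root_patternD(1,2,5)[OF assms(1) ij(1)]
  have "root_elem n i j 1 \<in> (pattern_group n R' :: 'a mat set)"
    by (rule root_elem_in_pattern_group[OF ij(1)])
  moreover have "root_elem n i j 1 \<notin> (pattern_group n R :: 'a mat set)"
    using b ij(2) by (auto simp: pattern_group_def root_elem_def)
  ultimately show ?thesis using pattern_group_mono[of R R' n] assms(2) by blast
qed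

lemma lin_af_restrict:
  assumes "R \<subseteq> R'"
  shows "lin_af n R' c |` pattern_group n R = lin_af n R c"
  using pattern_group_mono[OF assms] by (auto simp: lin_af_def restrict_map_def fun_eq_iff)

lemma e_step_lin_af:
  assumes k: "is_subfield k" and R': "root_pattern n R'" "derived_in R' C" and R: "C \<subseteq> R" "R \<subset> R'"
    and c: "\<And>i j. c i j \<in> k" "\<And>i. c i i = 0" "\<And>i l j. (i, l) \<in> R' \<Longrightarrow> (l, j) \<in> R' \<Longrightarrow> c i j = 0"
  shows "e_step k n (lin_af n R c) (lin_af n R' c)"
  unfolding e_step_def dom_lin_af
proof (intro exI conjI)
  show "AF k n (lin_af n R' c)" by (rule AF_lin_af) (use k R'(1) c in blast)+
  show "commutator n (pattern_group n R') (pattern_group n R') \<subseteq> pattern_group n R"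
    using commutator_pattern_group[OF R' order_refl order_refl] pattern_group_mono[OF R(1)] by blast
  show "lin_af n R' c |` pattern_group n R = lin_af n R c"
    using R(2) by (intro lin_af_restrict) blast
qed (use pattern_group_unipotent_subgroup[OF k R'(1)] pattern_group_psubset[OF R'(1) R(2)] in auto)

lemma entry_form_update:
  assumes "q < n" "p < n"
  shows "entry_form n (\<lambda>i j. c i j + (if i = q \<and> j = p then e else 0)) x = entry_form n c x + e * x $$ (q, p)"
proof -
  have "(\<Sum>i<n. \<Sum>j<n. (if i = q \<and> j = p then e else 0) * x $$ (i, j))
      = (\<Sum>i<n. \<Sum>j<n. if j = p then (if i = q then e * x $$ (i, j) else 0) else 0)"
    by (intro sum.cong refl) auto
  also have "\<dots> = (\<Sum>i<n. if i = q then e * x $$ (i, p) else 0)" using assms by simp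
  also have "\<dots> = e * x $$ (q, p)" using assms by simp
  finally show ?thesis by (simp add: entry_form_def distrib_right sum.distrib)
qed

text \<open>Exchange of one root \<open>y = (p, q)\<close> for another one \<open>z = (q, p')\<close>.  The extensions of the
  restricted form to the new domain differ by multiples of the \<open>z\<close>-entry, and conjugation by an
  element with \<open>y\<close>-entry \<open>s\<close> shifts this multiple by \<open>- c p p' s\<close>.\<close>

lemma eu_step_lin_af:
  fixes k :: "'a::field_char_0 set"
  assumes k: "is_subfield k" and N: "root_pattern n N" "derived_in N C"
    and y: "(p, q) \<in> N" "(p, q) \<notin> C" and z: "(q, p') \<in> N" "(q, p') \<notin> C" and yz: "(p, q) \<noteq> (q, p')"
    and R: "R = insert (p, q) C" and R': "R' = insert (q, p') C"
    and ck: "\<And>i j. c i j \<in> k" and cd: "\<And>i. c i i = 0" and cpp: "c p p' \<noteq> 0"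
    and iso: "\<And>i l j. (i, l) \<in> R \<Longrightarrow> (l, j) \<in> R \<Longrightarrow> c i j = 0"
    and iso': "\<And>i l j. (i, l) \<in> R' \<Longrightarrow> (l, j) \<in> R' \<Longrightarrow> c i j = 0"
  shows "eu_step k n (lin_af n R c) (lin_af n R' c)"
proof -
  have CN: "C \<subseteq> N" using N(2) by (simp add: derived_in_def)
  have sub: "C \<subseteq> R" "R \<subseteq> N" "C \<subseteq> R'" "R' \<subseteq> N" using CN y z R R' by auto
  have pat: "root_pattern n C" "root_pattern n R" "root_pattern n R'"
    using derived_in_root_pattern[OF N] sub CN by auto
  note b = root_patternD(1,2,5)[OF N(1) y(1)] root_patternD(2,5)[OF N(1) z(1)]
  have dom: "pattern_group n R \<inter> pattern_group n R' = (pattern_group n C :: 'a mat set)"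
    unfolding pattern_group_Int using R R' y z yz by (intro arg_cong[where f = "pattern_group n"]) auto
  \<comment> \<open>The candidates for \<open>Q\<close>: agreement with \<open>c\<close> on
    \<open>C\<close> leaves only the coefficient at \<open>z\<close> free.\<close>
  define g where "g e = (\<lambda>i j. c i j + (if i = q \<and> j = p' then e else 0))" for e
  have g0: "g 0 = c" by (simp add: g_def fun_eq_iff)
  have g_diag: "g e i i = 0" for e i using b(5) cd by (auto simp: g_def)
  have g_k: "g e i j \<in> k" if "e \<in> k" for e i j
    using that subfieldD(1)[OF k] by (auto simp: g_def intro!: subfieldD(3)[OF k] ck)
  have g_C: "g e i j = c i j" if "(i, j) \<in> C" for e i j using that z(2) by (auto simp: g_def)
  define Qs where "Qs = {Q. AF k n Q \<and> dom Q = pattern_group n R' \<and>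
    Q |` pattern_group n C = lin_af n R c |` pattern_group n C}"
  have FC: "lin_af n R c |` pattern_group n C = lin_af n C c" by (rule lin_af_restrict[OF sub(1)])
  have Qs_in: "lin_af n R' (g e) \<in> Qs" if "e \<in> k" for e
  proof -
    have "AF k n (lin_af n R' (g e))"
    proof (rule AF_lin_af[OF k pat(3)])
      show "g e i j = 0" if "(i, l) \<in> R'" "(l, j) \<in> R'" for i l j
      proof -
        have "(i, j) \<in> C" using that sub N(2) unfolding derived_in_def by blast
        then show ?thesis using g_C iso'[OF that] by simp
      qed
    qed (use g_k that g_diag in auto)
    moreover have "lin_af n C (g e) = lin_af n C c"
    proof
      fix x :: "'a mat"
      show "lin_af n C (g e) x = lin_af n C c x"
      proof (cases "x \<in> pattern_group n C")
        case True
        then have "x $$ (q, p') = 0" using pattern_groupD(4)[OF True b(2,4)] z(2) b(5) by simp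
        then show ?thesis unfolding lin_af_def g_def by (simp add: entry_form_update[OF b(2,4)])
      qed (simp add: lin_af_def)
    qed
    ultimately show ?thesis by (simp add: Qs_def FC lin_af_restrict[OF sub(3)])
  qed
  have Qs_out: "\<exists>e\<in>k. Q = lin_af n R' (g e)" if "Q \<in> Qs" for Q
  proof -
    obtain d where d: "Q = lin_af n R' d" "\<And>i j. d i j \<in> k" "\<And>i j. (i, j) \<notin> R' \<Longrightarrow> d i j = 0"
      using \<open>Q \<in> Qs\<close> AF_imp_lin_af[OF k pat(3), of Q] unfolding Qs_def by blast
    have dd: "d i i = 0" for i using d(3) root_patternD(3)[OF pat(3)] by blast
    have dC: "d i j = c i j" if ij: "(i, j) \<in> C" for i j
    proof -
      have "lin_af n C d = lin_af n C c"
        using \<open>Q \<in> Qs\<close> d(1) by (simp add: Qs_def FC lin_af_restrict[OF sub(3)])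
      then have "lin_af n C d (root_elem n i j 1) = lin_af n C c (root_elem n i j 1)" by simp
      then show ?thesis by (simp add: lin_af_root_elem[OF pat(1) ij dd] lin_af_root_elem[OF pat(1) ij cd])
    qed
    let ?e = "d q p' - c q p'"
    have "entry_form n d x = entry_form n (g ?e) x" if x: "x \<in> pattern_group n R'" for x
      unfolding entry_form_def
    proof (intro sum.cong refl)
      fix i j assume "i \<in> {..<n}" "j \<in> {..<n}"
      then have ij: "i < n" "j < n" by auto
      consider "(i, j) \<in> C" | "(i, j) = (q, p')" | "i = j" | "i \<noteq> j" "(i, j) \<notin> R'" using R' by auto
      then show "d i j * x $$ (i, j) = g ?e i j * x $$ (i, j)"
      proof cases
        case 4
        then show ?thesis using pattern_groupD(4)[OF x ij] by simp
      qed (use dC g_C dd g_diag in \<open>auto simp: g_def\<close>)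
    qed
    then have "Q = lin_af n R' (g ?e)" by (auto simp: d(1) lin_af_def fun_eq_iff)
    then show ?thesis using d(2) ck subfieldD(4)[OF k] by blast
  qed
  have conj: "conj_af n u (lin_af n R' (g e)) = lin_af n R' (g (e - c p p' * u $$ (p, q)))"
    if u: "u \<in> pattern_group n R" for u e
  proof
    fix x :: "'a mat"
    have uN: "u \<in> pattern_group n N" using u pattern_group_mono[OF sub(2)] by blast
    show "conj_af n u (lin_af n R' (g e)) x = lin_af n R' (g (e - c p p' * u $$ (p, q))) x"
    proof (cases "x \<in> pattern_group n R'")
      case True
      let ?w = "inv\<^bsub>GL n\<^esub> u * x * u"
      note w = conj_pattern_group[OF N sub(3,4) uN True]
      have wz: "?w $$ (q, p') = x $$ (q, p')" by (rule w(3)[OF b(2,4,5) z(2)])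
      let ?d = "g e"
      \<comment> \<open>Both sides evaluate the form on \<open>u * w = x * u\<close>, so the two
        defects of additivity determine the effect of the conjugation.\<close>
      have "entry_form n ?d u + entry_form n ?d ?w
            + (\<Sum>i<n. \<Sum>j<n. ?d i j * (\<Sum>l<n. off R u i l * off R' ?w l j))
          = entry_form n ?d x + entry_form n ?d u
            + (\<Sum>i<n. \<Sum>j<n. ?d i j * (\<Sum>l<n. off R' x i l * off R u l j))"
        using entry_form_mult[where c = ?d, OF pat(2,3) u w(1) g_diag]
          entry_form_mult[where c = ?d, OF pat(3,2) True u g_diag] w(2) by metis
      moreover have "(\<Sum>i<n. \<Sum>j<n. ?d i j * (\<Sum>l<n. off R' x i l * off R u l j)) = 0"
      proof -
        have "?d i j * (off R' x i l * off R u l j) = 0" for i j l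
        proof (cases "(i, l) \<in> R' \<and> (l, j) \<in> R")
          case il: True
          then have "(i, j) \<in> C" using sub N(2) unfolding derived_in_def by blast
          \<comment> \<open>If one factor lies in \<open>C\<close>, both roots lie in a common
            pattern. The remaining composite, \<open>z\<close> followed by \<open>y\<close>, would
            need \<open>p' = p\<close>, against \<open>c p p' \<noteq> 0\<close> and the zero
            diagonal.\<close>
          moreover have "c i j = 0"
            using il iso[of i l j] iso'[of i l j] cpp cd R R' by auto
          ultimately show ?thesis using g_C by simp
        qed (auto simp: off_def)
        then show ?thesis unfolding sum_distrib_left by (intro sum.neutral ballI)
      qed
      moreover have "(\<Sum>i<n. \<Sum>j<n. ?d i j * (\<Sum>l<n. off R u i l * off R' ?w l j))
          = c p p' * u $$ (p, q) * x $$ (q, p')"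
      proof -
        have t: "?d i j * (off R u i l * off R' ?w l j) =
          (if l = q then if j = p' then if i = p then c p p' * u $$ (p, q) * x $$ (q, p') else 0 else 0 else 0)"
          for i j l
        proof (cases "(i, l) \<in> R \<and> (l, j) \<in> R'")
          case il: True
          then have C: "(i, j) \<in> C" using sub N(2) unfolding derived_in_def by blast
          show ?thesis
          proof (cases "(i, l) = (p, q) \<and> (l, j) = (q, p')")
            case True
            then show ?thesis using g_C[OF C] R R' wz by (simp add: off_def)
          next
            case False
            \<comment> \<open>Unless the factors are \<open>y\<close> and \<open>z\<close>, one of
              them lies in \<open>C\<close>; then both belong to \<open>R\<close> or both to
              \<open>R'\<close>, where the form vanishes on composites.\<close>
            then have "c i j = 0" using il iso[of i l j] iso'[of i l j] R R' by auto
            then show ?thesis using g_C[OF C] False by auto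
          qed
        next
          case False
          then show ?thesis using R R' by (auto simp: off_def)
        qed
        show ?thesis using b by (simp add: sum_distrib_left t)
      qed
      ultimately have "entry_form n ?d ?w = entry_form n ?d x - c p p' * u $$ (p, q) * x $$ (q, p')"
        by (simp add: algebra_simps)
      then have "entry_form n (g e) ?w = entry_form n (g (e - c p p' * u $$ (p, q))) x"
        unfolding g_def by (simp add: entry_form_update[OF b(2,4)] algebra_simps)
      then show ?thesis
        unfolding conj_af_pattern[OF N sub(3,4) uN dom_lin_af] using True w(1)
        by (simp add: lin_af_def)
    next
      case False
      then show ?thesis
        unfolding conj_af_pattern[OF N sub(3,4) uN dom_lin_af] by (simp add: lin_af_def)
    qed
  qed
  have g_inj: "e = e'" if "lin_af n R' (g e) = lin_af n R' (g e')" for e e'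
  proof -
    have "lin_af n R' (g e) (root_elem n q p' 1) = lin_af n R' (g e') (root_elem n q p' 1)"
      using that by simp
    moreover have "(q, p') \<in> R'" using R' by simp
    ultimately have "g e q p' = g e' q p'"
      using lin_af_root_elem[OF pat(3), of q p' "g e" 1] lin_af_root_elem[OF pat(3), of q p' "g e'" 1]
        g_diag by simp
    then show ?thesis by (simp add: g_def)
  qed
  have k_C: "u $$ (p, q) = 0 \<longleftrightarrow> u \<in> k_points k (pattern_group n C)"
    if u: "u \<in> k_points k (pattern_group n R)" for u
  proof
    assume *: "u $$ (p, q) = 0"
    have "u \<in> pattern_group n C"
      using u * b(3) R by (intro pattern_group_offI[of u n R C]) (auto simp: k_points_def)
    then show "u \<in> k_points k (pattern_group n C)" using u by (simp add: k_points_def)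
  next
    assume "u \<in> k_points k (pattern_group n C)"
    then have "u \<in> pattern_group n C" by (simp add: k_points_def)
    from pattern_groupD(4)[OF this b(1,2) y(2)] show "u $$ (p, q) = 0" using b(3) by simp
  qed
  have k_R: "u \<in> pattern_group n R \<and> u $$ (p, q) \<in> k" if "u \<in> k_points k (pattern_group n R)" for u
    using that b(1,2) pattern_groupD(2,3)[of u n R] by (simp add: k_points_def)
  have ne: "pattern_group n C \<noteq> (pattern_group n R :: 'a mat set)"
    using pattern_group_psubset[OF pat(2), of C] R y(2) by auto
  have 1: "conj_af n u Q \<in> Qs" if uk: "u \<in> k_points k (pattern_group n R)" and QQ: "Q \<in> Qs" for u Q
  proof -
    obtain e where e: "e \<in> k" "Q = lin_af n R' (g e)" using Qs_out[OF QQ] by blast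
    show ?thesis using k_R[OF uk] e conj Qs_in subfieldD(4,5)[OF k] ck by simp
  qed
  have 2: "conj_af n u Q = Q \<longleftrightarrow> u \<in> k_points k (pattern_group n C)"
    if uk: "u \<in> k_points k (pattern_group n R)" and QQ: "Q \<in> Qs" for u Q
  proof -
    obtain e where e: "e \<in> k" "Q = lin_af n R' (g e)" using Qs_out[OF QQ] by blast
    have "conj_af n u Q = Q \<longleftrightarrow> u $$ (p, q) = 0"
      using g_inj[of "e - c p p' * u $$ (p, q)" e] cpp k_R[OF uk] by (auto simp: e conj)
    then show ?thesis using k_C[OF uk] by simp
  qed
  have 3: "\<exists>u\<in>k_points k (pattern_group n R). conj_af n u Q = Q'" if QQ: "Q \<in> Qs" and QQ': "Q' \<in> Qs" for Q Q'
  proof -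
    obtain e e' where e: "e \<in> k" "Q = lin_af n R' (g e)" "e' \<in> k" "Q' = lin_af n R' (g e')"
      using Qs_out[OF QQ] Qs_out[OF QQ'] by blast
    \<comment> \<open>The solution of \<open>e - c p p' * s = e'\<close>; it lies in
      \<open>k\<close>, which makes the action of the \<open>k\<close>-points transitive.\<close>
    let ?s = "(e - e') / c p p'"
    let ?u = "root_elem n p q ?s"
    have s: "?s \<in> k" using e ck by (intro subfieldD(7)[OF k] subfieldD(4)[OF k])
    have u: "?u \<in> pattern_group n R" using R by (intro root_elem_in_pattern_group) simp
    have "?u \<in> k_points k (pattern_group n R)"
      using u s subfieldD(1,2)[OF k] by (auto simp: k_points_def root_elem_def)
    moreover have "?u $$ (p, q) = ?s" using b by (simp add: root_elem_def)
    ultimately show ?thesis using conj[OF u, of e] cpp by (intro bexI[of _ ?u]) (auto simp: e)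
  qed
  have AFZ: "AF k n (lin_af n R' c)"
    by (rule AF_lin_af) (use k pat(3) ck cd iso' in blast)+
  show ?thesis
    unfolding eu_step_def Let_def dom_lin_af dom Qs_def[symmetric]
  proof (intro conjI ballI)
    show "lin_af n R c |` pattern_group n C = lin_af n R' c |` pattern_group n C"
      by (simp only: lin_af_restrict[OF sub(1)] lin_af_restrict[OF sub(3)])
    show "commutator n (pattern_group n R) (pattern_group n R) \<subseteq> pattern_group n C"
      "commutator n (pattern_group n R') (pattern_group n R') \<subseteq> pattern_group n C"
      "commutator n (pattern_group n R) (pattern_group n R') \<subseteq> pattern_group n C"
      by (rule commutator_pattern_group[OF N] sub)+
    show "conj_af n u Q \<in> Qs" "(conj_af n u Q = Q) = (u \<in> k_points k (pattern_group n C))"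
      if "u \<in> k_points k (pattern_group n R)" "Q \<in> Qs" for u Q
      using 1 2 that by blast+
    show "\<exists>u\<in>k_points k (pattern_group n R). conj_af n u Q = Q'" if "Q \<in> Qs" "Q' \<in> Qs" for Q Q'
      by (rule 3[OF that])
  qed (rule AFZ ne)+
qed

section \<open>Paths, and the shift of a set of chains by one level\<close>

definition af_rel :: "'a::field set \<Rightarrow> nat \<Rightarrow> 'a mat set \<Rightarrow> 'a af \<Rightarrow> 'a af \<Rightarrow> bool" where
  "af_rel k n H F Z \<longleftrightarrow> AF k n F \<and> dom F \<subseteq> H \<and> AF k n Z \<and> dom Z \<subseteq> H \<and>
     af_step k n (k_points k (H \<inter> carrier (GL n))) F Z"

lemma af_rel_path:
  assumes "(af_rel k n H)\<^sup>*\<^sup>* F Z" "AF k n F" "dom F \<subseteq> H"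
  shows "\<exists>Fs. af_path k n H F Z Fs"
  using assms(1)
proof (induction rule: rtranclp_induct)
  case base
  then show ?case using assms by (intro exI[of _ "[F]"]) (simp add: af_path_def)
next
  case (step Y Z)
  then obtain Fs where Fs: "af_path k n H F Y Fs" by blast
  have "af_step k n (k_points k (H \<inter> carrier (GL n))) ((Fs @ [Z]) ! i) ((Fs @ [Z]) ! Suc i)"
    if i: "Suc i < length (Fs @ [Z])" for i
  proof (cases "Suc i < length Fs")
    case True
    then show ?thesis using Fs by (simp add: af_path_def nth_append)
  next
    case False
    then have "Suc i = length Fs" "Fs ! i = Y"
      using i Fs by (auto simp: af_path_def last_conv_nth less_Suc_eq dest: sym[of "Suc i"])
    then show ?thesis using step by (simp add: nth_append af_rel_def)
  qed
  then show ?case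
    using Fs step by (intro exI[of _ "Fs @ [Z]"]) (auto simp: af_path_def af_rel_def)
qed

text \<open>Only comparisons of levels matter. For the block index this gives the radical of a
  standard parabolic; for levels that are not monotone in the index, a permuted version of
  one.\<close>

definition level_pattern :: "nat \<Rightarrow> (nat \<Rightarrow> nat) \<Rightarrow> (nat \<times> nat) set" where
  "level_pattern n l = {(i, j). i < n \<and> j < n \<and> l i < l j}"

lemma root_pattern_level: "root_pattern n (level_pattern n l)"
  by (auto simp: root_pattern_def level_pattern_def trans_def irrefl_def)

text \<open>Lowering the level of the vertices in \<open>S\<close> by one.  The roots lost are
  \<open>Y = {(p, q). p \<notin> S, q \<in> S, l q = l p + 1}\<close>; each \<open>(p, q)\<close> is exchanged, in the order of decreasing
  \<open>l p\<close>, for the new root \<open>(q, p')\<close> where \<open>p'\<close> is the successor of \<open>p\<close>; the remaining new roots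
  are then added by an extension step.\<close>

lemma level_shift_path:
  fixes k :: "'a::field_char_0 set"
  assumes k: "is_subfield k" and ck: "\<And>i j. c i j \<in> k"
    and c_less: "\<And>i j. c i j \<noteq> 0 \<Longrightarrow> i < n \<and> j < n"
    and c_level: "\<And>i j. c i j \<noteq> 0 \<Longrightarrow> l j = Suc (l i)"
    and c_S: "\<And>i j. c i j \<noteq> 0 \<Longrightarrow> i \<in> S \<longleftrightarrow> j \<in> S"
    and c_fun: "\<And>i j j'. c i j \<noteq> 0 \<Longrightarrow> c i j' \<noteq> 0 \<Longrightarrow> j = j'"
    and c_inj: "\<And>i i' j. c i j \<noteq> 0 \<Longrightarrow> c i' j \<noteq> 0 \<Longrightarrow> i = i'"
    and l': "\<And>v. v \<in> S \<Longrightarrow> l v = Suc (l' v)" "\<And>v. v \<notin> S \<Longrightarrow> l' v = l v"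
    and next_ex: "\<And>p q. p < n \<Longrightarrow> q < n \<Longrightarrow> p \<notin> S \<Longrightarrow> q \<in> S \<Longrightarrow> l q = Suc (l p) \<Longrightarrow> \<exists>p'. c p p' \<noteq> 0"
    and H: "\<And>R. root_pattern n R \<Longrightarrow> R \<subseteq> level_pattern n l \<union> level_pattern n l' \<Longrightarrow> pattern_group n R \<subseteq> H"
  shows "(af_rel k n H)\<^sup>*\<^sup>* (lin_af n (level_pattern n l) c) (lin_af n (level_pattern n l') c)"
proof -
  let ?R = "level_pattern n l" and ?R' = "level_pattern n l'"
  define N where "N = ?R \<union> ?R'"
  define C where "C = ?R \<inter> ?R'"
  define Y where "Y = ?R - ?R'"
  define nx where "nx p = (SOME p'. c p p' \<noteq> 0)" for p
  define \<phi> where "\<phi> = (\<lambda>(p, q::nat). (q, nx p))"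
  have cd: "c i i = 0" for i using c_level[of i i] by force
  have lv_iff: "l v = (if v \<in> S then Suc (l' v) else l' v)" for v
    using l' by (cases "v \<in> S") auto
  have lv: "l' v \<le> l v" "l v \<le> Suc (l' v)" for v
    by (simp_all add: lv_iff)
  have N_le: "l i \<le> l j \<and> l' i \<le> l' j \<and> (l i < l j \<or> l' i < l' j)" if "(i, j) \<in> N" for i j
  proof -
    have "l i < l j \<or> l' i < l' j" using that by (auto simp: N_def level_pattern_def)
    then show ?thesis using lv[of i] lv[of j] by linarith
  qed
  have N_less: "i < n \<and> j < n" if "(i, j) \<in> N" for i j
    using that by (auto simp: N_def level_pattern_def)
  \<comment> \<open>A root that raises only \<open>l\<close> leads from outside \<open>S\<close>
    into \<open>S\<close>, and one that raises only \<open>l'\<close> leads out of \<open>S\<close>.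
    Two of the same kind cannot follow each other, so a composite raises both levels.\<close>
  have der: "(i, j) \<in> C" if "(i, h) \<in> N" "(h, j) \<in> N" for i h j
  proof -
    have "l i < l j" "l' i < l' j"
      using N_le[OF that(1)] N_le[OF that(2)] lv[of i] lv[of j] by linarith+
    then show ?thesis using N_less that by (auto simp: C_def level_pattern_def)
  qed
  have CN: "C \<subseteq> N" by (auto simp: C_def N_def)
  have NC: "derived_in N C" using der CN by (auto simp: derived_in_def)
  have N: "root_pattern n N"
    unfolding root_pattern_def
  proof (intro conjI)
    show "trans N" using der CN unfolding trans_def by blast
    show "irrefl N" using N_le by (auto simp: irrefl_def)
  qed (use N_less in auto)
  have Y: "p \<notin> S \<and> q \<in> S \<and> l q = Suc (l p) \<and> p < n \<and> q < n" if "(p, q) \<in> Y" for p q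
  proof -
    have "l p < l q" "\<not> l' p < l' q" "p < n" "q < n" using that by (auto simp: Y_def level_pattern_def)
    then show ?thesis unfolding lv_iff by (auto split: if_splits)
  qed
  have YI: "(p, q) \<in> Y" if "p \<notin> S" "q \<in> S" "l q = Suc (l p)" "p < n" "q < n" for p q
    using that unfolding Y_def level_pattern_def lv_iff by simp
  have nx: "c p (nx p) \<noteq> 0" if "(p, q) \<in> Y" for p q
    unfolding nx_def by (rule someI_ex, rule next_ex[of p q]) (simp_all add: Y[OF that])
  have phi: "\<phi> (p, q) \<in> ?R' - ?R" if "(p, q) \<in> Y" for p q
  proof -
    have "nx p < n" "l (nx p) = Suc (l p)" "nx p \<notin> S"
      using Y[OF that] c_less[OF nx[OF that]] c_level[OF nx[OF that]] c_S[OF nx[OF that]] by simp_all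
    then show ?thesis using Y[OF that] unfolding \<phi>_def level_pattern_def lv_iff by auto
  qed
  have phi_inj: "inj_on \<phi> Y"
  proof (rule inj_onI)
    fix a b assume ab: "a \<in> Y" "b \<in> Y" "\<phi> a = \<phi> b"
    obtain p q p2 q2 where e: "a = (p, q)" "b = (p2, q2)" by fastforce
    then have "q = q2" "nx p = nx p2" using ab by (auto simp: \<phi>_def)
    then show "a = b" using c_inj[of p "nx p" p2] nx ab e by metis
  qed
  \<comment> \<open>\<open>W\<close> holds the lost roots still present; all other lost roots have
    already been replaced by their images.\<close>
  define st where "st W = C \<union> W \<union> \<phi> ` (Y - W)" for W
  \<comment> \<open>Closure under predecessor pairs records the order of the exchanges and is
    exactly what keeps the form additive on \<open>st W\<close>.\<close>
  define good where "good W \<longleftrightarrow> W \<subseteq> Y \<and> (\<forall>p q p2 q2. (p, q) \<in> W \<longrightarrow> c p2 p \<noteq> 0 \<longrightarrow> c q2 q \<noteq> 0 \<longrightarrow> (p2, q2) \<in> W)" for W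
  have st_sub: "C \<subseteq> st W" "st W \<subseteq> N" if "good W" for W
    using that phi by (auto simp: st_def good_def N_def C_def Y_def)
  have st_pat: "root_pattern n (st W)" if "good W" for W
    using derived_in_root_pattern[OF N NC st_sub[OF that]] .
  have iso_l: "c i j = 0" if "(i, h) \<in> ?R" "(h, j) \<in> ?R" for i h j
    using that c_level[of i j] by (force simp: level_pattern_def)
  have c_level': "l' j = Suc (l' i)" if "c i j \<noteq> 0" for i j
    using c_level[OF that] c_S[OF that] unfolding lv_iff by (auto split: if_splits)
  have iso_l': "c i j = 0" if "(i, h) \<in> ?R'" "(h, j) \<in> ?R'" for i h j
    using that c_level'[of i j] by (force simp: level_pattern_def)
  have iso: "c i j = 0" if W: "good W" and ih: "(i, h) \<in> st W" and hj: "(h, j) \<in> st W" for W i h j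
  proof (rule ccontr)
    assume cij: "c i j \<noteq> 0"
    have cases: "(a, b) \<in> ?R \<and> (a, b) \<in> ?R' \<or> (a, b) \<in> ?R \<and> (a, b) \<in> W \<or>
        (a, b) \<in> ?R' \<and> (\<exists>p q. (p, q) \<in> Y \<and> (p, q) \<notin> W \<and> a = q \<and> b = nx p)"
      if "(a, b) \<in> st W" for a b
      using that W phi unfolding st_def good_def C_def Y_def \<phi>_def by fastforce
    \<comment> \<open>Edges raise each of the two levels by exactly one, so a composite inside
      \<open>R\<close> or inside \<open>R'\<close> is harmless. What remains is a root of
      \<open>W\<close> next to an already exchanged one, in either order.\<close>
    have "\<not> ((i, h) \<in> ?R \<and> (h, j) \<in> ?R)" "\<not> ((i, h) \<in> ?R' \<and> (h, j) \<in> ?R')"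
      using iso_l iso_l' cij by blast+
    then consider "(i, h) \<in> W" "\<exists>p q. (p, q) \<in> Y \<and> (p, q) \<notin> W \<and> h = q \<and> j = nx p"
      | "(h, j) \<in> W" "\<exists>p q. (p, q) \<in> Y \<and> (p, q) \<notin> W \<and> i = q \<and> h = nx p"
      using cases[OF ih] cases[OF hj] by blast
    then show False
    proof cases
      case 1
      then obtain p where p: "(p, h) \<in> Y" "(p, h) \<notin> W" "j = nx p" by blast
      then have "p = i" using c_inj nx[OF p(1)] cij by blast
      then show False using 1 p by simp
    next
      case 2
      then obtain p where p: "(p, i) \<in> Y" "(p, i) \<notin> W" "h = nx p" by blast
      \<comment> \<open>Here \<open>(p, i)\<close> is the predecessor pair of \<open>(h, j)\<close>,
        the configuration that \<open>good\<close> is designed to exclude.\<close>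
      have "(p, i) \<in> W" using W 2(1) nx[OF p(1)] cij p(3) unfolding good_def by blast
      then show False using p by simp
    qed
  qed
  have AF: "AF k n (lin_af n (st W) c)" if "good W" for W
    by (rule AF_lin_af) (use k st_pat[OF that] ck cd iso[OF that] in blast)+
  have inH: "pattern_group n (st W) \<subseteq> H" if "good W" for W
    using H[OF st_pat[OF that]] st_sub(2)[OF that] by (simp add: N_def)
  have finY: "finite Y" using root_patternD(6)[OF root_pattern_level] by (auto simp: Y_def)
  have chain: "(af_rel k n H)\<^sup>*\<^sup>* (lin_af n (st W) c) (lin_af n (st {}) c)" if "good W" for W
  proof -
    have "finite W" using that finY finite_subset by (auto simp: good_def)
    then show ?thesis using that
    proof (induction W rule: finite_psubset_induct)
      case (psubset W)
      show ?case
      proof (cases "W = {}")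
        case False
        have "Max ((\<lambda>y. l (fst y)) ` W) \<in> (\<lambda>y. l (fst y)) ` W"
          using psubset.hyps False by (intro Max_in) auto
        then obtain p q where pq: "(p, q) \<in> W" "l p = Max ((\<lambda>y. l (fst y)) ` W)" by force
        have mx: "l p2 \<le> l p" if "(p2, q2) \<in> W" for p2 q2
          unfolding pq(2) using that psubset.hyps by (intro Max_ge) force+
        let ?W = "W - {(p, q)}"
        have WY: "W \<subseteq> Y" and pqY: "(p, q) \<in> Y" using psubset.prems pq by (auto simp: good_def)
        have good': "good ?W"
          unfolding good_def
        proof (intro conjI allI impI)
          fix p3 q3 p2 q2 assume a: "(p3, q3) \<in> ?W" "c p2 p3 \<noteq> 0" "c q2 q3 \<noteq> 0"
          then have "(p2, q2) \<in> W" using psubset.prems unfolding good_def by blast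
          \<comment> \<open>Otherwise \<open>p3\<close> would be one level above \<open>p\<close>,
            against the maximality of \<open>l p\<close> in \<open>W\<close>.\<close>
          moreover have "p2 \<noteq> p" using c_level[OF a(2)] mx[of p3 q3] a(1) by auto
          ultimately show "(p2, q2) \<in> ?W" by auto
        qed (use WY in auto)
        \<comment> \<open>The part common to the domains before and after the exchange; it takes the
          place of \<open>C\<close> in the exchange lemma.\<close>
        define D where "D = C \<union> ?W \<union> \<phi> ` (Y - W)"
        have e1: "st W = insert (p, q) D" using pq(1) by (auto simp: st_def D_def)
        have D: "derived_in N D"
          unfolding derived_in_def
        proof (intro conjI allI impI)
          show "D \<subseteq> N" using e1 st_sub(2)[OF psubset.prems] by auto
          show "(i, j) \<in> D" if "(i, h) \<in> N" "(h, j) \<in> N" for i h j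
            using der[OF that] by (simp add: D_def)
        qed
        have e2: "st ?W = insert (q, nx p) D"
        proof -
          have "Y - ?W = insert (p, q) (Y - W)" using pqY pq(1) by auto
          then show ?thesis by (auto simp: st_def D_def \<phi>_def)
        qed
        have n1: "(p, q) \<notin> D" using pqY phi by (auto simp: D_def C_def Y_def)
        have z: "(q, nx p) = \<phi> (p, q)" by (simp add: \<phi>_def)
        have n2: "(q, nx p) \<notin> D"
        proof -
          have "\<phi> (p, q) \<notin> ?R" using phi[OF pqY] by blast
          moreover have "C \<union> ?W \<subseteq> ?R" using WY by (auto simp: C_def Y_def)
          moreover have "\<phi> (p, q) \<notin> \<phi> ` (Y - W)"
            using inj_on_image_mem_iff[OF phi_inj pqY, of "Y - W"] pq(1) by blast
          ultimately show ?thesis unfolding z D_def by blast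
        qed
        have "eu_step k n (lin_af n (st W) c) (lin_af n (st ?W) c)"
        proof (rule eu_step_lin_af[where c = c, OF k N D _ n1 _ n2 _ e1 e2])
          show "c p (nx p) \<noteq> 0" by (rule nx[OF pqY])
          show "c i j \<in> k" "c i i = 0" for i j by (rule ck cd)+
          show "(p, q) \<in> N" using pqY by (auto simp: N_def Y_def)
          show "(q, nx p) \<in> N" unfolding z using phi[OF pqY] by (auto simp: N_def)
          show "(p, q) \<noteq> (q, nx p)" unfolding z using phi[OF pqY] pqY by (auto simp: Y_def)
          show "c i j = 0" if "(i, h) \<in> st W" "(h, j) \<in> st W" for i h j
            using iso[OF psubset.prems that] .
          show "c i j = 0" if "(i, h) \<in> st ?W" "(h, j) \<in> st ?W" for i h j
            using iso[OF good' that] .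
        qed
        then have "af_rel k n H (lin_af n (st W) c) (lin_af n (st ?W) c)"
          using AF[OF psubset.prems] AF[OF good'] inH[OF psubset.prems] inH[OF good']
          by (simp add: af_rel_def af_step_def)
        moreover have "(af_rel k n H)\<^sup>*\<^sup>* (lin_af n (st ?W) c) (lin_af n (st {}) c)"
          using pq(1) good' by (intro psubset.IH) auto
        ultimately show ?thesis by (rule converse_rtranclp_into_rtranclp)
      qed simp
    qed
  qed
  have goodY: "good Y"
    unfolding good_def
  proof (intro conjI allI impI order_refl)
    fix p q p2 q2 assume a: "(p, q) \<in> Y" "c p2 p \<noteq> 0" "c q2 q \<noteq> 0"
    then show "(p2, q2) \<in> Y"
      using Y[OF a(1)] c_level[OF a(2)] c_level[OF a(3)] c_S[OF a(2)] c_S[OF a(3)]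
        c_less[OF a(2)] c_less[OF a(3)] by (intro YI) auto
  qed
  have good0: "good {}" by (simp add: good_def)
  have stY: "st Y = ?R" by (auto simp: st_def C_def Y_def)
  have st0: "st {} \<subseteq> ?R'" using phi by (auto simp: st_def C_def)
  have R'N: "derived_in ?R' C"
    unfolding derived_in_def
  proof (intro conjI allI impI)
    show "C \<subseteq> ?R'" by (simp add: C_def)
    show "(i, j) \<in> C" if "(i, h) \<in> ?R'" "(h, j) \<in> ?R'" for i h j
      using that by (intro der[of i h j]) (simp_all add: N_def)
  qed
  \<comment> \<open>An e-step must enlarge the domain properly, so the case in which the exchanges
    already fill the new pattern is separate.\<close>
  have "(af_rel k n H)\<^sup>*\<^sup>* (lin_af n (st {}) c) (lin_af n ?R' c)"
  proof (cases "st {} = ?R'")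
    case False
    have "e_step k n (lin_af n (st {}) c) (lin_af n ?R' c)"
    proof (rule e_step_lin_af[where c = c, OF k root_pattern_level R'N])
      show "C \<subseteq> st {}" by (rule st_sub(1)[OF good0])
      show "st {} \<subset> ?R'" using st0 False by blast
    qed (rule ck cd iso_l', assumption?)+
    moreover have "AF k n (lin_af n ?R' c)"
      by (rule AF_lin_af) (use k root_pattern_level ck cd iso_l' in blast)+
    moreover have "pattern_group n ?R' \<subseteq> H" by (rule H[OF root_pattern_level]) simp
    ultimately have "af_rel k n H (lin_af n (st {}) c) (lin_af n ?R' c)"
      using AF[OF good0] inH[OF good0] by (simp add: af_rel_def af_step_def)
    then show ?thesis by simp
  qed simp
  then show ?thesis using chain[OF goodY] unfolding stY by (rule rtranclp_trans[rotated])
qed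

section \<open>Richardson orbits of right-justified chains\<close>

text \<open>\<open>c_total\<close> is right justification: a chain can stop only at the top level
  \<open>M\<close>. The starting levels are arbitrary.\<close>

locale chain_weights =
  fixes n :: nat and c :: "nat \<Rightarrow> nat \<Rightarrow> 'a::field_char_0" and L :: "nat \<Rightarrow> nat" and M :: nat
  assumes c_less: "c i j \<noteq> 0 \<Longrightarrow> i < n \<and> j < n"
    and c_level: "c i j \<noteq> 0 \<Longrightarrow> L j = Suc (L i)"
    and c_fun: "c i j \<noteq> 0 \<Longrightarrow> c i j' \<noteq> 0 \<Longrightarrow> j = j'"
    and c_inj: "c i j \<noteq> 0 \<Longrightarrow> c i' j \<noteq> 0 \<Longrightarrow> i = i'"
    and L_le: "i < n \<Longrightarrow> L i \<le> M"
    and c_total: "i < n \<Longrightarrow> L i < M \<Longrightarrow> \<exists>j. c i j \<noteq> 0"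
begin

section \<open>Chains and their reversal\<close>

definition nx :: "nat \<Rightarrow> nat" where "nx i = (SOME j. c i j \<noteq> 0)"

lemma nx: "i < n \<Longrightarrow> L i < M \<Longrightarrow> c i (nx i) \<noteq> 0"
  unfolding nx_def using c_total by (rule someI_ex)

lemma nx_eq: "c i j \<noteq> 0 \<Longrightarrow> nx i = j"
  unfolding nx_def by (rule some_equality) (auto intro: c_fun)

lemma nx_less: "i < n \<Longrightarrow> L i < M \<Longrightarrow> nx i < n" and nx_level: "i < n \<Longrightarrow> L i < M \<Longrightarrow> L (nx i) = Suc (L i)"
  using nx c_less c_level by blast+

lemma nx_inj: "i < n \<Longrightarrow> L i < M \<Longrightarrow> j < n \<Longrightarrow> L j < M \<Longrightarrow> nx i = nx j \<Longrightarrow> i = j"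
  using nx[of i] nx[of j] c_inj by metis

lemma c_less_M: "c i j \<noteq> 0 \<Longrightarrow> L i < M"
  using c_level[of i j] c_less[of i j] L_le[of j] by simp

definition chain_end :: "nat \<Rightarrow> nat" where "chain_end v = (nx ^^ (M - L v)) v"

lemma chain_end_nx: "v < n \<Longrightarrow> L v < M \<Longrightarrow> chain_end (nx v) = chain_end v"
proof -
  assume v: "v < n" "L v < M"
  then have "M - L v = Suc (M - L (nx v))" using nx_level[OF v] by simp
  then show ?thesis by (simp add: chain_end_def funpow_Suc_right del: funpow.simps)
qed

text \<open>\<open>chain_end\<close> names the chain and \<open>L\<close> the position on it, so
  these two serve as coordinates; later identities between vertices are proved by comparing
  them.\<close>

lemma chain_unique:
  assumes "v < n" "w < n" "L v = L w" "chain_end v = chain_end w"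
  shows "v = w"
  using assms
proof (induction "M - L v" arbitrary: v w)
  case 0
  have "L v = M" using 0(1) L_le[OF 0(2)] by linarith
  moreover have "L w = M" using calculation 0(4) by simp
  ultimately show ?case using 0(5) by (simp add: chain_end_def)
next
  case (Suc m)
  then have lt: "L v < M" "L w < M" by linarith+
  have "nx v = nx w"
  proof (rule Suc.hyps(1))
    show "m = M - L (nx v)" using Suc.hyps(2) nx_level[OF Suc.prems(1) lt(1)] by simp
    show "L (nx v) = L (nx w)"
      using nx_level[OF Suc.prems(1) lt(1)] nx_level[OF Suc.prems(2) lt(2)] Suc.prems(3) by simp
    show "chain_end (nx v) = chain_end (nx w)"
      using chain_end_nx[OF Suc.prems(1) lt(1)] chain_end_nx[OF Suc.prems(2) lt(2)] Suc.prems(4) by simp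
  qed (rule nx_less[OF Suc.prems(1) lt(1)] nx_less[OF Suc.prems(2) lt(2)])+
  then show ?case by (rule nx_inj[OF Suc.prems(1) lt(1) Suc.prems(2) lt(2)])
qed

lemma chain_walk:
  assumes "v < n" "t \<le> M - L v"
  shows "(nx ^^ t) v < n \<and> L ((nx ^^ t) v) = L v + t \<and> chain_end ((nx ^^ t) v) = chain_end v"
  using assms(2)
proof (induction t)
  case (Suc t)
  then have "L ((nx ^^ t) v) < M" by simp
  then show ?case using Suc nx_less nx_level chain_end_nx by simp
qed (simp add: assms)

definition start_level :: "nat \<Rightarrow> nat" where
  "start_level v = Min (L ` {w. w < n \<and> chain_end w = chain_end v})"

lemma start_level_le: "w < n \<Longrightarrow> chain_end w = chain_end v \<Longrightarrow> start_level v \<le> L w"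
  unfolding start_level_def by (rule Min_le) auto

lemma chain_level_exists:
  assumes v: "v < n" and t: "start_level v \<le> t" "t \<le> M"
  shows "\<exists>w<n. chain_end w = chain_end v \<and> L w = t"
proof -
  have "start_level v \<in> L ` {w. w < n \<and> chain_end w = chain_end v}"
    unfolding start_level_def by (rule Min_in) (use v in auto)
  then obtain u where u: "u < n" "chain_end u = chain_end v" "L u = start_level v" by auto
  then show ?thesis using chain_walk[of u "t - L u"] t by (intro exI[of _ "(nx ^^ (t - L u)) u"]) auto
qed

text \<open>Reflection of the levels of a chain, which run from its start level to
  \<open>M\<close>.\<close>

definition chain_rev :: "nat \<Rightarrow> nat" where
  "chain_rev v = (SOME w. w < n \<and> chain_end w = chain_end v \<and> L w = M + start_level v - L v)"

lemma chain_rev: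
  assumes v: "v < n"
  shows "chain_rev v < n" "chain_end (chain_rev v) = chain_end v"
    "L (chain_rev v) = M + start_level v - L v"
proof -
  have "\<exists>w<n. chain_end w = chain_end v \<and> L w = M + start_level v - L v"
    using start_level_le[OF v refl] L_le[OF v] by (intro chain_level_exists[OF v]) auto
  then have "\<exists>w. w < n \<and> chain_end w = chain_end v \<and> L w = M + start_level v - L v" by blast
  from someI_ex[OF this] show "chain_rev v < n" "chain_end (chain_rev v) = chain_end v"
    "L (chain_rev v) = M + start_level v - L v" unfolding chain_rev_def by auto
qed

lemma start_level_cong: "chain_end v = chain_end w \<Longrightarrow> start_level v = start_level w"
  by (simp add: start_level_def)

lemma chain_rev_rev: "v < n \<Longrightarrow> chain_rev (chain_rev v) = v"
proof -
  assume v: "v < n"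
  note r = chain_rev[OF v] and rr = chain_rev[OF chain_rev(1)[OF v]]
  have "L (chain_rev (chain_rev v)) = L v"
    unfolding rr(3) r(3) start_level_cong[OF r(2)] using L_le[OF v] start_level_le[OF v refl] by linarith
  moreover have "chain_end (chain_rev (chain_rev v)) = chain_end v" using rr(2) r(2) by (rule trans)
  ultimately show ?thesis by (rule chain_unique[OF rr(1) v])
qed

text \<open>Reversal turns the edge from \<open>v\<close> to \<open>nx v\<close> into the edge from
  \<open>chain_rev (nx v)\<close> to \<open>chain_rev v\<close>; this is why it produces the
  transpose.\<close>

lemma nx_chain_rev_nx:
  assumes v: "v < n" "L v < M"
  shows "L (chain_rev (nx v)) < M" "nx (chain_rev (nx v)) = chain_rev v"
proof -
  have w: "nx v < n" "L (nx v) = Suc (L v)" "chain_end (nx v) = chain_end v"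
    using v nx_less nx_level chain_end_nx by auto
  have s: "start_level (nx v) = start_level v" "start_level v \<le> L v"
    using start_level_cong[OF w(3)] start_level_le[OF v(1) refl] by auto
  note r = chain_rev[OF w(1)]
  show lt: "L (chain_rev (nx v)) < M" using r(3) w(2) s v(2) by simp
  show "nx (chain_rev (nx v)) = chain_rev v"
  proof (rule chain_unique)
    show "nx (chain_rev (nx v)) < n" using nx_less[OF r(1) lt] .
    show "L (nx (chain_rev (nx v))) = L (chain_rev v)"
      using nx_level[OF r(1) lt] r(3) chain_rev(3)[OF v(1)] w(2) s v(2) by simp
    show "chain_end (nx (chain_rev (nx v))) = chain_end (chain_rev v)"
      using chain_end_nx[OF r(1) lt] r(2) chain_rev(2)[OF v(1)] w(3) by simp
  qed (rule chain_rev(1)[OF v(1)])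
qed

lemma chain_rev_start:
  assumes v: "v < n" "L v = M"
  shows "c u (chain_rev v) = 0"
proof (rule ccontr)
  assume u: "c u (chain_rev v) \<noteq> 0"
  have "chain_end u = chain_end v"
    using chain_end_nx[of u] c_less[OF u] c_less_M[OF u] nx_eq[OF u] chain_rev(2)[OF v(1)] by simp
  then have "start_level v \<le> L u" using c_less[OF u] by (intro start_level_le) auto
  then show False using c_level[OF u] chain_rev(3)[OF v(1)] v(2) by simp
qed

text \<open>Product of the coefficients from \<open>v\<close> to the end of its chain. It supplies
  the diagonal scaling needed because the coefficients along a chain differ.\<close>

definition tail_weight :: "nat \<Rightarrow> 'a" where
  "tail_weight v = (\<Prod>t<M - L v. c ((nx ^^ t) v) ((nx ^^ Suc t) v))"

lemma tail_weight_nx: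
  assumes "v < n" "L v < M"
  shows "tail_weight v = c v (nx v) * tail_weight (nx v)"
proof -
  have "M - L v = Suc (M - L (nx v))" using nx_level[OF assms] assms by simp
  then show ?thesis
    unfolding tail_weight_def by (simp only: prod.lessThan_Suc_shift funpow_Suc_right o_apply funpow_0 funpow.simps id_apply)
qed

lemma tail_weight_nz: "v < n \<Longrightarrow> tail_weight v \<noteq> 0"
proof (induction "M - L v" arbitrary: v)
  case 0
  then show ?case by (simp add: tail_weight_def)
next
  case (Suc m)
  then have lt: "L v < M" by simp
  have "tail_weight (nx v) \<noteq> 0" using Suc nx_less nx_level lt by (intro Suc.hyps(1)) auto
  then show ?case using tail_weight_nx[OF Suc.prems lt] nx[OF Suc.prems lt] by simp
qed

definition G :: "'a mat" where "G = mat n n (\<lambda>(i, j). c i j)"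

text \<open>Reversing all chains conjugates \<open>G\<close> to its transpose.\<close>

lemma similar_transpose: "similar_mat (mat n n (\<lambda>(i, j). c j i)) G"
proof -
  let ?J = "mat n n (\<lambda>(i, j). c j i)"
  \<comment> \<open>Intertwining requires \<open>d i * c (chain_rev (nx i)) (chain_rev i) = c i (nx
    i) * d (nx i)\<close>. This product solves the recursion and is invariant under reversal, so
    that \<open>T\<close> is inverse to \<open>S\<close>.\<close>
  define d where "d v = tail_weight v * tail_weight (chain_rev v)" for v
  have d_nz: "d v \<noteq> 0" if "v < n" for v
    using that tail_weight_nz chain_rev(1) by (simp add: d_def)
  have d_rev: "d (chain_rev v) = d v" if "v < n" for v
    using chain_rev_rev[OF that] by (simp add: d_def)
  define S where "S = mat n n (\<lambda>(i, j). if j = chain_rev i then d i else 0)"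
  define T where "T = mat n n (\<lambda>(i, j). if j = chain_rev i then 1 / d i else 0)"
  have carr: "S \<in> carrier_mat n n" "T \<in> carrier_mat n n" "?J \<in> carrier_mat n n" "G \<in> carrier_mat n n"
    by (simp_all add: S_def T_def G_def)
  have row: "(mat n n (\<lambda>(i, j). if j = chain_rev i then w i else 0) * B) $$ (i, j) = w i * B $$ (chain_rev i, j)"
    if "i < n" "j < n" "B \<in> carrier_mat n n" for i j w and B :: "'a mat"
  proof -
    have "(mat n n (\<lambda>(i, j). if j = chain_rev i then w i else 0) * B) $$ (i, j) =
        (\<Sum>l<n. (if l = chain_rev i then w i else 0) * B $$ (l, j))"
      using that by (subst mult_mat_index[of _ n n _ n]) auto
    also have "\<dots> = (\<Sum>l<n. if l = chain_rev i then w i * B $$ (l, j) else 0)"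
      by (rule sum.cong) auto
    finally show ?thesis using that chain_rev(1) by simp
  qed
  have ST: "S * T = 1\<^sub>m n"
  proof (rule eq_matI)
    fix i j assume "i < dim_row (1\<^sub>m n :: 'a mat)" "j < dim_col (1\<^sub>m n :: 'a mat)"
    then have ij: "i < n" "j < n" by auto
    have "(S * T) $$ (i, j) = d i * T $$ (chain_rev i, j)"
      using ij carr unfolding S_def by (intro row)
    then show "(S * T) $$ (i, j) = 1\<^sub>m n $$ (i, j)"
      using ij chain_rev(1)[OF ij(1)] chain_rev_rev[OF ij(1)] d_rev[OF ij(1)] d_nz[OF ij(1)]
      by (auto simp: T_def)
  qed (simp_all add: S_def T_def)
  have TS: "T * S = 1\<^sub>m n"
    using mat_mult_left_right_inverse[OF carr(1,2) ST] .
  have "S * ?J = G * S"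
  proof (rule eq_matI)
    fix i j assume "i < dim_row (G * S)" "j < dim_col (G * S)"
    then have ij: "i < n" "j < n" using carr by auto
    have r: "chain_rev i < n" by (rule chain_rev(1)[OF ij(1)])
    have 1: "(S * ?J) $$ (i, j) = d i * c j (chain_rev i)"
      using ij r row[OF ij carr(3), of d] unfolding S_def by simp
    have 2: "(G * S) $$ (i, j) = (\<Sum>l<n. c i l * (if j = chain_rev l then d l else 0))"
      using ij by (subst mult_mat_index[OF carr(4,1)]) (auto simp: G_def S_def)
    show "(S * ?J) $$ (i, j) = (G * S) $$ (i, j)"
    proof (cases "L i < M")
      case True
      note nr = nx_chain_rev_nx[OF ij(1) True] and nl = nx_less[OF ij(1) True]
      have w: "c i l * (if j = chain_rev l then d l else 0)
          = (if l = nx i then c i (nx i) * (if j = chain_rev (nx i) then d (nx i) else 0) else 0)" for l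
        using nx_eq[of i l] by (cases "c i l = 0") auto
      have 3: "(G * S) $$ (i, j) = c i (nx i) * (if j = chain_rev (nx i) then d (nx i) else 0)"
        unfolding 2 sum.cong[OF refl w] using nl by simp
      have cr: "c (chain_rev (nx i)) (chain_rev i) \<noteq> 0"
        using nx[OF chain_rev(1)[OF nl] nr(1)] nr(2) by simp
      show ?thesis
      proof (cases "j = chain_rev (nx i)")
        case True
        have "tail_weight (chain_rev (nx i)) = c (chain_rev (nx i)) (chain_rev i) * tail_weight (chain_rev i)"
          using tail_weight_nx[OF chain_rev(1)[OF nl] nr(1)] nr(2) by simp
        then show ?thesis unfolding 1 3 d_def
          using True tail_weight_nx[OF ij(1) \<open>L i < M\<close>] by (simp add: algebra_simps)
      next
        case False
        then have "c j (chain_rev i) = 0" using c_inj[OF cr] by blast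
        then show ?thesis unfolding 1 3 using False by simp
      qed
    next
      case False
      then have LM: "L i = M" using L_le[OF ij(1)] by simp
      have "c i l = 0" for l using c_less_M[of i l] LM by auto
      then show ?thesis unfolding 1 2 using chain_rev_start[OF ij(1) LM] by simp
    qed
  qed (simp_all add: S_def G_def)
  then have "T * (S * ?J) = T * (G * S)" by simp
  then have "?J = T * G * S"
    unfolding assoc_mult_mat[OF carr(2,1,3), symmetric] assoc_mult_mat[OF carr(2,4,1), symmetric] TS
    using carr(3) by simp
  moreover have "{?J, G, T, S} \<subseteq> carrier_mat n n" using carr by blast
  ultimately show ?thesis using ST TS by (intro similar_matI[of _ _ T S n])
qed

section \<open>The orbit of the coefficient matrix is open and dense in the Lie algebra\<close>

abbreviation \<u> :: "'a mat set" where "\<u> \<equiv> pattern_algebra n (level_pattern n L)"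

lemma uD: "X \<in> \<u> \<Longrightarrow> X \<in> carrier_mat n n" "X \<in> \<u> \<Longrightarrow> i < n \<Longrightarrow> j < n \<Longrightarrow> \<not> L i < L j \<Longrightarrow> X $$ (i, j) = 0"
  by (auto simp: pattern_algebra_def level_pattern_def)

lemma G_in_u: "G \<in> \<u>"
proof -
  have "c i j = 0" if "\<not> L i < L j" for i j using c_level[of i j] that by force
  then show ?thesis by (simp add: G_def pattern_algebra_def level_pattern_def)
qed

definition block_upper :: "'a mat \<Rightarrow> bool" where
  "block_upper A \<longleftrightarrow> A \<in> carrier_mat n n \<and> (\<forall>i<n. \<forall>j<n. L j < L i \<longrightarrow> A $$ (i, j) = 0)"

lemma G_mult_entry:
  assumes "A \<in> carrier_mat n n" "i < n" "j < n"
  shows "L i < M \<Longrightarrow> (G * A) $$ (i, j) = c i (nx i) * A $$ (nx i, j)"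
    "L i = M \<Longrightarrow> (G * A) $$ (i, j) = 0"
proof -
  have *: "(G * A) $$ (i, j) = (\<Sum>l<n. c i l * A $$ (l, j))"
    using assms by (subst mult_mat_index[of _ n n _ n]) (auto simp: G_def)
  show "(G * A) $$ (i, j) = c i (nx i) * A $$ (nx i, j)" if lt: "L i < M"
  proof -
    have w: "c i l * A $$ (l, j) = (if l = nx i then c i (nx i) * A $$ (nx i, j) else 0)" for l
      using nx_eq[of i l] by (cases "c i l = 0") auto
    show ?thesis unfolding * sum.cong[OF refl w] using nx_less[OF assms(2) lt] by simp
  qed
  show "(G * A) $$ (i, j) = 0" if LM: "L i = M"
  proof -
    have "c i l = 0" for l using c_less_M[of i l] LM by auto
    then show ?thesis unfolding * by simp
  qed
qed

text \<open>By right justification the image of \<open>G^t\<close> is the span of all basis vectors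
  of level at most \<open>M - t\<close>, and \<open>X^t\<close> maps everything into that span. So
  \<open>P\<close> preserves the flag of levels; the induction is the entrywise form of
  this.\<close>

lemma intertwiner_block_upper:
  assumes X: "X \<in> \<u>" and P: "P \<in> carrier_mat n n" and eq: "X * P = P * G"
  shows "block_upper P"
proof -
  have "P $$ (x, z) = 0" if "x < n" "z < n" "L z < L x" for x z
    using that
  proof (induction "M - L x" arbitrary: x z rule: less_induct)
    case less
    have lt: "L z < M" using less.prems L_le[of x] by simp
    let ?w = "nx z"
    have w: "?w < n" "L ?w = Suc (L z)" "c z ?w \<noteq> 0"
      using nx_less nx_level nx less.prems(2) lt by auto
    have "(P * G) $$ (x, ?w) = (\<Sum>l<n. P $$ (x, l) * c l ?w)"
      using less.prems w(1) P by (subst mult_mat_index[of _ n n _ n]) (auto simp: G_def)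
    also have "\<dots> = (\<Sum>l<n. if l = z then P $$ (x, z) * c z ?w else 0)"
      using c_inj[OF w(3)] by (intro sum.cong refl) auto
    finally have 1: "(P * G) $$ (x, ?w) = P $$ (x, z) * c z ?w" using less.prems by simp
    have "(X * P) $$ (x, ?w) = (\<Sum>l<n. X $$ (x, l) * P $$ (l, ?w))"
      using less.prems w(1) P uD(1)[OF X] by (intro mult_mat_index)
    also have "\<dots> = 0"
    proof (intro sum.neutral ballI)
      fix l assume "l \<in> {..<n}"
      then have l: "l < n" by simp
      show "X $$ (x, l) * P $$ (l, ?w) = 0"
      proof (cases "L x < L l")
        case True
        then have "P $$ (l, ?w) = 0"
          using less.prems w l L_le[OF l] by (intro less.hyps) auto
        then show ?thesis by simp
      next
        case False
        then show ?thesis using uD(2)[OF X less.prems(1) l] by simp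
      qed
    qed
    finally show ?case using 1 eq w(3) by simp
  qed
  then show ?thesis using P by (simp add: block_upper_def)
qed

lemma block_upper_inverse:
  assumes P: "block_upper P" and Q: "Q \<in> carrier_mat n n" and PQ: "P * Q = 1\<^sub>m n"
  shows "block_upper Q"
proof -
  have cP: "P \<in> carrier_mat n n" using P by (simp add: block_upper_def)
  have "Q $$ (x, z) = 0" if xz: "x < n" "z < n" "L z < L x" for x z
  proof -
    let ?t = "L x"
    \<comment> \<open>Cutting at the level of \<open>x\<close>: \<open>?D\<close> and
      \<open>?E\<close> are the lower right corners of \<open>P\<close> and \<open>Q\<close>,
      completed by the identity, and \<open>?C\<close> is the lower left corner of \<open>Q\<close>.
      The corner of \<open>P\<close> is invertible and annihilates \<open>?C\<close>.\<close>
    let ?cut = "\<lambda>A. mat n n (\<lambda>(i, j). if ?t \<le> L i \<and> ?t \<le> L j then A $$ (i, j) else if i = j then 1 else 0) :: 'a mat"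
    let ?D = "?cut P" and ?E = "?cut Q"
    let ?C = "mat n n (\<lambda>(i, j). if ?t \<le> L i \<and> L j < ?t then Q $$ (i, j) else 0) :: 'a mat"
    have PQe: "(\<Sum>l<n. (if ?t \<le> L l then P $$ (i, l) * Q $$ (l, j) else 0)) = (if i = j then 1 else 0)"
      if ij: "i < n" "j < n" "?t \<le> L i" for i j
    proof -
      have "(\<Sum>l<n. (if ?t \<le> L l then P $$ (i, l) * Q $$ (l, j) else 0)) = (\<Sum>l<n. P $$ (i, l) * Q $$ (l, j))"
        using P ij by (intro sum.cong refl) (auto simp: block_upper_def)
      also have "\<dots> = (P * Q) $$ (i, j)" using mult_mat_index[OF cP Q ij(1,2)] by simp
      finally show ?thesis using PQ ij by simp
    qed
    have DE: "?D * ?E = 1\<^sub>m n"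
    proof (rule eq_matI)
      fix i j assume "i < dim_row (1\<^sub>m n :: 'a mat)" "j < dim_col (1\<^sub>m n :: 'a mat)"
      then have ij: "i < n" "j < n" by auto
      have "(?D * ?E) $$ (i, j) = (\<Sum>l<n. ?D $$ (i, l) * ?E $$ (l, j))"
        using ij by (intro mult_mat_index) auto
      also have "\<dots> = (if i = j then 1 else 0)"
      proof (cases "?t \<le> L i")
        case True
        show ?thesis
        proof (cases "?t \<le> L j")
          case j: True
          have "(\<Sum>l<n. ?D $$ (i, l) * ?E $$ (l, j)) =
              (\<Sum>l<n. (if ?t \<le> L l then P $$ (i, l) * Q $$ (l, j) else 0))"
            using True j ij by (intro sum.cong refl) auto
          then show ?thesis using PQe[OF ij True] by simp
        next
          case False
          then show ?thesis using True ij by (intro sum.neutral[THEN trans]) auto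
        qed
      next
        case False
        have "(\<Sum>l<n. ?D $$ (i, l) * ?E $$ (l, j)) = (\<Sum>l<n. if l = i then ?E $$ (i, j) else 0)"
          using False ij by (intro sum.cong refl) auto
        then show ?thesis using False ij by simp
      qed
      finally show "(?D * ?E) $$ (i, j) = 1\<^sub>m n $$ (i, j)" using ij by simp
    qed auto
    have ED: "?E * ?D = 1\<^sub>m n" by (rule mat_mult_left_right_inverse[OF _ _ DE]) auto
    have DC: "?D * ?C = 0\<^sub>m n n"
    proof (rule eq_matI)
      fix i j assume "i < dim_row (0\<^sub>m n n :: 'a mat)" "j < dim_col (0\<^sub>m n n :: 'a mat)"
      then have ij: "i < n" "j < n" by auto
      have "(?D * ?C) $$ (i, j) = (\<Sum>l<n. ?D $$ (i, l) * ?C $$ (l, j))"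
        using ij by (intro mult_mat_index) auto
      also have "\<dots> = 0"
      proof (cases "?t \<le> L i \<and> L j < ?t")
        case True
        have "(\<Sum>l<n. ?D $$ (i, l) * ?C $$ (l, j)) =
            (\<Sum>l<n. (if ?t \<le> L l then P $$ (i, l) * Q $$ (l, j) else 0))"
          using True ij by (intro sum.cong refl) auto
        also have "\<dots> = (if i = j then 1 else 0)" using PQe[of i j] ij True by simp
        finally show ?thesis using True by auto
      next
        case False
        then show ?thesis using ij by (intro sum.neutral) auto
      qed
      finally show "(?D * ?C) $$ (i, j) = 0\<^sub>m n n $$ (i, j)" using ij by simp
    qed auto
    have "?C = (?E * ?D) * ?C" unfolding ED by simp
    also have "\<dots> = ?E * (?D * ?C)" by (rule assoc_mult_mat[of _ n n _ n _ n]) auto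
    also have "\<dots> = 0\<^sub>m n n" unfolding DC by simp
    finally have "?C $$ (x, z) = 0" using xz by (metis index_zero_mat(1))
    then show ?thesis using xz by simp
  qed
  then show ?thesis using Q by (simp add: block_upper_def)
qed

text \<open>Starting from an intertwiner \<open>g0\<close> of \<open>X0\<close> and \<open>G\<close>, keep its rows at the chain starts and
  propagate them along the chains by multiplication with \<open>X\<close>.  After \<open>M\<close> rounds this is a
  matrix \<open>g\<close> with \<open>g X = G g\<close> which depends polynomially on \<open>X\<close> and equals \<open>g0\<close> at \<open>X0\<close>.\<close>

definition pd :: "nat \<Rightarrow> nat" where "pd x = (SOME u. c u x \<noteq> 0)"

lemma pd_eq: "c u x \<noteq> 0 \<Longrightarrow> pd x = u"
  unfolding pd_def by (rule some_equality) (auto intro: c_inj)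

primrec propagate :: "'a mat \<Rightarrow> nat \<Rightarrow> 'a mat \<Rightarrow> 'a mat" where
  "propagate g0 0 X = g0"
| "propagate g0 (Suc i) X = mat n n (\<lambda>(x, z). if c (pd x) x \<noteq> 0
     then (\<Sum>l<n. propagate g0 i X $$ (pd x, l) * X $$ (l, z)) / c (pd x) x else g0 $$ (x, z))"

lemma propagate_carrier: "g0 \<in> carrier_mat n n \<Longrightarrow> propagate g0 i X \<in> carrier_mat n n"
  by (cases i) auto

lemma propagate_poly:
  assumes "x < n" "z < n"
  shows "(\<lambda>X. propagate g0 i X $$ (x, z)) \<in> poly_funs UNIV n"
  using assms
proof (induction i arbitrary: x z)
  case 0
  then show ?case by (simp add: poly_funs.const)
next
  case (Suc i)
  show ?case
  proof (cases "c (pd x) x = 0")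
    case True
    then show ?thesis using Suc.prems by (simp add: poly_funs.const)
  next
    case False
    have "(\<lambda>X. inverse (c (pd x) x) * (\<Sum>l<n. propagate g0 i X $$ (pd x, l) * X $$ (l, z))) \<in> poly_funs UNIV n"
      using Suc c_less[OF False]
      by (intro poly_funs.mult poly_funs.const poly_funs_sum poly_funs.entry) auto
    then show ?thesis using False Suc.prems by (simp add: divide_inverse mult.commute)
  qed
qed

lemma propagate_fixed:
  assumes g0: "g0 \<in> carrier_mat n n" and X: "X \<in> carrier_mat n n" and eq: "g0 * X = G * g0"
  shows "propagate g0 i X = g0"
proof (induction i)
  case (Suc i)
  show ?case
  proof (rule eq_matI)
    fix x z assume "x < dim_row g0" "z < dim_col g0"
    then have xz: "x < n" "z < n" using g0 by auto
    show "propagate g0 (Suc i) X $$ (x, z) = g0 $$ (x, z)"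
    proof (cases "c (pd x) x = 0")
      case False
      let ?u = "pd x"
      have "(\<Sum>l<n. g0 $$ (?u, l) * X $$ (l, z)) = (g0 * X) $$ (?u, z)"
        using mult_mat_index[OF g0 X] c_less[OF False] xz by simp
      also have "\<dots> = c ?u x * g0 $$ (x, z)"
        unfolding eq using G_mult_entry(1)[OF g0 _ xz(2), of ?u] c_less[OF False] c_less_M[OF False]
          nx_eq[OF False] by simp
      finally show ?thesis using xz False by (simp add: Suc.IH)
    qed (use xz in simp)
  qed (use g0 in auto)
qed simp

text \<open>This settles the rows at level \<open>M\<close>, on which the chains impose no
  recursion: such a row of the propagated matrix is supported on level \<open>M\<close>, where the
  rows of \<open>X\<close> vanish.\<close>

lemma propagate_block_upper:
  assumes g0: "block_upper g0" and X: "X \<in> \<u>"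
  shows "block_upper (propagate g0 i X)"
proof (induction i)
  case (Suc i)
  have "propagate g0 (Suc i) X $$ (x, z) = 0" if xz: "x < n" "z < n" "L z < L x" for x z
  proof (cases "c (pd x) x = 0")
    case True
    then show ?thesis using xz g0 by (simp add: block_upper_def)
  next
    case False
    have "propagate g0 i X $$ (pd x, l) * X $$ (l, z) = 0" if l: "l < n" for l
    proof (cases "L l < L (pd x)")
      case True
      then show ?thesis using Suc c_less[OF False] l by (simp add: block_upper_def)
    next
      case False
      then have "\<not> L l < L z" using xz c_level[OF \<open>c (pd x) x \<noteq> 0\<close>] by simp
      then show ?thesis using uD(2)[OF X l xz(2)] by simp
    qed
    then have "(\<Sum>l<n. propagate g0 i X $$ (pd x, l) * X $$ (l, z)) = 0" by (intro sum.neutral) auto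
    then show ?thesis using xz False by simp
  qed
  moreover have "propagate g0 (Suc i) X \<in> carrier_mat n n" by simp
  ultimately show ?case unfolding block_upper_def by blast
qed (simp add: g0)

text \<open>A row is computed from the row of its predecessor, one level lower, so a row of level
  \<open>L x\<close> is final after \<open>L x\<close> rounds.\<close>

lemma propagate_stable:
  "x < n \<Longrightarrow> z < n \<Longrightarrow> L x \<le> i \<Longrightarrow> propagate g0 (Suc i) X $$ (x, z) = propagate g0 i X $$ (x, z)"
proof (induction i arbitrary: x z)
  case 0
  then have "c (pd x) x = 0" using c_level[of "pd x" x] by auto
  then show ?case using 0 by simp
next
  case (Suc i)
  show ?case
  proof (cases "c (pd x) x = 0")
    case True
    then show ?thesis using Suc.prems by simp
  next
    case False
    have "propagate g0 (Suc i) X $$ (pd x, l) = propagate g0 i X $$ (pd x, l)" if "l < n" for l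
      using that Suc.prems c_less[OF False] c_level[OF False] by (intro Suc.IH) auto
    then have "(\<Sum>l<n. propagate g0 (Suc i) X $$ (pd x, l) * X $$ (l, z)) =
        (\<Sum>l<n. propagate g0 i X $$ (pd x, l) * X $$ (l, z))" by (intro sum.cong) auto
    then show ?thesis
      unfolding propagate.simps(2)[of g0 "Suc i"] propagate.simps(2)[of g0 i]
      using Suc.prems by (simp del: propagate.simps(2))
  qed
qed

lemma propagate_intertwines:
  assumes g0: "block_upper g0" and X: "X \<in> \<u>"
  shows "propagate g0 M X * X = G * propagate g0 M X" (is "?h * X = G * ?h")
proof -
  have h: "?h \<in> carrier_mat n n" using propagate_carrier g0 by (simp add: block_upper_def)
  note cX = uD(1)[OF X]
  show ?thesis
  proof (rule eq_matI)
    fix u z assume "u < dim_row (G * ?h)" "z < dim_col (G * ?h)"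
    then have uz: "u < n" "z < n" using h by (auto simp: G_def)
    have e: "(?h * X) $$ (u, z) = (\<Sum>l<n. ?h $$ (u, l) * X $$ (l, z))"
      by (rule mult_mat_index[OF h cX uz])
    show "(?h * X) $$ (u, z) = (G * ?h) $$ (u, z)"
    proof (cases "L u < M")
      case True
      let ?x = "nx u"
      have x: "?x < n" "c u ?x \<noteq> 0" using nx_less nx uz True by auto
      have "?h $$ (?x, z) = propagate g0 (Suc M) X $$ (?x, z)"
        using propagate_stable[OF x(1) uz(2) L_le[OF x(1)]] by simp
      also have "\<dots> = (\<Sum>l<n. ?h $$ (u, l) * X $$ (l, z)) / c u ?x"
        using x uz pd_eq[OF x(2)] by simp
      finally show ?thesis unfolding e G_mult_entry(1)[OF h uz True] using x(2) by simp
    next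
      case False
      then have LM: "L u = M" using L_le[OF uz(1)] by simp
      have "?h $$ (u, l) * X $$ (l, z) = 0" if l: "l < n" for l
      proof (cases "L l < M")
        case True
        then show ?thesis using propagate_block_upper[OF g0 X, of M] uz l LM by (simp add: block_upper_def)
      next
        case False
        then have "\<not> L l < L z" using L_le[OF uz(2)] by simp
        then show ?thesis using uD(2)[OF X l uz(2)] by simp
      qed
      then show ?thesis unfolding e G_mult_entry(2)[OF h uz LM] by (intro sum.neutral) auto
    qed
  qed (use h cX in \<open>auto simp: G_def\<close>)
qed

text \<open>The determinant of the propagated matrix is the required polynomial: it equals
  \<open>det g0\<close> at \<open>X0\<close>, and where it is nonzero that matrix conjugates
  \<open>X\<close> to \<open>G\<close>.\<close>

lemma orbit_open:
  assumes g0: "block_upper g0" "det g0 \<noteq> 0" and X0: "X0 \<in> \<u>" "g0 * X0 = G * g0"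
  obtains q where "q \<in> poly_funs UNIV n" "q X0 \<noteq> 0" "\<And>X. X \<in> \<u> \<Longrightarrow> q X \<noteq> 0 \<Longrightarrow> similar_mat X G"
proof -
  have c0: "g0 \<in> carrier_mat n n" using g0 by (simp add: block_upper_def)
  have h: "propagate g0 M X \<in> carrier_mat n n" for X by (rule propagate_carrier[OF c0])
  let ?q = "\<lambda>X. det (propagate g0 M X)"
  show thesis
  proof (rule that[of ?q])
    have "(\<lambda>X. \<Sum>p\<in>{p. p permutes {0..<n}}. signof p * (\<Prod>i = 0..<n. propagate g0 M X $$ (i, p i))) \<in> poly_funs UNIV n"
      by (intro poly_funs_sum poly_funs.mult poly_funs.const poly_funs_prod propagate_poly UNIV_I)
        (auto dest: permutes_in_image)
    then show "?q \<in> poly_funs UNIV n" by (simp only: det_def'[OF h])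
    show "?q X0 \<noteq> 0" using propagate_fixed[OF c0 uD(1)[OF X0(1)] X0(2)] g0 by simp
  next
    fix X assume X: "X \<in> \<u>" and q: "?q X \<noteq> 0"
    let ?h = "propagate g0 M X"
    have "?h \<in> Units (ring_mat TYPE('a) n ())" by (rule det_non_zero_imp_unit[OF h q])
    then obtain B where B: "B \<in> carrier_mat n n" "B * ?h = 1\<^sub>m n" "?h * B = 1\<^sub>m n"
      by (auto simp: Units_def ring_mat_def)
    have cG: "G \<in> carrier_mat n n" by (simp add: G_def)
    have "B * (?h * X) = B * (G * ?h)" using propagate_intertwines[OF g0(1) X] by simp
    then have "X = B * G * ?h"
      unfolding assoc_mult_mat[OF B(1) h uD(1)[OF X], symmetric] assoc_mult_mat[OF B(1) cG h, symmetric] B(2)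
      using uD(1)[OF X] by simp
    moreover have "{X, G, B, ?h} \<subseteq> carrier_mat n n" using B(1) h cG uD(1)[OF X] by blast
    ultimately show "similar_mat X G" using B(2,3) by (intro similar_matI[of _ _ B ?h n])
  qed
qed

lemma richardson_orbit_G:
  "richardson_orbit n (pattern_group n (level_pattern n L)) {Y. similar_mat Y G}"
  unfolding richardson_orbit_def Lie_pattern_group[OF root_pattern_level]
proof (intro conjI allI impI)
  have cG: "G \<in> carrier_mat n n" by (simp add: G_def)
  have "nilpotent_mat n G"
    using pattern_nilpotent[OF root_pattern_level G_in_u] cG by (auto simp: nilpotent_mat_def)
  then show "\<exists>X. nilpotent_mat n X \<and> {Y. similar_mat Y G} = {Y. similar_mat Y X}" by blast
next
  \<comment> \<open>All polynomials whose nonvanishing forces similarity to \<open>G\<close>. Their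
    common zeros form the complement of the orbit, since near any orbit point
    \<open>orbit_open\<close> supplies a member of \<open>S\<close>.\<close>
  define S where "S = {f \<in> poly_funs UNIV n. \<forall>X\<in>\<u>. f X \<noteq> 0 \<longrightarrow> similar_mat X G}"
  define Z where "Z = {A \<in> carrier_mat n n. \<forall>f\<in>S. f A = 0}"
  have "zariski_closed n Z"
    unfolding zariski_closed_def by (rule exI[of _ S]) (auto simp: S_def Z_def)
  moreover have "{Y. similar_mat Y G} \<inter> \<u> = \<u> - Z"
  proof (intro equalityI subsetI)
    fix X assume "X \<in> \<u> - Z"
    then have X: "X \<in> \<u>" "X \<notin> Z" by auto
    then obtain f where "f \<in> S" "f X \<noteq> 0" using uD(1)[OF X(1)] by (auto simp: Z_def)
    then show "X \<in> {Y. similar_mat Y G} \<inter> \<u>" using X(1) by (simp add: S_def)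
  next
    fix X assume "X \<in> {Y. similar_mat Y G} \<inter> \<u>"
    then have X: "X \<in> \<u>" and sim: "similar_mat X G" by auto
    obtain P Q where PQ: "P \<in> carrier_mat n n" "Q \<in> carrier_mat n n" "P * Q = 1\<^sub>m n" "Q * P = 1\<^sub>m n"
      "X = P * G * Q"
      using similar_matD[OF sim] uD(1)[OF X] by auto
    have cG: "G \<in> carrier_mat n n" by (simp add: G_def)
    have "X * P = P * G * (Q * P)"
      unfolding PQ(5) using PQ(1,2) cG by (intro assoc_mult_mat[of _ n n _ n _ n]) auto
    then have "X * P = P * G" using PQ(1,4) cG by (simp add: mult_carrier_mat[of _ n n _ n])
    then have "block_upper P" by (rule intertwiner_block_upper[OF X PQ(1)])
    then have Qu: "block_upper Q" by (rule block_upper_inverse[OF _ PQ(2,3)])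
    have "Q * X = Q * P * G * Q"
      unfolding PQ(5) using PQ(1,2) cG by (simp add: assoc_mult_mat[of _ n n _ n _ n] mult_carrier_mat[of _ n n _ n])
    then have QX: "Q * X = G * Q" using PQ(4) cG by simp
    have "det Q * det P = 1" using det_mult[OF PQ(2,1)] PQ(4) by simp
    then have "det Q \<noteq> 0" by auto
    then obtain q where "q \<in> poly_funs UNIV n" "q X \<noteq> 0"
      "\<And>X. X \<in> \<u> \<Longrightarrow> q X \<noteq> 0 \<Longrightarrow> similar_mat X G"
      using orbit_open[OF Qu _ X QX] by blast
    then have "q \<in> S" "q X \<noteq> 0" by (auto simp: S_def)
    then show "X \<in> \<u> - Z" using X by (auto simp: Z_def)
  qed
  ultimately show "\<exists>Z. zariski_closed n Z \<and> {Y. similar_mat Y G} \<inter> \<u> = \<u> - Z" by blast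
next
  fix Z :: "'a mat set"
  assume "zariski_closed n Z \<and> {Y. similar_mat Y G} \<inter> \<u> \<subseteq> Z"
  then obtain T where T: "T \<subseteq> poly_funs UNIV n" "Z = {A \<in> carrier_mat n n. \<forall>f\<in>T. f A = 0}"
    and sub: "{Y. similar_mat Y G} \<inter> \<u> \<subseteq> Z" by (auto simp: zariski_closed_def)
  have one: "block_upper (1\<^sub>m n)" "det (1\<^sub>m n :: 'a mat) \<noteq> 0" "1\<^sub>m n * G = G * 1\<^sub>m n"
    by (auto simp: block_upper_def G_def)
  obtain q where q: "q \<in> poly_funs UNIV n" "q G \<noteq> 0" "\<And>X. X \<in> \<u> \<Longrightarrow> q X \<noteq> 0 \<Longrightarrow> similar_mat X G"
    using orbit_open[OF one(1,2) G_in_u one(3)] by blast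
  show "\<u> \<subseteq> Z"
  proof
    fix X assume X: "X \<in> \<u>"
    note cX = uD(1)[OF X]
    have cG: "G \<in> carrier_mat n n" by (simp add: G_def)
    have "f X = 0" if f: "f \<in> T" for f
    proof -
      \<comment> \<open>Irreducibility of the Lie algebra, tested on the line through
        \<open>G\<close> and \<open>X\<close>: the product of \<open>f\<close> and \<open>q\<close>
        vanishes on the line and \<open>q\<close> does not vanish at \<open>G\<close>, so
        \<open>f\<close> is zero along it.\<close>
      let ?l = "\<lambda>t. G + t \<cdot>\<^sub>m (X - G)"
      have XG: "X - G \<in> carrier_mat n n" using cX cG by auto
      have line: "?l t \<in> \<u>" for t
        using X G_in_u by (auto simp: pattern_algebra_def)
      obtain pf where pf: "\<And>t. poly pf t = f (?l t)"
        using poly_funs_line[OF _ cG XG] f T(1) by blast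
      obtain pq where pq: "\<And>t. poly pq t = q (?l t)"
        using poly_funs_line[OF q(1) cG XG] by blast
      have "poly (pf * pq) t = 0" for t
      proof (cases "q (?l t) = 0")
        case False
        then have "?l t \<in> Z" using q(3)[OF line] line sub by blast
        then show ?thesis using f T(2) by (simp add: pf)
      qed (simp add: pq)
      then have "pf * pq = 0" unfolding poly_all_0_iff_0[symmetric] by blast
      moreover have "?l 0 = G" using cX cG by (intro eq_matI) auto
      then have "pq \<noteq> 0" using pq[of 0] q(2) by auto
      ultimately have "pf = 0" by simp
      moreover have "?l 1 = X" using cX cG by (intro eq_matI) auto
      ultimately show "f X = 0" using pf[of 1] by simp
    qed
    then show "X \<in> Z" using T(2) cX by simp
  qed
qed

end

section \<open>Block levels and the path\<close>

text \<open>The empty partial sum is counted too, so the levels of indices below \<open>n\<close>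
  run from 1 to \<open>length ns\<close>.\<close>

definition block_level :: "nat list \<Rightarrow> nat \<Rightarrow> nat" where
  "block_level ns i = card {p. p \<le> length ns \<and> sum_list (take p ns) \<le> i}"

lemma earlier_block_iff: "earlier_block ns i j \<longleftrightarrow> block_level ns i < block_level ns j"
proof
  assume "earlier_block ns i j"
  then obtain p where p: "p \<le> length ns" "i < sum_list (take p ns)" "sum_list (take p ns) \<le> j"
    by (auto simp: earlier_block_def)
  show "block_level ns i < block_level ns j"
    unfolding block_level_def
  proof (rule psubset_card_mono)
    have "p \<in> {p. p \<le> length ns \<and> sum_list (take p ns) \<le> j}"
      "p \<notin> {p. p \<le> length ns \<and> sum_list (take p ns) \<le> i}" using p by auto
    moreover have "i \<le> j" using p by simp
    ultimately show "{p. p \<le> length ns \<and> sum_list (take p ns) \<le> i} \<subset> {p. p \<le> length ns \<and> sum_list (take p ns) \<le> j}"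
      by (intro psubsetI) (auto intro: le_trans)
  qed simp
next
  assume *: "block_level ns i < block_level ns j"
  show "earlier_block ns i j"
  proof (rule ccontr)
    assume "\<not> earlier_block ns i j"
    then have "{p. p \<le> length ns \<and> sum_list (take p ns) \<le> j} \<subseteq> {p. p \<le> length ns \<and> sum_list (take p ns) \<le> i}"
      by (force simp: earlier_block_def not_less)
    then have "block_level ns j \<le> block_level ns i"
      unfolding block_level_def by (intro card_mono) auto
    then show False using * by simp
  qed
qed

lemma unip_radical_eq: "unip_radical n ns = pattern_group n (level_pattern n (block_level ns))"
  by (auto simp: unip_radical_def pattern_group_def level_pattern_def earlier_block_iff)

lemma block_level_le:
  assumes "composition n ns" "i < n"
  shows "block_level ns i \<le> length ns"
proof -
  have "{p. p \<le> length ns \<and> sum_list (take p ns) \<le> i} \<subseteq> {..<length ns}"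
    using assms by (auto simp: composition_def le_less)
  then have "block_level ns i \<le> card {..<length ns}"
    unfolding block_level_def by (intro card_mono) auto
  then show ?thesis by simp
qed

lemma sum_list_take_mono: "p \<le> p' \<Longrightarrow> sum_list (take p ns) \<le> sum_list (take p' (ns :: nat list))"
proof -
  assume "p \<le> p'"
  then obtain d where "p' = p + d" using le_Suc_ex by blast
  then show ?thesis by (simp add: take_add)
qed

lemma block_level_last:
  assumes ns: "composition n ns" "ns \<noteq> []" and i: "n - last ns \<le> i" "i < n"
  shows "block_level ns i = length ns"
proof -
  have "sum_list ns = sum_list (butlast ns) + last ns"
    using ns(2) by (metis append_butlast_last_id sum_list_append sum_list.Cons sum_list.Nil add_0_right)
  moreover have "sum_list ns = n" using ns by (simp add: composition_def)
  ultimately have b: "sum_list (butlast ns) \<le> i" using i by linarith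
  have "sum_list (take p ns) \<le> i" if "p < length ns" for p
  proof -
    have "p \<le> length ns - 1" using that by simp
    from sum_list_take_mono[OF this, of ns] show ?thesis using b by (simp add: butlast_conv_take)
  qed
  then have "{p. p \<le> length ns \<and> sum_list (take p ns) \<le> i} = {..<length ns}"
    using ns i by (auto simp: composition_def le_less)
  then show ?thesis by (simp add: block_level_def)
qed

text \<open>Two block boundaries separate \<open>i\<close> from \<open>j\<close>, and since blocks
  are nonempty the first index after the earlier boundary lies strictly between. This rules out
  edges that skip a block.\<close>

lemma block_level_between:
  assumes ns: "composition n ns" and j: "j < n" and lt: "Suc (block_level ns i) < block_level ns j"
  shows "\<exists>l<n. block_level ns i < block_level ns l \<and> block_level ns l < block_level ns j"
proof -
  let ?S = "\<lambda>p. sum_list (take p ns)"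
  let ?A = "\<lambda>i. {p. p \<le> length ns \<and> ?S p \<le> i}"
  have fin: "finite (?A i)" for i by simp
  have "card (?A j) \<le> card (?A j - ?A i) + card (?A i)"
    using card_Un_le[of "?A j - ?A i" "?A i"] card_mono[of "(?A j - ?A i) \<union> ?A i" "?A j"] by auto
  then have "2 \<le> card (?A j - ?A i)" using lt by (simp add: block_level_def)
  then obtain p p' where pp: "p \<in> ?A j - ?A i" "p' \<in> ?A j - ?A i" "p < p'"
  proof -
    have "\<not> card (?A j - ?A i) \<le> Suc 0" using \<open>2 \<le> card (?A j - ?A i)\<close> by simp
    then obtain x y where "x \<in> ?A j - ?A i" "y \<in> ?A j - ?A i" "x \<noteq> y"
      unfolding card_le_Suc0_iff_eq[OF finite_Diff[OF fin]] by blast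
    then show thesis using that[of x y] that[of y x] by (metis nat_neq_iff)
  qed
  have S: "?S p < ?S p'"
  proof -
    have "?S (Suc p) = ?S p + ns ! p" "0 < ns ! p"
      using pp ns by (auto simp: take_Suc_conv_app_nth composition_def)
    then show ?thesis using sum_list_take_mono[of "Suc p" p' ns] pp(3) by simp
  qed
  have "earlier_block ns i (?S p)"
    unfolding earlier_block_def by (rule exI[of _ p]) (use pp in auto)
  moreover have "earlier_block ns (?S p) j"
    unfolding earlier_block_def by (rule exI[of _ p']) (use pp S in auto)
  moreover have "?S p < n" using pp(1) j by simp
  ultimately show ?thesis unfolding earlier_block_iff by blast
qed

lemma mono_level_less_iff:
  assumes "\<And>i j. i \<le> j \<Longrightarrow> j < n \<Longrightarrow> L i \<le> (L j :: nat)" "i < n"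
  shows "i < card {v. v < n \<and> L v < t} \<longleftrightarrow> L i < t"
proof
  assume "L i < t"
  then have "{..i} \<subseteq> {v. v < n \<and> L v < t}" using assms by (auto intro: le_less_trans)
  then have "card {..i} \<le> card {v. v < n \<and> L v < t}" by (intro card_mono) auto
  then show "i < card {v. v < n \<and> L v < t}" by simp
next
  assume *: "i < card {v. v < n \<and> L v < t}"
  show "L i < t"
  proof (rule ccontr)
    assume nt: "\<not> L i < t"
    have "v < i" if "v < n" "L v < t" for v
      using assms(1)[of i v] that nt by linarith
    then have "{v. v < n \<and> L v < t} \<subseteq> {..<i}" by blast
    then have "card {v. v < n \<and> L v < t} \<le> card {..<i}" by (intro card_mono) auto
    then show False using * by simp
  qed
qed

text \<open>The block sizes are the numbers of vertices on the levels from \<open>L 0\<close> to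
  \<open>M\<close>. The hypothesis \<open>step\<close> both sorts them and excludes empty
  levels.\<close>

lemma level_composition:
  assumes mono: "\<And>i j. i \<le> j \<Longrightarrow> j < n \<Longrightarrow> L i \<le> L j" and n: "n \<ge> 1"
    and LM: "\<And>i. i < n \<Longrightarrow> L i \<le> M"
    and step: "\<And>t. t < M \<Longrightarrow> card {v. v < n \<and> L v = t} \<le> card {v. v < n \<and> L v = Suc t}"
  obtains ns where "composition n ns" "sorted ns" "unip_radical n ns = pattern_group n (level_pattern n L)"
proof
  define cnt where "cnt t = card {v. v < n \<and> L v = t}" for t
  define ns where "ns = map cnt [L 0..<Suc M]"
  have L0: "L 0 \<le> M" "\<And>v. v < n \<Longrightarrow> L 0 \<le> L v" using LM[of 0] mono[of 0] n by auto
  have len: "length ns = Suc M - L 0" by (simp add: ns_def del: upt_Suc)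
  have S: "sum_list (take p ns) = card {v. v < n \<and> L v < L 0 + p}" if "p \<le> length ns" for p
    using that
  proof (induction p)
    case 0
    have "{v. v < n \<and> L v < L 0} = {}" using L0(2) not_less by blast
    then show ?case by simp
  next
    case (Suc p)
    have "{v. v < n \<and> L v < L 0 + Suc p} = {v. v < n \<and> L v < L 0 + p} \<union> {v. v < n \<and> L v = L 0 + p}" by auto
    then have "card {v. v < n \<and> L v < L 0 + Suc p} = card {v. v < n \<and> L v < L 0 + p} + cnt (L 0 + p)"
      unfolding cnt_def by (simp add: card_Un_disjoint disjoint_iff)
    moreover have "ns ! p = cnt (L 0 + p)" using Suc.prems len by (simp add: ns_def del: upt_Suc)
    ultimately show ?case using Suc by (simp add: take_Suc_conv_app_nth)
  qed
  have pos: "0 < cnt t" if "L 0 \<le> t" "t \<le> M" for t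
    using that
  proof (induction t rule: dec_induct)
    case base
    have "0 \<in> {v. v < n \<and> L v = L 0}" using n by simp
    then show ?case unfolding cnt_def by (subst card_gt_0_iff) auto
  next
    case (step t)
    then show ?case using assms(4)[of t] by (simp add: cnt_def)
  qed
  have "{v. v < n \<and> L v < L 0 + length ns} = {..<n}" using LM L0 len by (auto simp: less_Suc_eq_le)
  then have "sum_list ns = n" using S[of "length ns"] by simp
  then show "composition n ns" using pos by (auto simp: composition_def ns_def less_Suc_eq_le)
  show "sorted ns"
    unfolding sorted_iff_nth_Suc using step by (auto simp: ns_def cnt_def simp del: upt_Suc)
  have "earlier_block ns i j \<longleftrightarrow> L i < L j" if ij: "i < n" "j < n" for i j
  proof
    assume "earlier_block ns i j"
    then obtain p where p: "p \<le> length ns" "i < sum_list (take p ns)" "\<not> j < sum_list (take p ns)"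
      by (auto simp: earlier_block_def)
    have "L i < L 0 + p" "\<not> L j < L 0 + p"
      using mono_level_less_iff[OF mono ij(1), where t = "L 0 + p"]
        mono_level_less_iff[OF mono ij(2), where t = "L 0 + p"] p(2,3) S[OF p(1)] by simp_all
    then show "L i < L j" by linarith
  next
    assume lt: "L i < L j"
    let ?p = "L j - L 0"
    have p: "?p \<le> length ns" using LM[OF ij(2)] len by simp
    have "L 0 + ?p = L j" using L0(2)[OF ij(2)] by simp
    then have "i < sum_list (take ?p ns)" "\<not> j < sum_list (take ?p ns)"
      using mono_level_less_iff[OF mono ij(1), where t = "L j"] mono_level_less_iff[OF mono ij(2), where t = "L j"] S[OF p] lt
      by simp_all
    then show "earlier_block ns i j" using p unfolding earlier_block_def by (intro exI[of _ ?p]) simp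
  qed
  then show "unip_radical n ns = pattern_group n (level_pattern n L)"
    unfolding unip_radical_def pattern_group_def level_pattern_def by auto
qed

section \<open>Right-justified levels and the interpolation between level functions\<close>

primrec depth_upto :: "(nat \<Rightarrow> nat \<Rightarrow> 'a::zero) \<Rightarrow> nat \<Rightarrow> nat \<Rightarrow> nat" where
  "depth_upto c 0 v = 0"
| "depth_upto c (Suc m) v = (if \<exists>w. c v w \<noteq> 0 then Suc (depth_upto c m (SOME w. c v w \<noteq> 0)) else 0)"

lemma right_justified_level:
  fixes b :: "nat \<Rightarrow> nat" and c :: "nat \<Rightarrow> nat \<Rightarrow> 'a::zero"
  assumes c_less: "\<And>i j. c i j \<noteq> 0 \<Longrightarrow> i < n \<and> j < n" and c_level: "\<And>i j. c i j \<noteq> 0 \<Longrightarrow> b j = Suc (b i)"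
    and c_fun: "\<And>i j j'. c i j \<noteq> 0 \<Longrightarrow> c i j' \<noteq> 0 \<Longrightarrow> j = j'" and b: "\<And>i. i < n \<Longrightarrow> b i \<le> M"
  obtains a where "\<And>i j. c i j \<noteq> 0 \<Longrightarrow> a j = Suc (a i)" "\<And>v. v < n \<Longrightarrow> b v \<le> a v" "\<And>v. a v \<le> M"
    "\<And>v. (\<And>w. c v w = 0) \<Longrightarrow> a v = M"
proof
  have le: "depth_upto c m v \<le> m" for m v by (induction m arbitrary: v) auto
  have 0: "depth_upto c m v = 0" if "\<And>w. c v w = 0" for m v using that by (cases m) auto
  \<comment> \<open>The depth counts the edges after \<open>v\<close>. The bound
    \<open>M - b v\<close> on the recursion suffices because each edge raises \<open>b\<close> by
    one, and it also yields \<open>b v \<le> a v\<close>.\<close>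
  define a where "a v = M - depth_upto c (M - b v) v" for v
  show "b v \<le> a v" if "v < n" for v using le[of "M - b v" v] b[OF that] by (simp add: a_def)
  show "a v \<le> M" for v by (simp add: a_def)
  show "a v = M" if "\<And>w. c v w = 0" for v using 0[OF that] by (simp add: a_def)
  show "a j = Suc (a i)" if ij: "c i j \<noteq> 0" for i j
  proof -
    have s: "(SOME w. c i w \<noteq> 0) = j" by (rule some_equality) (use ij c_fun in auto)
    have m: "M - b i = Suc (M - b j)" using c_level[OF ij] c_less[OF ij] b[of j] by simp
    have "depth_upto c (M - b i) i = Suc (depth_upto c (M - b j) j)" unfolding m using ij s by auto
    then show ?thesis using le[of "M - b i" i] by (simp add: a_def)
  qed
qed

lemma justified_path:
  fixes k :: "'a::field_char_0 set"
  assumes k: "is_subfield k" and ck: "\<And>i j. c i j \<in> k"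
    and c_less: "\<And>i j. c i j \<noteq> 0 \<Longrightarrow> i < n \<and> j < n"
    and c_b: "\<And>i j. c i j \<noteq> 0 \<Longrightarrow> b j = Suc (b i)" and c_a: "\<And>i j. c i j \<noteq> 0 \<Longrightarrow> a j = Suc (a i)"
    and c_fun: "\<And>i j j'. c i j \<noteq> 0 \<Longrightarrow> c i j' \<noteq> 0 \<Longrightarrow> j = j'"
    and c_inj: "\<And>i i' j. c i j \<noteq> 0 \<Longrightarrow> c i' j \<noteq> 0 \<Longrightarrow> i = i'"
    and ab: "\<And>v. v < n \<Longrightarrow> b v \<le> a v" and aM: "\<And>v. a v \<le> M"
    and ends: "\<And>v. (\<And>w. c v w = 0) \<Longrightarrow> a v = M"
    and H: "\<And>R. root_pattern n R \<Longrightarrow> (\<And>i j. (i, j) \<in> R \<Longrightarrow> i < r) \<Longrightarrow> pattern_group n R \<subseteq> H"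
    and last: "\<And>i. r \<le> i \<Longrightarrow> i < n \<Longrightarrow> b i = M"
  shows "(af_rel k n H)\<^sup>*\<^sup>* (lin_af n (level_pattern n a) c) (lin_af n (level_pattern n b) c)"
proof -
  \<comment> \<open>After \<open>q\<close> rounds each chain has moved left by \<open>q\<close>
    blocks, or by its total shift \<open>a v - b v\<close> if that is smaller; the total shift is
    constant along a chain.\<close>
  define l where "l q v = a v - min q (a v - b v)" for q v
  have l_last: "l q v = M" if "r \<le> v" "v < n" for q v
    using that last ab[of v] aM[of v] by (simp add: l_def)
  have lM: "l q v \<le> M" for q v using aM[of v] by (simp add: l_def)
  have *: "(af_rel k n H)\<^sup>*\<^sup>* (lin_af n (level_pattern n (l 0)) c) (lin_af n (level_pattern n (l q)) c)" for q
  proof (induction q)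
    case (Suc q)
    let ?S = "{v. q < a v - b v}"
    have "(af_rel k n H)\<^sup>*\<^sup>* (lin_af n (level_pattern n (l q)) c) (lin_af n (level_pattern n (l (Suc q))) c)"
    proof (rule level_shift_path[where S = ?S, OF k ck c_less])
      show "l q j = Suc (l q i)" if "c i j \<noteq> 0" for i j
        using c_a[OF that] c_b[OF that] by (simp add: l_def min_def Suc_diff_le)
      show "(i \<in> ?S) = (j \<in> ?S)" if "c i j \<noteq> 0" for i j
        using c_a[OF that] c_b[OF that] by simp
      show "l q v = Suc (l (Suc q) v)" if "v \<in> ?S" for v
        using that by (simp add: l_def min_def)
      show "l (Suc q) v = l q v" if "v \<notin> ?S" for v
        using that by (simp add: l_def min_def)
      \<comment> \<open>A stopped vertex without successor has \<open>a p = M\<close> and has moved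
        at most \<open>q\<close> blocks, while \<open>v\<close> has moved exactly \<open>q\<close>
        blocks. Hence \<open>v\<close> cannot lie one level above \<open>p\<close>.\<close>
      show "\<exists>p'. c p p' \<noteq> 0" if "p < n" "v < n" "p \<notin> ?S" "v \<in> ?S" "l q v = Suc (l q p)" for p v
      proof (rule ccontr)
        assume "\<nexists>p'. c p p' \<noteq> 0"
        then have "a p = M" by (intro ends) auto
        then have "l q p \<ge> M - q" using that(3) by (simp add: l_def)
        moreover have "l q v \<le> M - q" using that(4) aM[of v] by (simp add: l_def)
        ultimately show False using that(5) by simp
      qed
      show "pattern_group n R \<subseteq> H"
        if R: "root_pattern n R" "R \<subseteq> level_pattern n (l q) \<union> level_pattern n (l (Suc q))" for R
      proof (rule H[OF R(1)])
        fix i j assume "(i, j) \<in> R"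
        then have "l q i < l q j \<or> l (Suc q) i < l (Suc q) j" "i < n"
          using R(2) by (auto simp: level_pattern_def)
        then show "i < r" using l_last[of i q] l_last[of i "Suc q"] lM[of q j] lM[of "Suc q" j]
          by (cases "r \<le> i") auto
      qed
    qed (use c_fun c_inj in blast)+
    then show ?case using Suc by (rule rtranclp_trans[rotated])
  qed simp
  have "l 0 = a" by (simp add: l_def fun_eq_iff)
  moreover have "l M v = b v" if "v < n" for v
  proof -
    have "min M (a v - b v) = a v - b v" using aM[of v] by (intro min_absorb2) simp
    then show ?thesis using ab[OF that] by (simp add: l_def)
  qed
  then have "level_pattern n (l M) = level_pattern n b" by (auto simp: level_pattern_def)
  ultimately show ?thesis using *[of M] by simp
qed

section \<open>Domains inside the group \<open>H\<close>\<close>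

lemma unip_radical_two_blocks:
  assumes "r + m = n"
  shows "A \<in> unip_radical n [r, m] \<longleftrightarrow> A \<in> carrier_mat n n \<and>
    (\<forall>i<n. \<forall>j<n. \<not> (i < r \<and> r \<le> j) \<longrightarrow> A $$ (i, j) = (if i = j then 1 else 0))"
proof -
  have "earlier_block [r, m] i j \<longleftrightarrow> i < r \<and> r \<le> j" if "i < n" "j < n" for i j
  proof
    assume "earlier_block [r, m] i j"
    then obtain p where p: "p \<le> 2" "i < sum_list (take p [r, m])" "sum_list (take p [r, m]) \<le> j"
      unfolding earlier_block_def by (metis One_nat_def Suc_1 length_Cons list.size(3))
    then consider "p = 0" | "p = 1" | "p = 2" by linarith
    then show "i < r \<and> r \<le> j" by cases (use p that assms in auto)
  next
    assume "i < r \<and> r \<le> j"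
    then show "earlier_block [r, m] i j" unfolding earlier_block_def by (intro exI[of _ 1]) simp
  qed
  then show ?thesis unfolding unip_radical_def by auto
qed

lemma corner_SL_I:
  assumes A: "A \<in> carrier_mat n n" and r: "r \<le> n" and det: "det (mat r r (\<lambda>(i, j). A $$ (i, j))) = 1"
    and off: "\<And>i j. i < n \<Longrightarrow> j < n \<Longrightarrow> r \<le> i \<or> r \<le> j \<Longrightarrow> A $$ (i, j) = (if i = j then 1 else 0)"
  shows "A \<in> corner_SL n r"
proof -
  let ?A = "mat r r (\<lambda>(i, j). A $$ (i, j))"
  have "A = four_block_mat ?A (0\<^sub>m r (n - r)) (0\<^sub>m (n - r) r) (1\<^sub>m (n - r))"
    using A r by (intro eq_matI) (auto simp: off)
  then show ?thesis unfolding corner_SL_def using det by auto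
qed

text \<open>The factorization is that of a parabolic: \<open>?B\<close> keeps the roots with column
  below \<open>r\<close> and lies in the corner, and the rest \<open>?C\<close> lies in the
  radical.\<close>

lemma pattern_group_in_H:
  fixes R :: "(nat \<times> nat) set"
  assumes R: "root_pattern n R" and rows: "\<And>i j. (i, j) \<in> R \<Longrightarrow> i < r" and r: "r + m = n"
  shows "(pattern_group n R :: 'a::field mat set) \<subseteq> corner_SL n r <#>\<^bsub>GL n\<^esub> unip_radical n [r, m]"
proof
  fix A :: "'a mat" assume A: "A \<in> pattern_group n R"
  define R1 where "R1 = {(i, j) \<in> R. j < r}"
  have R1: "root_pattern n R1"
    using R unfolding root_pattern_def R1_def trans_def irrefl_def by fast
  have R1R: "R1 \<subseteq> R" by (auto simp: R1_def)
  let ?B = "restrict_pattern n R1 A"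
  have B: "?B \<in> pattern_group n R1" by (rule restrict_pattern_in) simp
  note Bi = pattern_group_inv[OF R1 B]
  let ?I = "inv\<^bsub>GL n\<^esub> ?B"
  let ?C = "?I * A"
  have cc: "?B \<in> carrier_mat n n" "?I \<in> carrier_mat n n" "A \<in> carrier_mat n n"
    using B Bi(2) A by (auto dest: pattern_groupD)
  have AC: "A = ?B * ?C"
    unfolding assoc_mult_mat[OF cc, symmetric] Bi(3) using cc(3) by simp
  have C: "?C \<in> pattern_group n R"
    using pattern_group_mult[OF R _ A] Bi(2) pattern_group_mono[OF R1R] by blast
  \<comment> \<open>\<open>A\<close> and \<open>?B\<close> agree in the columns below
    \<open>r\<close>, so multiplying by the inverse of \<open>?B\<close> makes these columns
    trivial.\<close>
  have "?C $$ (i, j) = (if i = j then 1 else 0)" if ij: "i < n" "j < n" "\<not> (i < r \<and> r \<le> j)" for i j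
  proof (cases "i < r")
    case False
    then show ?thesis using rows pattern_groupD(4)[OF C ij(1,2)] by blast
  next
    case True
    then have j: "j < r" using ij by simp
    have "?C $$ (i, j) = (\<Sum>l<n. ?I $$ (i, l) * A $$ (l, j))"
      by (rule mult_mat_index[OF cc(2,3) ij(1,2)])
    also have "\<dots> = (\<Sum>l<n. ?I $$ (i, l) * ?B $$ (l, j))"
    proof (intro sum.cong refl)
      fix l assume "l \<in> {..<n}"
      then have "A $$ (l, j) = ?B $$ (l, j)"
        using ij j pattern_groupD(4)[OF A, of l j] root_patternD(5)[OF R, of l j]
        by (auto simp: restrict_pattern_def R1_def)
      then show "?I $$ (i, l) * A $$ (l, j) = ?I $$ (i, l) * ?B $$ (l, j)" by simp
    qed
    also have "\<dots> = (?I * ?B) $$ (i, j)" using mult_mat_index[OF cc(2,1) ij(1,2)] by simp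
    finally show ?thesis unfolding Bi(4) using ij by simp
  qed
  then have "?C \<in> unip_radical n [r, m]"
    using C by (simp add: unip_radical_two_blocks[OF r] pattern_groupD)
  moreover have "?B \<in> corner_SL n r"
  proof (rule corner_SL_I[OF cc(1)])
    show "r \<le> n" using r by simp
    show off: "?B $$ (i, j) = (if i = j then 1 else 0)" if "i < n" "j < n" "r \<le> i \<or> r \<le> j" for i j
    proof -
      have "(i, j) \<notin> R1" using that rows[of i j] by (auto simp: R1_def)
      then show ?thesis using pattern_groupD(4)[OF B that(1,2)] by simp
    qed
    let ?D = "mat r r (\<lambda>(i, j). ?B $$ (i, j))"
    have "?B = four_block_mat ?D (0\<^sub>m r (n - r)) (0\<^sub>m (n - r) r) (1\<^sub>m (n - r))"
      using cc(1) r by (intro eq_matI) (auto simp: off)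
    then have "det ?B = det ?D * det (1\<^sub>m (n - r) :: 'a mat)"
      using det_four_block_mat_upper_right_zero[of ?D r "0\<^sub>m r (n - r)" "n - r" "0\<^sub>m (n - r) r" "1\<^sub>m (n - r)"]
      by simp
    then show "det ?D = 1" using Bi(5) by simp
  qed
  ultimately show "A \<in> corner_SL n r <#>\<^bsub>GL n\<^esub> unip_radical n [r, m]"
    unfolding set_mult_def using AC by auto
qed

section \<open>Signed permutation matrices and sorting of the levels\<close>

definition monomial_mat :: "nat \<Rightarrow> (nat \<Rightarrow> nat) \<Rightarrow> (nat \<Rightarrow> 'a::field) \<Rightarrow> 'a mat" where
  "monomial_mat n \<pi> \<epsilon> = mat n n (\<lambda>(i, j). if j = \<pi> i then \<epsilon> i else 0)"

lemma monomial_mat_conj: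
  assumes \<pi>: "\<And>i. i < n \<Longrightarrow> \<pi> i < n" and u: "u \<in> carrier_mat n n" and ij: "i < n" "j < n"
  shows "(monomial_mat n \<pi> \<epsilon> * u * (monomial_mat n \<pi> \<epsilon>)\<^sup>T) $$ (i, j) = \<epsilon> i * \<epsilon> j * u $$ (\<pi> i, \<pi> j)"
proof -
  let ?g = "monomial_mat n \<pi> \<epsilon>"
  have g: "?g \<in> carrier_mat n n" by (simp add: monomial_mat_def)
  have 1: "(?g * u) $$ (i, l) = \<epsilon> i * u $$ (\<pi> i, l)" if "l < n" for l
  proof -
    have "(?g * u) $$ (i, l) = (\<Sum>h<n. ?g $$ (i, h) * u $$ (h, l))"
      by (rule mult_mat_index[OF g u ij(1) that])
    also have "\<dots> = (\<Sum>h<n. if h = \<pi> i then \<epsilon> i * u $$ (h, l) else 0)"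
      using ij by (intro sum.cong refl) (auto simp: monomial_mat_def)
    finally show ?thesis using \<pi>[OF ij(1)] by simp
  qed
  have "(?g * u * ?g\<^sup>T) $$ (i, j) = (\<Sum>l<n. (?g * u) $$ (i, l) * ?g\<^sup>T $$ (l, j))"
    using g u ij by (intro mult_mat_index[of _ n n _ n]) auto
  also have "\<dots> = (\<Sum>l<n. if l = \<pi> j then \<epsilon> i * \<epsilon> j * u $$ (\<pi> i, l) else 0)"
    using ij 1 g by (intro sum.cong refl) (auto simp: monomial_mat_def)
  finally show ?thesis using \<pi>[OF ij(2)] by simp
qed

lemma monomial_mat_orthogonal:
  assumes \<pi>: "\<And>i. i < n \<Longrightarrow> \<pi> i < n" "inj_on \<pi> {..<n}" and \<epsilon>: "\<And>i. \<epsilon> i * \<epsilon> i = 1"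
  shows "monomial_mat n \<pi> \<epsilon> * (monomial_mat n \<pi> \<epsilon>)\<^sup>T = 1\<^sub>m n"
    "(monomial_mat n \<pi> \<epsilon>)\<^sup>T * monomial_mat n \<pi> \<epsilon> = 1\<^sub>m n"
proof -
  let ?g = "monomial_mat n \<pi> \<epsilon>"
  have g: "?g \<in> carrier_mat n n" by (simp add: monomial_mat_def)
  have "?g * 1\<^sub>m n * ?g\<^sup>T = 1\<^sub>m n"
  proof (rule eq_matI)
    fix i j assume "i < dim_row (1\<^sub>m n :: 'a mat)" "j < dim_col (1\<^sub>m n :: 'a mat)"
    then have ij: "i < n" "j < n" by auto
    have "\<pi> i = \<pi> j \<longleftrightarrow> i = j" using \<pi>(2) ij by (auto dest: inj_onD)
    moreover have "(?g * 1\<^sub>m n * ?g\<^sup>T) $$ (i, j) = \<epsilon> i * \<epsilon> j * 1\<^sub>m n $$ (\<pi> i, \<pi> j)"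
      by (rule monomial_mat_conj[OF \<pi>(1) one_carrier_mat ij])
    ultimately show "(?g * 1\<^sub>m n * ?g\<^sup>T) $$ (i, j) = 1\<^sub>m n $$ (i, j)"
      using ij \<pi>(1) \<epsilon> by simp
  qed (use g in auto)
  then show 1: "?g * ?g\<^sup>T = 1\<^sub>m n" using g by simp
  show "?g\<^sup>T * ?g = 1\<^sub>m n" using mat_mult_left_right_inverse[OF g _ 1] g by simp
qed

text \<open>The sign of the permutation is absorbed into the first row.\<close>

lemma monomial_mat_det_one:
  assumes \<pi>: "\<And>i. i < r \<Longrightarrow> \<pi> i < r" "inj_on \<pi> {..<r}"
  obtains \<epsilon> :: "nat \<Rightarrow> 'a::field" where "\<And>i. \<epsilon> i = 1 \<or> \<epsilon> i = - 1" "\<And>i. r \<le> i \<Longrightarrow> \<epsilon> i = 1"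
    "det (monomial_mat r \<pi> \<epsilon>) = 1"
proof -
  let ?g = "monomial_mat r \<pi> (\<lambda>_. 1 :: 'a)"
  have g: "?g \<in> carrier_mat r r" by (simp add: monomial_mat_def)
  have "det ?g * det ?g\<^sup>T = 1"
    using monomial_mat_orthogonal(1)[OF \<pi>, of "\<lambda>_. 1 :: 'a"] det_mult[OF g, of "?g\<^sup>T"] g by simp
  then have "det ?g * det ?g = 1" using det_transpose[OF g] by simp
  then have "(det ?g - 1) * (det ?g + 1) = 0" by (simp add: algebra_simps)
  then consider "det ?g = 1" | "det ?g = - 1" by (auto simp: eq_neg_iff_add_eq_0)
  then show thesis
  proof cases
    case 1
    then show ?thesis by (intro that[of "\<lambda>_. 1"]) auto
  next
    case 2
    show ?thesis
    proof (cases "r = 0")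
      case True
      then have "det ?g = 1" using det_dim_zero g by blast
      then show ?thesis by (intro that[of "\<lambda>_. 1"]) auto
    next
      case False
      let ?\<epsilon> = "\<lambda>i. if i = 0 then - 1 else 1 :: 'a"
      have "monomial_mat r \<pi> ?\<epsilon> = multrow 0 (- 1) ?g"
        by (rule eq_matI) (auto simp: monomial_mat_def)
      then have "det (monomial_mat r \<pi> ?\<epsilon>) = 1" using det_multrow[OF _ g, of 0 "- 1"] 2 False by simp
      then show ?thesis using False by (intro that[of ?\<epsilon>]) auto
    qed
  qed
qed

lemma sorting_permutation:
  fixes a :: "nat \<Rightarrow> nat"
  obtains \<pi> where "\<pi> permutes {..<r}" "\<And>i j. i \<le> j \<Longrightarrow> j < r \<Longrightarrow> a (\<pi> i) \<le> a (\<pi> j)"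
proof -
  let ?xs = "map a [0..<r]"
  obtain \<pi> where \<pi>: "\<pi> permutes {..<length ?xs}" "permute_list \<pi> ?xs = sort ?xs"
    using mset_eq_permutation[of "sort ?xs" ?xs] by auto
  show thesis
  proof
    show p: "\<pi> permutes {..<r}" using \<pi>(1) by simp
    fix i j :: nat assume ij: "i \<le> j" "j < r"
    have nth: "sort ?xs ! h = a (\<pi> h)" if "h < r" for h
      using that permute_list_nth[OF \<pi>(1), of h] permutes_in_image[OF p, of h] \<pi>(2) by simp
    have "sort ?xs ! i \<le> sort ?xs ! j" using ij by (intro sorted_nth_mono) auto
    then show "a (\<pi> i) \<le> a (\<pi> j)" using nth ij by simp
  qed
qed

text \<open>On the product of the root elements at \<open>(i, l)\<close> and \<open>(l, j)\<close>
  the defect of additivity is exactly \<open>c i j\<close>.\<close>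

lemma AF_lin_af_isotropic:
  fixes c :: "nat \<Rightarrow> nat \<Rightarrow> 'a::field"
  assumes R: "root_pattern n R" and AF: "AF k n (lin_af n R c)" and c: "\<And>i. c i i = 0"
    and ij: "(i, l) \<in> R" "(l, j) \<in> R"
  shows "c i j = 0"
proof -
  let ?A = "root_elem n i l (1 :: 'a)" and ?B = "root_elem n l j (1 :: 'a)"
  have AB: "?A \<in> pattern_group n R" "?B \<in> pattern_group n R"
    using ij root_elem_in_pattern_group by blast+
  note b = root_patternD(1,2,5)[OF R ij(1)] root_patternD(2,5)[OF R ij(2)]
  have "the (lin_af n R c (?A * ?B)) = the (lin_af n R c ?A) + the (lin_af n R c ?B)"
    using AF AB unfolding AF_def dom_lin_af by blast
  then have "entry_form n c (?A * ?B) = entry_form n c ?A + entry_form n c ?B"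
    using AB pattern_group_mult[OF R AB] by (simp add: lin_af_def)
  then have s: "(\<Sum>x<n. \<Sum>y<n. c x y * (\<Sum>h<n. off R ?A x h * off R ?B h y)) = 0"
    using entry_form_mult[where c = c, OF R R AB c] by simp
  have t: "c x y * (off R ?A x h * off R ?B h y) = (if h = l then if y = j then if x = i then c i j else 0 else 0 else 0)"
    if "x < n" "y < n" "h < n" for x y h
  proof -
    have o: "off R (root_elem n p q (1 :: 'a)) u v = (if u = p \<and> v = q then 1 else 0)"
      if "(p, q) \<in> R" "u < n" "v < n" for p q u v
      using that root_patternD(5)[OF R, of u v] by (cases "(u, v) \<in> R") (auto simp: off_def root_elem_def)
    show ?thesis unfolding o[OF ij(1) that(1,3)] o[OF ij(2) that(3,2)] by simp
  qed
  have "(\<Sum>x<n. \<Sum>y<n. c x y * (\<Sum>h<n. off R ?A x h * off R ?B h y)) =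
      (\<Sum>x<n. \<Sum>y<n. \<Sum>h<n. (if h = l then if y = j then if x = i then c i j else 0 else 0 else 0))"
    unfolding sum_distrib_left by (intro sum.cong refl t) auto
  also have "\<dots> = c i j" using b by simp
  finally show ?thesis using s by simp
qed

lemma nontrivial_on_root_lin_af:
  assumes R: "root_pattern n R" and c: "\<And>i. c i i = 0" "\<And>i j. (i, j) \<notin> R \<Longrightarrow> c i j = 0"
  shows "nontrivial_on_root n (lin_af n R c) i j \<longleftrightarrow> c i j \<noteq> 0"
proof -
  have rs: "root_subgroup n i j = range (root_elem n i j :: 'a \<Rightarrow> _)"
    by (auto simp: root_subgroup_def root_elem_def)
  show ?thesis
  proof
    assume nt: "nontrivial_on_root n (lin_af n R c) i j"
    then have ij: "i < n" "j < n" "i \<noteq> j" "root_elem n i j (1 :: 'a) \<in> pattern_group n R"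
      unfolding nontrivial_on_root_def rs dom_lin_af by auto
    have "(i, j) \<in> R"
      using pattern_groupD(4)[OF ij(4,1,2)] ij by (auto simp: root_elem_def)
    then show "c i j \<noteq> 0" using nt lin_af_root_elem[where c = c, OF R _ c(1)]
      unfolding nontrivial_on_root_def rs by fastforce
  next
    assume nz: "c i j \<noteq> 0"
    then have ij: "(i, j) \<in> R" using c(2) by blast
    have "lin_af n R c (root_elem n i j 1) \<noteq> Some 0"
      using nz lin_af_root_elem[where c = c, OF R ij c(1)] by simp
    then show "nontrivial_on_root n (lin_af n R c) i j"
      using root_patternD(1,2,5)[OF R ij] root_elem_in_pattern_group[OF ij]
      unfolding nontrivial_on_root_def rs dom_lin_af by blast
  qed
qed

theorem theorem7p7:
  fixes k :: "'a::{alg_closed_field, field_char_0} set"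
    and n :: nat and ns :: "nat list" and F :: "'a af"
  assumes "is_subfield k" and "n \<ge> 1"
    and "F \<in> C_hat k n"
    and "composition n ns" and "dom F = unip_radical n ns"
  defines "r \<equiv> n - last ns"
  defines "H \<equiv> corner_SL n r <#>\<^bsub>GL n\<^esub> unip_radical n [r, last ns]"
  shows "\<exists>Fbar. Fbar \<in> cap_B n (C_hat_le k n) \<and> dom Fbar \<subseteq> H \<and>
           (\<exists>\<gamma>\<in>k_points k (corner_SL n r).
              J_of n Fbar = \<gamma> * J_of n F * inv\<^bsub>GL n\<^esub> \<gamma>) \<and>
           (\<exists>Fs. af_path k n H Fbar F Fs)"
proof -
  note k = assms(1) and n = assms(2) and ns = assms(4)
  let ?b = "block_level ns" and ?M = "length ns"
  let ?Rb = "level_pattern n ?b"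
  have ns0: "ns \<noteq> []" using ns n by (auto simp: composition_def)
  have r: "r + last ns = n" "r \<le> n"
    using ns ns0 member_le_sum_list[of "last ns" ns] by (auto simp: r_def composition_def)
  have AF_F: "AF k n F" and hat: "\<And>i j i' j'. nontrivial_on_root n F i j \<Longrightarrow>
      nontrivial_on_root n F i' j' \<Longrightarrow> (i, j) \<noteq> (i', j') \<Longrightarrow> i \<noteq> i' \<and> j \<noteq> j'"
    using assms(3) unfolding C_hat_def C_class_def by blast+
  obtain c where F: "F = lin_af n ?Rb c" and ck: "\<And>i j. c i j \<in> k" and c0: "\<And>i j. (i, j) \<notin> ?Rb \<Longrightarrow> c i j = 0"
    using AF_imp_lin_af[OF k root_pattern_level AF_F, of ?b] assms(5) unfolding unip_radical_eq by blast
  have c_diag: "c i i = 0" for i by (rule c0) (simp add: level_pattern_def)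
  have c_Rb: "(i, j) \<in> ?Rb" if "c i j \<noteq> 0" for i j using c0 that by blast
  have c_less: "i < n \<and> j < n" if "c i j \<noteq> 0" for i j using c_Rb[OF that] by (simp add: level_pattern_def)
  have c_iso: "c i j = 0" if "(i, h) \<in> ?Rb" "(h, j) \<in> ?Rb" for i h j
    using AF_lin_af_isotropic[where c = c, OF root_pattern_level _ c_diag that] AF_F F by simp
  \<comment> \<open>An edge across an intermediate block would be a composite of two roots, where
    the coefficient of an additive function vanishes.\<close>
  have c_b: "?b j = Suc (?b i)" if "c i j \<noteq> 0" for i j
  proof (rule ccontr)
    assume "?b j \<noteq> Suc (?b i)"
    then have "Suc (?b i) < ?b j" using c_Rb[OF that] by (simp add: level_pattern_def)
    then obtain h where "h < n" "?b i < ?b h" "?b h < ?b j"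
      using block_level_between[OF ns conjunct2[OF c_less]] \<open>c i j \<noteq> 0\<close> by blast
    then have "c i j = 0" using c_less[OF that] by (intro c_iso[of i h j]) (auto simp: level_pattern_def)
    then show False using that by simp
  qed
  have c_hat: "i = i' \<and> j = j' \<or> i \<noteq> i' \<and> j \<noteq> j'" if "c i j \<noteq> 0" "c i' j' \<noteq> 0" for i j i' j'
    using hat[of i j i' j'] that unfolding F
    by (simp add: nontrivial_on_root_lin_af[where c = c, OF root_pattern_level c_diag c0]) blast
  have c_fun: "j = j'" if "c i j \<noteq> 0" "c i j' \<noteq> 0" for i j j' using c_hat[OF that] by blast
  have c_inj: "i = i'" if "c i j \<noteq> 0" "c i' j \<noteq> 0" for i i' j using c_hat[OF that] by blast
  have b_le: "?b i \<le> ?M" if "i < n" for i by (rule block_level_le[OF ns that])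
  have b_last: "?b i = ?M" if "r \<le> i" "i < n" for i
    using block_level_last[OF ns ns0] that by (simp add: r_def)
  obtain a where c_a: "\<And>i j. c i j \<noteq> 0 \<Longrightarrow> a j = Suc (a i)" and ab: "\<And>v. v < n \<Longrightarrow> ?b v \<le> a v"
    and aM: "\<And>v. a v \<le> ?M" and ends: "\<And>v. (\<And>w. c v w = 0) \<Longrightarrow> a v = ?M"
    using right_justified_level[of c n ?b ?M] c_less c_b c_fun b_le by blast
  have a_last: "a i = ?M" if "r \<le> i" "i < n" for i using ab[OF that(2)] aM[of i] b_last[OF that] by simp
  have inH: "pattern_group n R \<subseteq> H" if "root_pattern n R" "\<And>i j. (i, j) \<in> R \<Longrightarrow> i < r" for R
    unfolding H_def by (rule pattern_group_in_H[OF that r(1)])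
  have path: "(af_rel k n H)\<^sup>*\<^sup>* (lin_af n (level_pattern n a) c) F"
    unfolding F
    by (rule justified_path[where M = ?M and r = r, OF k ck c_less c_b c_a])
      (use c_fun c_inj ab aM ends inH b_last in blast)+
  have lvl_rows: "i < r" if "(i, j) \<in> level_pattern n l" "\<And>i. r \<le> i \<Longrightarrow> i < n \<Longrightarrow> l i = ?M" "\<And>j. j < n \<Longrightarrow> l j \<le> ?M"
    for l i j
    using that(1) that(2)[of i] that(3)[of j] by (cases "i < r") (auto simp: level_pattern_def)

  \<comment> \<open>Sorting the first \<open>r\<close> indices suffices: the others already have the
    top level. Therefore \<open>?\<gamma>\<close> can be taken in the corner group.\<close>
  obtain \<pi> where \<pi>: "\<pi> permutes {..<r}" "\<And>i j. i \<le> j \<Longrightarrow> j < r \<Longrightarrow> a (\<pi> i) \<le> a (\<pi> j)"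
    using sorting_permutation[of r a] by blast
  have \<pi>n: "\<pi> permutes {..<n}" using permutes_subset[OF \<pi>(1)] r(2) by auto
  have \<pi>_less: "\<pi> i < n" if "i < n" for i using permutes_in_image[OF \<pi>n, of i] that by simp
  have \<pi>_less_r: "\<pi> i < r" if "i < r" for i using permutes_in_image[OF \<pi>(1), of i] that by simp
  have \<pi>_id: "\<pi> i = i" if "r \<le> i" for i using permutes_not_in[OF \<pi>(1)] that by simp
  have \<pi>_inj: "inj \<pi>" by (rule permutes_inj[OF \<pi>n])
  have \<pi>_bij: "bij_betw \<pi> {..<n} {..<n}" by (rule permutes_imp_bij[OF \<pi>n])
  have \<pi>_surj: "\<exists>j<n. \<pi> j = i" if "i < n" for i
    using bij_betw_imp_surj_on[OF \<pi>_bij] that by (metis imageE lessThan_iff)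
  obtain \<epsilon> :: "nat \<Rightarrow> 'a" where \<epsilon>: "\<And>i. \<epsilon> i = 1 \<or> \<epsilon> i = - 1" "\<And>i. r \<le> i \<Longrightarrow> \<epsilon> i = 1"
    and det: "det (monomial_mat r \<pi> \<epsilon>) = 1"
    using monomial_mat_det_one[OF \<pi>_less_r inj_on_subset[OF \<pi>_inj subset_UNIV]] by blast
  have \<epsilon>2: "\<epsilon> i * \<epsilon> i = 1" for i using \<epsilon>(1)[of i] by auto
  have \<epsilon>k: "\<epsilon> i \<in> k" for i using \<epsilon>(1)[of i] subfieldD(2)[OF k] subfieldD(6)[OF k] by auto

  let ?\<gamma> = "monomial_mat n \<pi> \<epsilon>"
  have \<gamma>c: "?\<gamma> \<in> carrier_mat n n" by (simp add: monomial_mat_def)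
  note orth = monomial_mat_orthogonal[OF \<pi>_less inj_on_subset[OF \<pi>_inj subset_UNIV] \<epsilon>2]
  have \<gamma>GL: "?\<gamma>\<^sup>T \<in> carrier (GL n)" "inv\<^bsub>GL n\<^esub> ?\<gamma> = ?\<gamma>\<^sup>T" "inv\<^bsub>GL n\<^esub> ?\<gamma>\<^sup>T = ?\<gamma>"
    using GL_inv_eqI[OF \<gamma>c _ orth] GL_inv_eqI[OF _ \<gamma>c orth(2,1)] \<gamma>c by auto
  have \<gamma>SL: "?\<gamma> \<in> corner_SL n r"
  proof (rule corner_SL_I[OF \<gamma>c r(2)])
    have "mat r r (\<lambda>(i, j). ?\<gamma> $$ (i, j)) = monomial_mat r \<pi> \<epsilon>"
      using r(2) by (intro eq_matI) (auto simp: monomial_mat_def)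
    then show "det (mat r r (\<lambda>(i, j). ?\<gamma> $$ (i, j))) = 1" using det by simp
    show "?\<gamma> $$ (i, j) = (if i = j then 1 else 0)" if "i < n" "j < n" "r \<le> i \<or> r \<le> j" for i j
      using that \<pi>_id[of i] \<pi>_less_r[of i] \<epsilon>(2)[of i] by (cases "r \<le> i") (auto simp: monomial_mat_def)
  qed
  have \<gamma>TSL: "?\<gamma>\<^sup>T \<in> corner_SL n r"
  proof (rule corner_SL_I[OF _ r(2)])
    have "mat r r (\<lambda>(i, j). ?\<gamma>\<^sup>T $$ (i, j)) = (monomial_mat r \<pi> \<epsilon>)\<^sup>T"
      using r(2) by (intro eq_matI) (auto simp: monomial_mat_def)
    then show "det (mat r r (\<lambda>(i, j). ?\<gamma>\<^sup>T $$ (i, j))) = 1"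
      using det det_transpose[of "monomial_mat r \<pi> \<epsilon>" r] by (simp add: monomial_mat_def)
    show "?\<gamma>\<^sup>T $$ (i, j) = (if i = j then 1 else 0)" if "i < n" "j < n" "r \<le> i \<or> r \<le> j" for i j
      using that \<pi>_id[of j] \<pi>_less_r[of j] \<epsilon>(2)[of j] by (cases "r \<le> j") (auto simp: monomial_mat_def)
  qed (use \<gamma>c in simp)
  have \<gamma>k: "?\<gamma> \<in> k_points k (corner_SL n r)"
    using \<gamma>SL \<epsilon>k subfieldD(1)[OF k] by (auto simp: k_points_def monomial_mat_def)
  have "?\<gamma>\<^sup>T \<in> H"
  proof -
    have "1\<^sub>m n \<in> unip_radical n [r, last ns]" by (simp add: unip_radical_two_blocks[OF r(1)])
    moreover have "?\<gamma>\<^sup>T = ?\<gamma>\<^sup>T * 1\<^sub>m n" using \<gamma>c by simp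
    ultimately show ?thesis unfolding H_def set_mult_def using \<gamma>TSL by auto
  qed
  then have \<gamma>T: "?\<gamma>\<^sup>T \<in> k_points k (H \<inter> carrier (GL n))"
    using \<gamma>GL(1) \<epsilon>k subfieldD(1)[OF k] by (auto simp: k_points_def monomial_mat_def)

  \<comment> \<open>Levels and coefficients in the sorted basis, whose \<open>i\<close>-th vector is
    the old vector \<open>\<pi> i\<close> up to the sign \<open>\<epsilon> i\<close>.\<close>
  define L where "L i = a (\<pi> i)" for i
  define d where "d i j = \<epsilon> i * \<epsilon> j * c (\<pi> i) (\<pi> j)" for i j
  have d_nz: "d i j \<noteq> 0 \<longleftrightarrow> c (\<pi> i) (\<pi> j) \<noteq> 0" for i j
    using \<epsilon>2[of i] \<epsilon>2[of j] by (auto simp: d_def)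
  have dk: "d i j \<in> k" for i j unfolding d_def by (intro subfieldD(5)[OF k] \<epsilon>k ck)
  have \<pi>_less_iff: "\<pi> i < n \<longleftrightarrow> i < n" for i using permutes_in_image[OF \<pi>n, of i] by simp
  have L_last: "L i = ?M" if "r \<le> i" "i < n" for i using a_last[OF that] \<pi>_id[OF that(1)] by (simp add: L_def)
  interpret ch: chain_weights n d L ?M
  proof
    show "i < n \<and> j < n" if "d i j \<noteq> 0" for i j using that c_less \<pi>_less_iff unfolding d_nz by blast
    show "L j = Suc (L i)" if "d i j \<noteq> 0" for i j using that c_a unfolding d_nz L_def by blast
    show "j = j'" if "d i j \<noteq> 0" "d i j' \<noteq> 0" for i j j'
      using c_fun[of "\<pi> i" "\<pi> j" "\<pi> j'"] that injD[OF \<pi>_inj] unfolding d_nz by blast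
    show "i = i'" if "d i j \<noteq> 0" "d i' j \<noteq> 0" for i i' j
      using c_inj[of "\<pi> i" "\<pi> j" "\<pi> i'"] that injD[OF \<pi>_inj] unfolding d_nz by blast
    show "L i \<le> ?M" for i by (simp add: L_def aM)
    show "\<exists>j. d i j \<noteq> 0" if "i < n" "L i < ?M" for i
    proof -
      obtain w where w: "c (\<pi> i) w \<noteq> 0" using ends[of "\<pi> i"] \<open>L i < ?M\<close> by (auto simp: L_def)
      then obtain j where "\<pi> j = w" using \<pi>_surj c_less by blast
      then show ?thesis using w d_nz by blast
    qed
  qed
  let ?RL = "level_pattern n L"
  let ?Fbar = "lin_af n ?RL d"
  have d_diag: "d i i = 0" for i using ch.c_level[of i i] by auto
  have d_RL: "(i, j) \<in> ?RL" if "d i j \<noteq> 0" for i j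
    using ch.c_less[OF that] ch.c_level[OF that] by (simp add: level_pattern_def)
  have d_iso: "d i j = 0" if "(i, h) \<in> ?RL" "(h, j) \<in> ?RL" for i h j
    using that ch.c_level[of i j] by (force simp: level_pattern_def)
  have c_Ra: "(i, j) \<in> level_pattern n a" if "c i j \<noteq> 0" for i j
    using c_less[OF that] c_a[OF that] by (simp add: level_pattern_def)
  have c_iso_a: "c i j = 0" if "(i, h) \<in> level_pattern n a" "(h, j) \<in> level_pattern n a" for i h j
    using that c_a[of i j] by (force simp: level_pattern_def)
  have AFbar: "AF k n ?Fbar"
    by (rule AF_lin_af) (use k root_pattern_level dk d_diag d_iso in blast)+
  have AFa: "AF k n (lin_af n (level_pattern n a) c)"
    by (rule AF_lin_af) (use k root_pattern_level ck c_diag c_iso_a in blast)+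
  have domH: "pattern_group n ?RL \<subseteq> H" "pattern_group n (level_pattern n a) \<subseteq> H"
    using inH[OF root_pattern_level] lvl_rows[of _ _ L] lvl_rows[of _ _ a] L_last a_last aM
    by (auto simp: L_def)

  have mono: "L i \<le> L j" if "i \<le> j" "j < n" for i j
  proof (cases "j < r")
    case True
    then show ?thesis using \<pi>(2)[OF that(1)] by (simp add: L_def)
  next
    case False
    then show ?thesis using L_last[of j] that aM by (simp add: L_def)
  qed
  \<comment> \<open>Below the top level every vertex has a successor, so \<open>ch.nx\<close> embeds
    each level into the next; this is the origin of the increasing block sizes.\<close>
  have step: "card {v. v < n \<and> L v = t} \<le> card {v. v < n \<and> L v = Suc t}" if "t < ?M" for t
  proof (rule card_inj_on_le[where f = ch.nx])
    show "inj_on ch.nx {v. v < n \<and> L v = t}"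
    proof (rule inj_onI)
      fix x y assume xy: "x \<in> {v. v < n \<and> L v = t}" "y \<in> {v. v < n \<and> L v = t}" "ch.nx x = ch.nx y"
      then have "x < n" "L x < ?M" "y < n" "L y < ?M" using that by simp_all
      then show "x = y" using xy(3) by (rule ch.nx_inj)
    qed
    show "ch.nx ` {v. v < n \<and> L v = t} \<subseteq> {v. v < n \<and> L v = Suc t}"
    proof (rule image_subsetI)
      fix x assume x: "x \<in> {v. v < n \<and> L v = t}"
      then have "x < n" "L x < ?M" using that by simp_all
      then show "ch.nx x \<in> {v. v < n \<and> L v = Suc t}"
        using ch.nx_less[of x] ch.nx_level[of x] x by simp
    qed
  qed simp
  obtain ns' where ns': "composition n ns'" "sorted ns'" "unip_radical n ns' = (pattern_group n ?RL :: 'a mat set)"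
    by (rule level_composition[of n L ?M, OF mono n ch.L_le step])
  have nt: "nontrivial_on_root n ?Fbar i j \<longleftrightarrow> d i j \<noteq> 0" for i j
    by (rule nontrivial_on_root_lin_af[OF root_pattern_level d_diag]) (use d_RL in blast)
  have "?Fbar \<in> C_hat k n"
    unfolding C_hat_def C_class_def
  proof (intro CollectI conjI allI impI)
    show "\<exists>ns. composition n ns \<and> dom ?Fbar = unip_radical n ns" using ns' by auto
    fix i j i' j'
    assume *: "nontrivial_on_root n ?Fbar i j \<and> nontrivial_on_root n ?Fbar i' j' \<and> (i, j) \<noteq> (i', j')"
    then have nz: "d i j \<noteq> 0" "d i' j' \<noteq> 0" by (simp_all add: nt)
    show "i \<noteq> i'" using * nz ch.c_fun by blast
    show "j \<noteq> j'" using * nz ch.c_inj by blast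
  qed (rule AFbar)
  then have hat_le: "?Fbar \<in> C_hat_le k n" using ns' by (auto simp: C_hat_le_def)
  have Jbar: "J_of n ?Fbar = mat n n (\<lambda>(i, j). d j i)"
    by (rule J_of_lin_af[OF root_pattern_level d_RL d_iso])
  have JF: "J_of n F = mat n n (\<lambda>(i, j). c j i)"
    unfolding F by (rule J_of_lin_af[OF root_pattern_level c_Rb c_iso])
  \<comment> \<open>The Richardson orbit was found for the coefficient matrix, while
    \<open>J_of\<close> is its transpose; \<open>similar_transpose\<close> closes the gap.\<close>
  have cap: "?Fbar \<in> cap_B n (C_hat_le k n)"
    unfolding cap_B_def using hat_le ch.richardson_orbit_G ch.similar_transpose by (auto simp: Jbar)
  have J: "J_of n ?Fbar = ?\<gamma> * J_of n F * inv\<^bsub>GL n\<^esub> ?\<gamma>"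
    unfolding Jbar JF \<gamma>GL(2)
  proof (rule eq_matI)
    let ?J = "mat n n (\<lambda>(i, j). c j i)"
    fix i j assume "i < dim_row (?\<gamma> * ?J * ?\<gamma>\<^sup>T)" "j < dim_col (?\<gamma> * ?J * ?\<gamma>\<^sup>T)"
    then have ij: "i < n" "j < n" using \<gamma>c by auto
    show "mat n n (\<lambda>(i, j). d j i) $$ (i, j) = (?\<gamma> * ?J * ?\<gamma>\<^sup>T) $$ (i, j)"
      using ij \<pi>_less by (subst monomial_mat_conj) (auto simp: d_def)
  qed (use \<gamma>c in auto)

  \<comment> \<open>The path starts at \<open>?Fbar\<close>, so the co-step undoes the sorting and
    uses the inverse of \<open>?\<gamma>\<close>, which is its transpose.\<close>
  have "lin_af n (level_pattern n a) c = conj_af n ?\<gamma>\<^sup>T ?Fbar"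
  proof
    fix u :: "'a mat"
    let ?w = "?\<gamma> * u * ?\<gamma>\<^sup>T"
    show "lin_af n (level_pattern n a) c u = conj_af n ?\<gamma>\<^sup>T ?Fbar u"
    proof (cases "u \<in> carrier_mat n n")
      case True
      define w where "w = ?w"
      have wc: "w \<in> carrier_mat n n"
        unfolding w_def using True \<gamma>c by (simp add: mult_carrier_mat[of _ n n _ n])
      have w: "w $$ (i, j) = \<epsilon> i * \<epsilon> j * u $$ (\<pi> i, \<pi> j)" if "i < n" "j < n" for i j
        unfolding w_def by (rule monomial_mat_conj[OF \<pi>_less True that])
      have e1: "\<epsilon> i * \<epsilon> j * x = (if i = j then 1 else 0) \<longleftrightarrow> x = (if \<pi> i = \<pi> j then 1 else 0)" for i j and x :: 'a
        using \<epsilon>2[of i] \<epsilon>(1)[of i] \<epsilon>(1)[of j] inj_eq[OF \<pi>_inj, of i j] by auto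
      have e2: "w $$ (i, j) = (if i = j then 1 else 0) \<longleftrightarrow> u $$ (\<pi> i, \<pi> j) = (if \<pi> i = \<pi> j then 1 else 0)"
        if "i < n" "j < n" for i j
        unfolding w[OF that] by (rule e1)
      have "w \<in> pattern_group n ?RL \<longleftrightarrow>
          (\<forall>i<n. \<forall>j<n. \<not> L i < L j \<longrightarrow> w $$ (i, j) = (if i = j then 1 else 0))"
        using wc by (auto simp: pattern_group_def level_pattern_def)
      also have "\<dots> \<longleftrightarrow> (\<forall>i<n. \<forall>j<n. \<not> L i < L j \<longrightarrow> u $$ (\<pi> i, \<pi> j) = (if \<pi> i = \<pi> j then 1 else 0))"
        using e2 by blast
      also have "\<dots> \<longleftrightarrow> (\<forall>i<n. \<forall>j<n. \<not> a i < a j \<longrightarrow> u $$ (i, j) = (if i = j then 1 else 0))"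
        unfolding L_def using \<pi>_surj \<pi>_less by metis
      also have "\<dots> \<longleftrightarrow> u \<in> pattern_group n (level_pattern n a)"
        using True by (auto simp: pattern_group_def level_pattern_def)
      finally have mem: "w \<in> pattern_group n ?RL \<longleftrightarrow> u \<in> pattern_group n (level_pattern n a)" .
      have "entry_form n d w = (\<Sum>i<n. \<Sum>j<n. c (\<pi> i) (\<pi> j) * u $$ (\<pi> i, \<pi> j))"
        unfolding entry_form_def
      proof (intro sum.cong refl)
        fix i j assume "i \<in> {..<n}" "j \<in> {..<n}"
        then have ij: "i < n" "j < n" by auto
        have "d i j * w $$ (i, j) = (\<epsilon> i * \<epsilon> i) * (\<epsilon> j * \<epsilon> j) * (c (\<pi> i) (\<pi> j) * u $$ (\<pi> i, \<pi> j))"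
          unfolding w[OF ij] d_def by (simp only: ac_simps)
        then show "d i j * w $$ (i, j) = c (\<pi> i) (\<pi> j) * u $$ (\<pi> i, \<pi> j)" by (simp add: \<epsilon>2)
      qed
      also have "\<dots> = (\<Sum>i<n. \<Sum>j<n. c (\<pi> i) j * u $$ (\<pi> i, j))"
        by (intro sum.cong refl sum.reindex_bij_betw[OF \<pi>_bij])
      also have "\<dots> = entry_form n c u"
        unfolding entry_form_def by (rule sum.reindex_bij_betw[OF \<pi>_bij, of "\<lambda>i. \<Sum>j<n. c i j * u $$ (i, j)"])
      finally show ?thesis using True mem by (simp add: conj_af_def lin_af_def \<gamma>GL(3) w_def)
    next
      case False
      then show ?thesis by (auto simp: conj_af_def lin_af_def restrict_map_def dest: pattern_groupD(1))
    qed
  qed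
  then have "co_step n (k_points k (H \<inter> carrier (GL n))) ?Fbar (lin_af n (level_pattern n a) c)"
    unfolding co_step_def using \<gamma>T by blast
  then have "af_rel k n H ?Fbar (lin_af n (level_pattern n a) c)"
    using AFbar AFa domH by (simp add: af_rel_def af_step_def)
  then have "(af_rel k n H)\<^sup>*\<^sup>* ?Fbar F" using path by (rule converse_rtranclp_into_rtranclp)
  then have "\<exists>Fs. af_path k n H ?Fbar F Fs" by (rule af_rel_path) (use AFbar domH in simp_all)
  then show ?thesis using cap domH J \<gamma>k by (intro exI[of _ ?Fbar]) auto
qed

end
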